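(* Let $A$ be a finite alphabet and $L\subseteq A^*$. If $L$ is definable by a sentence of $FO^2[<,\mathrm{Inv}]$, then its syntactic monoid $M(L)$ belongs to $\mathbf{M}_e\mathbf{DA}$. Further, if $|A|=2$ and $M(L)\in\mathbf{M}_e\mathbf{DA}$, then $L$ is definable in $FO^2[<,\mathrm{Inv}]$.
   Context: $FO^2[<,\mathrm{Inv}]$ is two-variable first-order logic over finite words with $<$, unary letter predicates $a(x)$, and binary predicates $a(x,y)$ meaning that the letter $a$ occurs at some position strictly between $x$ and $y$; sentences define languages (in the empty word existential sentences are false, universal ones true). The syntactic monoid $M(L)$ of a regular language $L$ is the transition monoid of its minimal deterministic automaton (the smallest monoid recognizing $L$ via a homomorphism $A^*\to M$ and a subset). For a finite monoid $M$: $m_1\le_{\mathcal J}m_2$ iff $m_1=sm_2t$ for some $s,t\in M$; for an idempotent $e$ ($e^2=e$), $M_e$ is the submonoid generated by all $m$ with $e\le_{\mathcal J}m$. $\mathbf{DA}$ is the class of finite monoids $M$ such that $eM_ee=\{e\}$ for every idempotent $e\in M$. $\mathbf{M}_e\mathbf{DA}$ is the class of finite monoids $M$ such that $eM_ee\in\mathbf{DA}$ for every idempotent $e\in M$. *)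

theory Defs
  imports "HOL-Algebra.Group"
begin

datatype var = VX | VY

datatype 'a fo2 =
    FTrue
  | FNot "'a fo2"
  | FAnd "'a fo2" "'a fo2"
  | FEx var "'a fo2"
  | FLess var var
  | FEq var var
  | FLetter 'a var
  | FInv 'a var var

fun fv :: "'a fo2 \<Rightarrow> var set" where
  "fv FTrue = {}"
| "fv (FNot f) = fv f"
| "fv (FAnd f g) = fv f \<union> fv g"
| "fv (FEx v f) = fv f - {v}"
| "fv (FLess u v) = {u, v}"
| "fv (FEq u v) = {u, v}"
| "fv (FLetter a v) = {v}"
| "fv (FInv a u v) = {u, v}"

fun sat :: "'a list \<Rightarrow> (var \<Rightarrow> nat) \<Rightarrow> 'a fo2 \<Rightarrow> bool" where
  "sat w \<sigma> FTrue = True"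
| "sat w \<sigma> (FNot f) = (\<not> sat w \<sigma> f)"
| "sat w \<sigma> (FAnd f g) = (sat w \<sigma> f \<and> sat w \<sigma> g)"
| "sat w \<sigma> (FEx v f) = (\<exists>i < length w. sat w (\<sigma>(v := i)) f)"
| "sat w \<sigma> (FLess u v) = (\<sigma> u < \<sigma> v)"
| "sat w \<sigma> (FEq u v) = (\<sigma> u = \<sigma> v)"
| "sat w \<sigma> (FLetter a v) = (\<sigma> v < length w \<and> w ! (\<sigma> v) = a)"
| "sat w \<sigma> (FInv a u v) =
     (\<exists>k. min (\<sigma> u) (\<sigma> v) < k \<and> k < max (\<sigma> u) (\<sigma> v) \<and> k < length w \<and> w ! k = a)"

definition sentence :: "'a fo2 \<Rightarrow> bool" where
  "sentence f \<longleftrightarrow> fv f = {}"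

definition FO2Inv_definable :: "'a list set \<Rightarrow> bool" where
  "FO2Inv_definable L \<longleftrightarrow>
     (\<exists>f. sentence f \<and> L = {w. sat w (\<lambda>_. 0) f})"

definition synclass :: "'a list set \<Rightarrow> 'a list \<Rightarrow> 'a list set" where
  "synclass L u = {v. \<forall>x y. (x @ u @ y \<in> L) \<longleftrightarrow> (x @ v @ y \<in> L)}"

definition synrep :: "'a list set \<Rightarrow> 'a list set \<Rightarrow> 'a list" where
  "synrep L X = (SOME u. X = synclass L u)"

definition syntactic_monoid :: "'a list set \<Rightarrow> 'a list set monoid" where
  "syntactic_monoid L =
     \<lparr> carrier = range (synclass L),
       mult = (\<lambda>X Y. synclass L (synrep L X @ synrep L Y)),
       one = synclass L [] \<rparr>"

definition J_le :: "('b, 'c) monoid_scheme \<Rightarrow> 'b \<Rightarrow> 'b \<Rightarrow> bool" where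
  "J_le M m1 m2 \<longleftrightarrow> (\<exists>s \<in> carrier M. \<exists>t \<in> carrier M. m1 = s \<otimes>\<^bsub>M\<^esub> m2 \<otimes>\<^bsub>M\<^esub> t)"

definition idem :: "('b, 'c) monoid_scheme \<Rightarrow> 'b \<Rightarrow> bool" where
  "idem M e \<longleftrightarrow> e \<in> carrier M \<and> e \<otimes>\<^bsub>M\<^esub> e = e"

definition gen_submonoid :: "('b, 'c) monoid_scheme \<Rightarrow> 'b set \<Rightarrow> 'b set" where
  "gen_submonoid M S = \<Inter> {N. submonoid N M \<and> S \<subseteq> N}"

definition Me :: "('b, 'c) monoid_scheme \<Rightarrow> 'b \<Rightarrow> 'b set" where
  "Me M e = gen_submonoid M {m \<in> carrier M. J_le M e m}"

definition eMe_e :: "('b, 'c) monoid_scheme \<Rightarrow> 'b \<Rightarrow> 'b set" where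
  "eMe_e M e = {e \<otimes>\<^bsub>M\<^esub> m \<otimes>\<^bsub>M\<^esub> e | m. m \<in> Me M e}"

definition local_monoid :: "('b, 'c) monoid_scheme \<Rightarrow> 'b \<Rightarrow> 'b monoid" where
  "local_monoid M e = \<lparr> carrier = eMe_e M e, mult = mult M, one = e \<rparr>"

definition DA :: "('b, 'c) monoid_scheme \<Rightarrow> bool" where
  "DA M \<longleftrightarrow> monoid M \<and> finite (carrier M) \<and>
     (\<forall>e. idem M e \<longrightarrow> eMe_e M e = {e})"

definition MeDA :: "('b, 'c) monoid_scheme \<Rightarrow> bool" where
  "MeDA M \<longleftrightarrow> monoid M \<and> finite (carrier M) \<and>
     (\<forall>e. idem M e \<longrightarrow> DA (local_monoid M e))"

end

theory Submission
  imports Defs "HOL-Library.Countable_Set"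
begin

text \<open>
  Necessity.  Two-pebble games show that the syntactic congruence of a definable language has finite
  index.  Given an idempotent \<open>e\<close>, choose a word \<open>E\<close> for it in which every letter \<open>\<J>\<close>-above \<open>e\<close>
  occurs.  Between positions separated by a copy of \<open>E\<close> all these letters occur, so in words
  composed of long powers of \<open>E\<close> and factors \<open>E v E\<close> the between predicates are useless except
  locally, and the game degenerates to the one for the order.  That game does not distinguish
  \<open>F^n m F^n\<close> from \<open>F^n F^n\<close> if all factors of \<open>m\<close> occur in \<open>F\<close>, and this is the identity of \<open>DA\<close> in
  the local monoid.

  Sufficiency.  Over two letters, cut a word into blocks \<open>a^i b^j\<close>; exponents matter only up to a
  threshold because the monoid is aperiodic.  Every nonempty product of blocks contains both letters,
  so an idempotent \<open>e\<close> represented by blocks has \<open>M_e = M\<close> and \<open>e M e\<close> is in \<open>DA\<close>.  Take windows of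
  \<open>|M|\<close> blocks; each contains a place that absorbs an idempotent.  When a word is read from the left,
  the \<open>\<R>\<close>-class can only drop shortly after the previous drop or at a window not seen since then,
  because \<open>DA\<close> in the local monoid would otherwise undo the drop.  Drops are therefore first
  occurrences of windows, and induction on the set of admitted windows makes \<open>\<R>\<close>-classes, dually
  \<open>\<L>\<close>-classes, and hence by aperiodicity values, definable in a temporal logic on blocks, which
  translates into the two-variable logic on letters.
\<close>

section \<open>The syntactic monoid\<close>

text \<open>Adjacent factors remain recognisable as neighbours in the game, so successor survives
  beside the order. Each factor \<open>E v E\<close> is therefore padded on both sides with as many
  copies of \<open>E\<close> as there are rounds. A neighbourhood then shows at most one such
  factor, and the monoid does not notice the padding because \<open>E\<close> is idempotent. For the
  converse, an idempotent given by powers of a single letter may have a small \<open>M_e\<close>;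
  this is why runs are hidden inside the letters of a new alphabet before \<R>-classes are read. The
  \<R>-class after a drop depends on the exact value of what was read before, not only on its
  \<R>-class. The induction must therefore deliver values, which requires combining both reading
  directions at every stage. It closes because the part before the first occurrence of a window
  admits one window fewer, and because the properties asked of the congruence are invariant under
  reversal. The recorded windows are one letter longer than the number of values: they include the
  letter read at the drop, since only a repetition of the same step can be undone by the
  identity.\<close>

definition pw :: "nat \<Rightarrow> 'a list \<Rightarrow> 'a list" where
  "pw k u = concat (replicate k u)"

lemma pw_0 [simp]: "pw 0 u = []"
  by (simp add: pw_def)

lemma pw_Suc [simp]: "pw (Suc k) u = u @ pw k u"
  by (simp add: pw_def)

lemma pw_add: "pw (k + l) u = pw k u @ pw l u"
  by (induction k) auto

lemma pw_1: "pw 1 u = u"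
  by simp

lemma set_pw_subset: "set (pw k u) \<subseteq> set u"
  by (induction k) auto

lemma pw_commute: "u @ pw k u = pw k u @ u"
  by (induction k) auto

lemma rev_pw: "rev (pw k u) = pw k (rev u)"
  by (induction k) (auto simp: pw_commute)

lemma synclass_eq_iff:
  "synclass L u = synclass L v \<longleftrightarrow> (\<forall>x y. (x @ u @ y \<in> L) \<longleftrightarrow> (x @ v @ y \<in> L))"
  by (auto simp: synclass_def)

lemma synclass_append_cong:
  assumes "synclass L u = synclass L u'" and "synclass L v = synclass L v'"
  shows "synclass L (u @ v) = synclass L (u' @ v')"
proof -
  have "(x @ (u @ v) @ y \<in> L) = (x @ (u' @ v') @ y \<in> L)" for x y
  proof -
    have "(x @ (u @ v) @ y \<in> L) = (x @ u @ (v @ y) \<in> L)" by simp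
    also have "\<dots> = (x @ u' @ (v @ y) \<in> L)"
      using assms(1) unfolding synclass_eq_iff by blast
    also have "\<dots> = ((x @ u') @ v @ y \<in> L)" by simp
    also have "\<dots> = ((x @ u') @ v' @ y \<in> L)"
      using assms(2) unfolding synclass_eq_iff by blast
    finally show ?thesis by simp
  qed
  then show ?thesis by (simp add: synclass_eq_iff)
qed

lemma synclass_mem: "synclass L u = synclass L v \<Longrightarrow> u \<in> L \<longleftrightarrow> v \<in> L"
  unfolding synclass_eq_iff by (metis append.left_neutral append.right_neutral)

lemma synclass_synrep [simp]: "synclass L (synrep L (synclass L u)) = synclass L u"
  unfolding synrep_def by (metis (mono_tags, lifting) someI)

lemma syntactic_monoid_simps [simp]:
  "carrier (syntactic_monoid L) = range (synclass L)"
  "\<one>\<^bsub>syntactic_monoid L\<^esub> = synclass L []"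
  "synclass L u \<otimes>\<^bsub>syntactic_monoid L\<^esub> synclass L v = synclass L (u @ v)"
  by (simp_all add: syntactic_monoid_def synclass_append_cong[OF synclass_synrep synclass_synrep])

lemma monoid_syntactic_monoid: "monoid (syntactic_monoid L)"
  by (rule monoidI) auto

lemma J_le_synclass:
  "J_le (syntactic_monoid L) (synclass L u) (synclass L v) \<longleftrightarrow>
     (\<exists>s t. synclass L u = synclass L (s @ v @ t))"
  by (auto simp: J_le_def)

section \<open>The submonoid M_e and the local monoid, described by words\<close>

lemma submonoid_gen_submonoid:
  assumes "monoid M" and "S \<subseteq> carrier M"
  shows "submonoid (gen_submonoid M S) M"
proof -
  interpret monoid M by fact
  have "submonoid (carrier M) M"
    by unfold_locales auto
  with assms(2) have "gen_submonoid M S \<subseteq> carrier M"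
    unfolding gen_submonoid_def by (intro Inter_lower CollectI conjI)
  then show ?thesis
    unfolding gen_submonoid_def
    by (intro submonoid.intro) (auto intro: submonoid.m_closed submonoid.one_closed)
qed

lemma gen_submonoid_incl: "S \<subseteq> gen_submonoid M S"
  by (auto simp: gen_submonoid_def)

lemma gen_submonoid_minimal: "submonoid N M \<Longrightarrow> S \<subseteq> N \<Longrightarrow> gen_submonoid M S \<subseteq> N"
  by (auto simp: gen_submonoid_def)

definition letters_above :: "'a list set \<Rightarrow> 'a list \<Rightarrow> 'a set" where
  "letters_above L x = {c. \<exists>s t. synclass L x = synclass L (s @ [c] @ t)}"

lemma set_subset_letters_above:
  assumes "synclass L x = synclass L y"
  shows "set y \<subseteq> letters_above L x"
proof
  fix c assume "c \<in> set y"
  then obtain s t where "y = s @ [c] @ t" by (auto simp: in_set_conv_decomp)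
  with assms show "c \<in> letters_above L x" unfolding letters_above_def by blast
qed

text \<open>A factor of an element \<J>-above \<open>e\<close> is again above \<open>e\<close>, so a
  word for such an element uses letters above \<open>e\<close> only; conversely these letters are
  themselves among the generators.\<close>

lemma Me_syntactic_monoid:
  "Me (syntactic_monoid L) (synclass L x) = synclass L ` lists (letters_above L x)"
  (is "Me ?M ?e = _ ` lists ?B")
proof
  have "submonoid (synclass L ` lists ?B) ?M"
    by unfold_locales (auto intro!: image_eqI)
  moreover have "{m \<in> carrier ?M. J_le ?M ?e m} \<subseteq> synclass L ` lists ?B"
  proof
    fix m assume "m \<in> {m \<in> carrier ?M. J_le ?M ?e m}"
    then obtain u s t where "m = synclass L u" "?e = synclass L (s @ u @ t)"
      by (auto simp: J_le_synclass)
    with set_subset_letters_above[of L x "s @ u @ t"] show "m \<in> synclass L ` lists ?B"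
      by auto
  qed
  ultimately show "Me ?M ?e \<subseteq> synclass L ` lists ?B"
    unfolding Me_def by (rule gen_submonoid_minimal)
next
  let ?N = "Me ?M ?e"
  have sub: "submonoid ?N ?M"
    unfolding Me_def by (rule submonoid_gen_submonoid[OF monoid_syntactic_monoid]) auto
  have "synclass L u \<in> ?N" if "set u \<subseteq> ?B" for u
    using that
  proof (induction u)
    case Nil
    then show ?case using submonoid.one_closed[OF sub] by simp
  next
    case (Cons c u)
    have "synclass L [c] \<in> ?N"
      unfolding Me_def using Cons.prems
      by (intro subsetD[OF gen_submonoid_incl]) (auto simp: J_le_synclass letters_above_def)
    moreover have "synclass L u \<in> ?N" using Cons by auto
    ultimately have "synclass L [c] \<otimes>\<^bsub>?M\<^esub> synclass L u \<in> ?N"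
      by (rule submonoid.m_closed[OF sub])
    then show ?case by simp
  qed
  then show "synclass L ` lists ?B \<subseteq> ?N" by auto
qed

lemma eMe_e_syntactic_monoid:
  "eMe_e (syntactic_monoid L) (synclass L x) =
     (\<lambda>u. synclass L (x @ u @ x)) ` lists (letters_above L x)"
proof -
  have "eMe_e (syntactic_monoid L) (synclass L x) =
    (\<lambda>m. synclass L x \<otimes>\<^bsub>syntactic_monoid L\<^esub> m \<otimes>\<^bsub>syntactic_monoid L\<^esub> synclass L x) `
      synclass L ` lists (letters_above L x)"
    unfolding eMe_e_def Me_syntactic_monoid by blast
  then show ?thesis by (simp add: image_image)
qed

lemma monoid_local_monoid:
  assumes "synclass L (x @ x) = synclass L x"
  shows "monoid (local_monoid (syntactic_monoid L) (synclass L x))" (is "monoid ?N")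
proof (rule monoidI)
  let ?B = "letters_above L x"
  have xB: "set x \<subseteq> ?B" by (rule set_subset_letters_above) simp
  have absorb: "synclass L (x @ x @ u) = synclass L (x @ u)"
    "synclass L (u @ x @ x) = synclass L (u @ x)" for u
    using synclass_append_cong[OF assms refl] synclass_append_cong[OF refl assms] by simp_all
  have carr: "carrier ?N = (\<lambda>u. synclass L (x @ u @ x)) ` lists ?B"
    by (simp add: local_monoid_def eMe_e_syntactic_monoid)
  have mult: "m \<otimes>\<^bsub>?N\<^esub> m' = m \<otimes>\<^bsub>syntactic_monoid L\<^esub> m'" for m m'
    by (simp add: local_monoid_def)
  have one: "\<one>\<^bsub>?N\<^esub> = synclass L x" by (simp add: local_monoid_def)
  show "m \<otimes>\<^bsub>?N\<^esub> m' \<in> carrier ?N" if "m \<in> carrier ?N" "m' \<in> carrier ?N" for m m'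
  proof -
    from that obtain u u' where "set u \<subseteq> ?B" "set u' \<subseteq> ?B"
      "m = synclass L (x @ u @ x)" "m' = synclass L (x @ u' @ x)"
      unfolding carr by auto
    then show ?thesis
      unfolding carr mult using xB by (auto intro!: image_eqI[of _ _ "u @ x @ x @ u'"])
  qed
  show "\<one>\<^bsub>?N\<^esub> \<in> carrier ?N"
    unfolding carr one by (rule image_eqI[of _ _ "[]"]) (simp_all add: assms)
  show "m1 \<otimes>\<^bsub>?N\<^esub> m2 \<otimes>\<^bsub>?N\<^esub> m3 = m1 \<otimes>\<^bsub>?N\<^esub> (m2 \<otimes>\<^bsub>?N\<^esub> m3)"
    if "m1 \<in> carrier ?N" "m2 \<in> carrier ?N" "m3 \<in> carrier ?N" for m1 m2 m3
  proof -
    from that obtain u1 u2 u3 where "m1 = synclass L u1" "m2 = synclass L u2" "m3 = synclass L u3"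
      unfolding carr by blast
    then show ?thesis by (simp add: mult)
  qed
  show "\<one>\<^bsub>?N\<^esub> \<otimes>\<^bsub>?N\<^esub> m = m" "m \<otimes>\<^bsub>?N\<^esub> \<one>\<^bsub>?N\<^esub> = m" if "m \<in> carrier ?N" for m
  proof -
    from that obtain u where m: "m = synclass L (x @ u @ x)" unfolding carr by auto
    show "\<one>\<^bsub>?N\<^esub> \<otimes>\<^bsub>?N\<^esub> m = m" "m \<otimes>\<^bsub>?N\<^esub> \<one>\<^bsub>?N\<^esub> = m"
      using absorb(1)[of "u @ x"] absorb(2)[of "x @ u"] by (simp_all add: mult one m)
  qed
qed

section \<open>Idempotent powers, the identity of DA and aperiodicity\<close>

lemma finite_idempotent_power:
  assumes "finite (range (synclass L))"
  obtains k where "k \<ge> 1" "synclass L (pw k u @ pw k u) = synclass L (pw k u)"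
proof -
  have "finite (range (\<lambda>k. synclass L (pw k u)))"
    by (rule finite_subset[OF _ assms]) auto
  then have "\<not> inj (\<lambda>k. synclass L (pw k u))"
    using finite_imageD infinite_UNIV_nat by blast
  then obtain i j where "i \<noteq> j" "synclass L (pw i u) = synclass L (pw j u)"
    by (auto simp: inj_def)
  then obtain i j where "i < j" and ij: "synclass L (pw i u) = synclass L (pw j u)"
    by (metis nat_neq_iff)
  define p where "p = j - i"
  have p: "p \<ge> 1" and eq: "synclass L (pw i u) = synclass L (pw (i + p) u)"
    using \<open>i < j\<close> ij by (auto simp: p_def)
  have step: "synclass L (pw (i + l) u) = synclass L (pw (i + l + p) u)" for l
    using synclass_append_cong[OF eq refl, of "pw l u"]
    by (simp add: pw_add[symmetric] add_ac)
  have iter: "synclass L (pw (i + l) u) = synclass L (pw (i + l + m * p) u)" for l m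
  proof (induction m)
    case (Suc m)
    with step[of "l + m * p"] show ?case by (simp add: add_ac)
  qed simp
  \<comment> \<open>A multiple of the period that is at least i: from exponent i on, adding
    \<open>i + 1\<close> periods changes nothing, so \<open>pw k u\<close> is equivalent to its
    square.\<close>
  define k where "k = (i + 1) * p"
  have "i \<le> k" using p by (cases p) (auto simp: k_def)
  then have "synclass L (pw k u) = synclass L (pw (k + k) u)"
    using iter[of "k - i" "i + 1"] by (simp add: k_def)
  moreover have "k \<ge> 1" using p by (simp add: k_def)
  ultimately show ?thesis using that by (simp add: pw_add)
qed

text \<open>The factorisation of \<open>f\<close> places \<open>x m x\<close> \<J>-above
  \<open>f\<close> inside the local monoid at \<open>x\<close>, so the DA law at the idempotent
  \<open>f\<close> absorbs it. The letters of \<open>s\<close>, \<open>m\<close> and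
  \<open>t\<close> occur in \<open>x\<close>, which puts these words, flanked by \<open>x\<close>,
  into the local monoid.\<close>

lemma MeDA_identity:
  assumes "MeDA (syntactic_monoid L)"
    and idem: "synclass L (x @ x) = synclass L x" "synclass L (f @ f) = synclass L f"
    and sub: "set s \<subseteq> set x" "set m \<subseteq> set x" "set t \<subseteq> set x"
    and f: "synclass L f = synclass L (x @ s @ x @ m @ x @ t @ x)"
  shows "synclass L (f @ x @ m @ x @ f) = synclass L f"
proof -
  let ?M = "syntactic_monoid L"
  let ?e = "synclass L x"
  let ?N = "local_monoid ?M ?e"
  let ?B = "letters_above L x"
  have B: "set x \<subseteq> ?B" by (rule set_subset_letters_above) simp
  have absorb: "synclass L (v @ x @ x @ u) = synclass L (v @ x @ u)" for v u
    using synclass_append_cong[OF refl synclass_append_cong[OF idem(1) refl]] by simp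
  have carr: "carrier ?N = (\<lambda>u. synclass L (x @ u @ x)) ` lists ?B"
    by (simp add: local_monoid_def eMe_e_syntactic_monoid)
  have mult: "m \<otimes>\<^bsub>?N\<^esub> m' = m \<otimes>\<^bsub>?M\<^esub> m'" for m m'
    by (simp add: local_monoid_def)
  have inN: "synclass L (x @ u @ x) \<in> carrier ?N" if "set u \<subseteq> set x" for u
    using that B unfolding carr by auto
  have "Defs.idem ?M ?e" using idem by (simp add: idem_def)
  then have DA: "DA ?N" using assms(1) by (auto simp: MeDA_def)
  have "synclass L f \<in> carrier ?N"
    unfolding f using inN[of "s @ x @ m @ x @ t"] sub by simp
  then have "Defs.idem ?N (synclass L f)" using idem by (simp add: idem_def mult)
  then have *: "eMe_e ?N (synclass L f) = {synclass L f}" using DA by (auto simp: DA_def)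
  have "J_le ?N (synclass L f) (synclass L (x @ m @ x))"
    unfolding J_le_def
    by (rule bexI[OF _ inN[OF sub(1)]], rule bexI[OF _ inN[OF sub(3)]])
      (use absorb[of "x @ s" "m @ x @ x @ t @ x"] absorb[of "x @ s @ x @ m" "t @ x"] in \<open>simp add: mult f\<close>)
  then have "synclass L (x @ m @ x) \<in> Me ?N (synclass L f)"
    unfolding Me_def by (intro subsetD[OF gen_submonoid_incl] CollectI conjI inN sub)
  then have "synclass L f \<otimes>\<^bsub>?N\<^esub> synclass L (x @ m @ x) \<otimes>\<^bsub>?N\<^esub> synclass L f \<in> eMe_e ?N (synclass L f)"
    unfolding eMe_e_def by blast
  then have "synclass L f \<otimes>\<^bsub>?N\<^esub> synclass L (x @ m @ x) \<otimes>\<^bsub>?N\<^esub> synclass L f = synclass L f"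
    by (simp only: * singleton_iff)
  then show ?thesis by (simp add: mult)
qed

text \<open>For \<open>x = f = pw k u\<close> idempotent, \<open>f\<close> factors through
  \<open>u\<close> by a word of total exponent 5k, where \<open>pw l u\<close> with
  \<open>l = k - 1\<close> fills the exponent up to a multiple of k. Absorbing \<open>u\<close>
  makes exponent 4k + 1 equivalent to k, and 4k + 1 also reduces to k + 1.\<close>

lemma MeDA_aperiodic:
  assumes "MeDA (syntactic_monoid L)"
  obtains k where "k \<ge> 1" "synclass L (pw (Suc k) u) = synclass L (pw k u)"
proof -
  have "finite (range (synclass L))" using assms by (simp add: MeDA_def)
  then obtain k where k: "k \<ge> 1" "synclass L (pw k u @ pw k u) = synclass L (pw k u)"
    by (rule finite_idempotent_power)
  show ?thesis
  proof (cases "u = []")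
    case False
    let ?x = "pw k u"
    have k2: "synclass L (pw (k + k + j) u) = synclass L (pw (k + j) u)" for j
      using synclass_append_cong[OF k(2) refl, of "pw j u"] by (simp add: pw_add)
    obtain l where l: "k = Suc l" using k(1) by (cases k) auto
    have sub: "set u \<subseteq> set ?x" by (simp add: l)
    have sub': "set (pw l u) \<subseteq> set ?x" using sub set_pw_subset by fastforce
    have red: "synclass L (pw (j * k + k) u) = synclass L (pw k u)" for j
    proof (induction j)
      case (Suc j)
      with k2[of "j * k"] show ?case by (simp add: add_ac)
    qed simp
    have "synclass L (?x @ pw l u @ ?x @ u @ ?x @ [] @ ?x) = synclass L (pw (4 * k + k) u)"
    proof -
      have "?x @ pw l u @ ?x @ u @ ?x @ [] @ ?x = pw (k + (l + (k + (1 + (k + k))))) u"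
        by (simp only: pw_add pw_1 append_Nil)
      also have "k + (l + (k + (1 + (k + k)))) = 4 * k + k" by (simp add: l)
      finally show ?thesis by simp
    qed
    then have "synclass L ?x = synclass L (?x @ pw l u @ ?x @ u @ ?x @ [] @ ?x)"
      using red[of 4] by metis
    from MeDA_identity[OF assms k(2) k(2) sub' sub _ this]
    have eq: "synclass L (?x @ ?x @ u @ ?x @ ?x) = synclass L ?x" by simp
    have "?x @ ?x @ u @ ?x @ ?x = pw (k + (k + (1 + (k + k)))) u"
      by (simp only: pw_add pw_1)
    also have "k + (k + (1 + (k + k))) = 3 * k + k + 1" by simp
    finally have "?x @ ?x @ u @ ?x @ ?x = pw (3 * k + k + 1) u" .
    moreover have "synclass L (pw (3 * k + k + 1) u) = synclass L (pw (Suc k) u)"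
      using synclass_append_cong[OF red[of 3] refl, of u]
      by (simp only: pw_add pw_1 pw_Suc pw_commute append.assoc)
    ultimately show ?thesis using that[OF k(1)] eq by simp
  next
    case True
    then have "pw k u = []" for k by (induction k) auto
    then show ?thesis by (intro that[of 1]) simp_all
  qed
qed

lemma MeDA_aperiodic_uniform:
  assumes "MeDA (syntactic_monoid L)"
  obtains k where "k \<ge> 1" "\<And>l. l \<ge> k \<Longrightarrow> synclass L (pw l u) = synclass L (pw k u)"
proof -
  obtain k where k: "k \<ge> 1" "synclass L (pw (Suc k) u) = synclass L (pw k u)"
    by (rule MeDA_aperiodic[OF assms])
  have "synclass L (pw l u) = synclass L (pw k u)" if "l \<ge> k" for l
    using that
  proof (induction l rule: dec_induct)
    case (step l)
    with synclass_append_cong[OF refl step.IH, of u] k(2) show ?case by simp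
  qed simp
  with k(1) that show ?thesis by blast
qed

section \<open>Two-pebble games\<close>

fun qd :: "'a fo2 \<Rightarrow> nat" where
  "qd FTrue = 0"
| "qd (FNot f) = qd f"
| "qd (FAnd f g) = max (qd f) (qd g)"
| "qd (FEx v f) = Suc (qd f)"
| "qd (FLess u v) = 0"
| "qd (FEq u v) = 0"
| "qd (FLetter a v) = 0"
| "qd (FInv a u v) = 0"

definition bet :: "'a list \<Rightarrow> nat \<Rightarrow> nat \<Rightarrow> 'a set" where
  "bet w i j = set (drop (Suc (min i j)) (take (max i j) w))"

lemma bet_commute: "bet w i j = bet w j i"
  by (simp add: bet_def min.commute max.commute)

lemma in_set_drop_iff: "c \<in> set (drop n w) \<longleftrightarrow> (\<exists>k<length w. n \<le> k \<and> w ! k = c)"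
proof
  assume "c \<in> set (drop n w)"
  then obtain l where l: "l < length w - n" "drop n w ! l = c"
    by (auto simp: in_set_conv_nth)
  moreover have "n \<le> length w" using l(1) by linarith
  ultimately show "\<exists>k<length w. n \<le> k \<and> w ! k = c"
    by (intro exI[of _ "n + l"]) auto
next
  assume "\<exists>k<length w. n \<le> k \<and> w ! k = c"
  then obtain k where "k < length w" "n \<le> k" "w ! k = c" by blast
  then show "c \<in> set (drop n w)"
    unfolding in_set_conv_nth by (intro exI[of _ "k - n"]) auto
qed

lemma in_set_take_iff: "c \<in> set (take n w) \<longleftrightarrow> (\<exists>k<length w. k < n \<and> w ! k = c)"
  by (auto simp: in_set_conv_nth)

lemma sat_FInv: "sat w \<sigma> (FInv a u v) \<longleftrightarrow> a \<in> bet w (\<sigma> u) (\<sigma> v)"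
  by (auto simp: bet_def in_set_drop_iff Suc_le_eq)

lemma bet_same [simp]: "bet w i i = {}"
  by (simp add: bet_def)

text \<open>The binary atomic type of two pebbles. Equality of the positions is covered as the
  failure of both order tests.\<close>

definition same_view :: "'a list \<Rightarrow> nat \<Rightarrow> nat \<Rightarrow> 'a list \<Rightarrow> nat \<Rightarrow> nat \<Rightarrow> bool" where
  "same_view w i j w' i' j' \<longleftrightarrow>
     (i < j \<longleftrightarrow> i' < j') \<and> (j < i \<longleftrightarrow> j' < i') \<and> bet w i j = bet w' i' j'"

lemma same_view_swap: "same_view w i j w' i' j' \<Longrightarrow> same_view w j i w' j' i'"
  by (auto simp: same_view_def bet_commute)

lemma same_view_sym: "same_view w i j w' i' j' \<Longrightarrow> same_view w' i' j' w i j"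
  by (auto simp: same_view_def)

text \<open>\<open>I r i i'\<close> says that, with \<open>r\<close> rounds left, a pebble on position \<open>i\<close> of \<open>w\<close> may face a
  pebble on position \<open>i'\<close> of \<open>w'\<close>.\<close>

definition forth :: "nat \<Rightarrow> 'a list \<Rightarrow> 'a list \<Rightarrow> (nat \<Rightarrow> nat \<Rightarrow> nat \<Rightarrow> bool) \<Rightarrow> bool" where
  "forth K w w' I \<longleftrightarrow>
     (\<forall>r\<le>K. \<forall>i i'. I r i i' \<longrightarrow> i < length w \<and> i' < length w' \<and> w ! i = w' ! i') \<and>
     (\<forall>r<K. \<forall>j<length w. \<exists>j'. I r j j') \<and>
     (\<forall>r<K. \<forall>i i'. I (Suc r) i i' \<longrightarrow> I r i i' \<and>
        (\<forall>j<length w. \<exists>j'. I r j j' \<and> same_view w i j w' i' j'))"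

lemma forth_letter: "forth K w w' I \<Longrightarrow> r \<le> K \<Longrightarrow> I r i i' \<Longrightarrow>
    i < length w \<and> i' < length w' \<and> w ! i = w' ! i'"
  unfolding forth_def by blast

lemma forth_step: "forth K w w' I \<Longrightarrow> r < K \<Longrightarrow> I (Suc r) i i' \<Longrightarrow> j < length w \<Longrightarrow>
    \<exists>j'. I r j j' \<and> same_view w i j w' i' j'"
  unfolding forth_def by blast

definition bisim :: "nat \<Rightarrow> 'a list \<Rightarrow> 'a list \<Rightarrow> bool" where
  "bisim K w w' \<longleftrightarrow> (\<exists>I. forth K w w' I \<and> forth K w' w (\<lambda>r i i'. I r i' i))"

lemma var_cases: "v \<noteq> u \<Longrightarrow> x \<noteq> u \<Longrightarrow> x = (v :: var)"
  by (cases v; cases u; cases x) auto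

text \<open>With two variables, a quantifier that moves one pebble leaves at most one other on the
  board, so a forth condition speaking of a single facing pair suffices. If no other variable is
  free, the start clause of \<open>forth\<close> provides the answer.\<close>

lemma forth_sat:
  assumes "forth K w w' I" and "forth K w' w (\<lambda>r i i'. I r i' i)"
    and "qd f \<le> r" "r \<le> K"
    and "\<And>u. u \<in> fv f \<Longrightarrow> I r (\<sigma> u) (\<sigma>' u)"
    and "\<And>u v. u \<in> fv f \<Longrightarrow> v \<in> fv f \<Longrightarrow> same_view w (\<sigma> u) (\<sigma> v) w' (\<sigma>' u) (\<sigma>' v)"
  shows "sat w \<sigma> f \<longleftrightarrow> sat w' \<sigma>' f"
proof -
  \<comment> \<open>One direction of the quantifier case, stated for arbitrary words and relation
    because the other direction is the same statement with the words exchanged and the relation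
    reversed.\<close>
  have ex: "sat w' \<sigma>' (FEx v f)"
    if fo: "forth K w w' I"
      and IH: "\<And>r \<sigma> \<sigma>'. qd f \<le> r \<Longrightarrow> r \<le> K \<Longrightarrow>
        (\<And>u. u \<in> fv f \<Longrightarrow> I r (\<sigma> u) (\<sigma>' u)) \<Longrightarrow>
        (\<And>u v. u \<in> fv f \<Longrightarrow> v \<in> fv f \<Longrightarrow> same_view w (\<sigma> u) (\<sigma> v) w' (\<sigma>' u) (\<sigma>' v)) \<Longrightarrow>
        sat w \<sigma> f \<longleftrightarrow> sat w' \<sigma>' f"
      and qd: "qd (FEx v f) \<le> r" "r \<le> K"
      and I: "\<And>u. u \<in> fv (FEx v f) \<Longrightarrow> I r (\<sigma> u) (\<sigma>' u)"
      and sat: "sat w \<sigma> (FEx v f)"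
    for f v r \<sigma> \<sigma>' w w' and I :: "nat \<Rightarrow> nat \<Rightarrow> nat \<Rightarrow> bool"
  proof -
    from qd obtain r' where r: "r = Suc r'" "r' < K" "qd f \<le> r'" by (cases r) auto
    from sat obtain i where i: "i < length w" "sat w (\<sigma>(v := i)) f" by auto
    have "\<exists>i'. I r' i i' \<and>
        (\<forall>u\<in>fv f - {v}. I r' (\<sigma> u) (\<sigma>' u) \<and> same_view w (\<sigma> u) i w' (\<sigma>' u) i')"
    proof (cases "fv f - {v} = {}")
      case True
      moreover obtain i' where "I r' i i'" using fo r(2) i(1) unfolding forth_def by blast
      ultimately show ?thesis by auto
    next
      case False
      then obtain x where x: "x \<in> fv f" "x \<noteq> v" by blast
      then have only: "u = x" if "u \<in> fv f - {v}" for u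
        using that var_cases[of x v u] by auto
      have "I (Suc r') (\<sigma> x) (\<sigma>' x)" using I[of x] x by (simp add: r)
      with fo r i have "I r' (\<sigma> x) (\<sigma>' x) \<and> (\<exists>i'. I r' i i' \<and> same_view w (\<sigma> x) i w' (\<sigma>' x) i')"
        unfolding forth_def by blast
      with only show ?thesis by blast
    qed
    then obtain i' where i': "I r' i i'"
      "\<And>u. u \<in> fv f - {v} \<Longrightarrow> I r' (\<sigma> u) (\<sigma>' u)"
      "\<And>u. u \<in> fv f - {v} \<Longrightarrow> same_view w (\<sigma> u) i w' (\<sigma>' u) i'"
      by blast
    have only: "u = x" if "u \<noteq> v" "x \<noteq> v" for u x :: var
      using var_cases[of x v u] that by auto
    have "sat w (\<sigma>(v := i)) f \<longleftrightarrow> sat w' (\<sigma>'(v := i')) f"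
    proof (rule IH[OF r(3)])
      show "r' \<le> K" using r by simp
      show "I r' ((\<sigma>(v := i)) u) ((\<sigma>'(v := i')) u)" if "u \<in> fv f" for u
        using that i' by auto
      show "same_view w ((\<sigma>(v := i)) u) ((\<sigma>(v := i)) x) w' ((\<sigma>'(v := i')) u) ((\<sigma>'(v := i')) x)"
        if "u \<in> fv f" "x \<in> fv f" for u x
        using that i'(3) only[of u x] same_view_swap[OF i'(3)]
        by (cases "u = v"; cases "x = v") (auto simp: same_view_def)
    qed
    moreover have "i' < length w'"
      using i'(1) fo r(2) unfolding forth_def by (meson less_imp_le)
    ultimately show ?thesis using i by auto
  qed
  show ?thesis
    using assms(3-)
  proof (induction f arbitrary: r \<sigma> \<sigma>')
    case (FAnd f g)
    have "sat w \<sigma> f \<longleftrightarrow> sat w' \<sigma>' f"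
      by (rule FAnd.IH(1)[of r]) (use FAnd.prems in auto)
    moreover have "sat w \<sigma> g \<longleftrightarrow> sat w' \<sigma>' g"
      by (rule FAnd.IH(2)[of r]) (use FAnd.prems in auto)
    ultimately show ?case by simp
  next
    case (FNot f)
    have "sat w \<sigma> f \<longleftrightarrow> sat w' \<sigma>' f"
      by (rule FNot.IH[of r]) (use FNot.prems in auto)
    then show ?case by simp
  next
    case (FEx v f)
    note prems = FEx.prems
    have IH': "sat w' \<sigma>' f \<longleftrightarrow> sat w \<sigma> f"
      if "qd f \<le> r" "r \<le> K"
        "\<And>u. u \<in> fv f \<Longrightarrow> I r (\<sigma> u) (\<sigma>' u)"
        "\<And>u v. u \<in> fv f \<Longrightarrow> v \<in> fv f \<Longrightarrow> same_view w' (\<sigma>' u) (\<sigma>' v) w (\<sigma> u) (\<sigma> v)"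
      for r \<sigma> \<sigma>'
      by (rule FEx.IH[symmetric, OF that(1,2,3)]) (use that(4) same_view_sym in blast)+
    show ?case
    proof
      assume sat: "sat w \<sigma> (FEx v f)"
      show "sat w' \<sigma>' (FEx v f)"
        by (rule ex[OF assms(1) FEx.IH prems(1,2) prems(3) sat]) auto
    next
      assume sat: "sat w' \<sigma>' (FEx v f)"
      show "sat w \<sigma> (FEx v f)"
        by (rule ex[OF assms(2) IH' prems(1,2) prems(3) sat]) auto
    qed
  next
    case (FLess u v)
    then show ?case by (auto simp: same_view_def)
  next
    case (FEq u v)
    from FEq.prems(4)[of u v] have "same_view w (\<sigma> u) (\<sigma> v) w' (\<sigma>' u) (\<sigma>' v)" by simp
    then show ?case unfolding same_view_def by simp (metis nat_neq_iff)
  next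
    case (FLetter a v)
    then show ?case using assms(1) by (force simp: forth_def)
  next
    case (FInv a u v)
    then have "same_view w (\<sigma> u) (\<sigma> v) w' (\<sigma>' u) (\<sigma>' v)" by simp
    then show ?case unfolding sat_FInv same_view_def by simp
  qed simp
qed

lemma bisim_sentence:
  assumes "bisim K w w'" and "sentence f" and "qd f \<le> K"
  shows "sat w \<sigma> f \<longleftrightarrow> sat w' \<sigma> f"
proof -
  from assms(1) obtain I where "forth K w w' I" "forth K w' w (\<lambda>r i i'. I r i' i)"
    by (auto simp: bisim_def)
  from forth_sat[OF this assms(3) order_refl] assms(2) show ?thesis
    by (simp add: sentence_def)
qed

lemma forth_set:
  assumes "forth K w w' I" "0 < K"
  shows "set w \<subseteq> set w'"
proof
  fix c assume "c \<in> set w"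
  then obtain j where "j < length w" "w ! j = c" by (auto simp: in_set_conv_nth)
  moreover from this assms obtain j' where "I 0 j j'" unfolding forth_def by blast
  then have "j' < length w'" "w ! j = w' ! j'" using assms(1) unfolding forth_def by blast+
  ultimately show "c \<in> set w'" by auto
qed

text \<open>One further round lets the opponent put the second pebble anywhere to the left or to the
  right, which exposes the letters on that side.\<close>

lemma forth_set_take_drop:
  assumes "forth K w w' I" "r < K" "I (Suc r) i i'"
  shows "set (take i w) \<subseteq> set (take i' w')" "set (drop (Suc i) w) \<subseteq> set (drop (Suc i') w')"
proof -
  have *: "\<exists>j'<length w'. w' ! j' = w ! j \<and> (i < j \<longleftrightarrow> i' < j') \<and> (j < i \<longleftrightarrow> j' < i')"
    if "j < length w" for j
  proof -
    from forth_step[OF assms that] obtain j' where "I r j j'" "same_view w i j w' i' j'"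
      by blast
    moreover have "j' < length w' \<and> w ! j = w' ! j'"
      using forth_letter[OF assms(1) _ \<open>I r j j'\<close>] assms(2) by simp
    ultimately show ?thesis unfolding same_view_def by (intro exI[of _ j']) auto
  qed
  show "set (take i w) \<subseteq> set (take i' w')" "set (drop (Suc i) w) \<subseteq> set (drop (Suc i') w')"
    unfolding subset_iff in_set_take_iff in_set_drop_iff Suc_le_eq using * by metis+
qed

text \<open>The round given up below serves to see that paired positions of \<open>u\<close> and \<open>u'\<close> have the
  same letters to their left and to their right, which is what a pebble in the context observes.\<close>

lemma forth_context:
  assumes fo: "forth (Suc K) u u' I" and conv: "forth (Suc K) u' u (\<lambda>r i i'. I r i' i)"
  shows "forth K (x @ u @ y) (x @ u' @ y)
    (\<lambda>r i i'. (i < length x \<and> i' = i) \<or>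
       (\<exists>k k'. i = length x + k \<and> i' = length x + k' \<and> I (Suc r) k k') \<or>
       (\<exists>k<length y. i = length x + length u + k \<and> i' = length x + length u' + k))"
    (is "forth K ?w ?w' ?J")
proof -
  \<comment> \<open>Two context pebbles on opposite sides of the factor have all of its letters
    between them.\<close>
  have su: "set u = set u'" using forth_set[OF fo] forth_set[OF conv] by simp
  have len: "k < length u \<and> k' < length u' \<and> u ! k = u' ! k'" if "I r k k'" "r \<le> Suc K" for r k k'
    using fo that unfolding forth_def by blast
  have sets: "set (take k u) = set (take k' u')" "set (drop (Suc k) u) = set (drop (Suc k') u')"
    if "I (Suc r) k k'" "r \<le> K" for r k k'
    using forth_set_take_drop[OF fo _ that(1)] forth_set_take_drop[OF conv, where r = r and i = k' and i' = k] that by auto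
  have start: "\<exists>k'. I (Suc r) k k'" if "k < length u" "r < K" for r k
    using fo that unfolding forth_def by (metis Suc_less_eq)
  have pos: "j < length x \<or> (\<exists>k<length u. j = length x + k) \<or>
      (\<exists>k<length y. j = length x + length u + k)" if "j < length ?w" for j
  proof -
    consider "j < length x" | "length x \<le> j" "j < length x + length u" | "length x + length u \<le> j"
      by linarith
    then show ?thesis
    proof cases
      case 2
      then have "j - length x < length u" "j = length x + (j - length x)" by auto
      then show ?thesis by blast
    next
      case 3
      then have "j - length x - length u < length y"
        "j = length x + length u + (j - length x - length u)" using that by auto
      then show ?thesis by blast
    qed simp
  qed
  have step: "\<exists>j'. ?J r j j' \<and> same_view ?w i j ?w' i' j'"
    if J: "?J (Suc r) i i'" and r: "r < K" and j: "j < length ?w" for r i i' j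
  proof -
    consider (x) "j < length x" | (u) k where "k < length u" "j = length x + k"
      | (y) k where "k < length y" "j = length x + length u + k"
      using pos[OF j] by blast
    then show ?thesis
    proof cases
      case x
      have "same_view ?w i j ?w' i' j"
        using J
      proof (elim disjE exE conjE)
        fix l l' assume i: "i = length x + l" "i' = length x + l'" "I (Suc (Suc r)) l l'"
        with x r sets[OF i(3)] len[OF i(3)] show ?thesis
          by (auto simp: same_view_def bet_def)
      next
        fix l assume i: "l < length y" "i = length x + length u + l" "i' = length x + length u' + l"
        with x su show ?thesis by (auto simp: same_view_def bet_def)
      qed (use x in \<open>auto simp: same_view_def bet_def\<close>)
      with x show ?thesis by blast
    next
      case y
      have "same_view ?w i j ?w' i' (length x + length u' + k)"
        using J
      proof (elim disjE exE conjE)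
        fix l l' assume i: "i = length x + l" "i' = length x + l'" "I (Suc (Suc r)) l l'"
        with y r sets[OF i(3)] len[OF i(3)] show ?thesis
          by (auto simp: same_view_def bet_def)
      next
        fix l assume i: "l < length y" "i = length x + length u + l" "i' = length x + length u' + l"
        then have "bet ?w i j = bet y l k" "bet ?w' i' (length x + length u' + k) = bet y l k"
          using y by (auto simp: bet_def Suc_diff_le min_def max_def)
        with i y show ?thesis by (auto simp: same_view_def)
      qed (use y su in \<open>auto simp: same_view_def bet_def\<close>)
      with y show ?thesis by blast
    next
      case u
      have "\<exists>k'. I (Suc r) k k' \<and> same_view ?w i j ?w' i' (length x + k')"
        using J
      proof (elim disjE exE conjE)
        assume i: "i < length x" "i' = i"
        obtain k' where k': "I (Suc r) k k'" using start u r by blast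
        with u i r sets[OF k'] len[OF k'] show ?thesis
          by (intro exI[of _ k']) (auto simp: same_view_def bet_def)
      next
        fix l l' assume i: "i = length x + l" "i' = length x + l'" "I (Suc (Suc r)) l l'"
        then obtain k' where k': "I (Suc r) k k'" "same_view u l k u' l' k'"
          using fo r u unfolding forth_def by (metis Suc_less_eq)
        with u i r len[OF i(3)] len[OF k'(1)] show ?thesis
          by (intro exI[of _ k']) (auto simp: same_view_def bet_def min_def max_def)
      next
        fix l assume i: "l < length y" "i = length x + length u + l" "i' = length x + length u' + l"
        obtain k' where k': "I (Suc r) k k'" using start u r by blast
        with u i r sets[OF k'] len[OF k'] show ?thesis
          by (intro exI[of _ k']) (auto simp: same_view_def bet_def min_def max_def)
      qed
      with u show ?thesis by blast
    qed
  qed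
  show ?thesis
    unfolding forth_def
  proof (intro conjI allI impI)
    fix r i i' assume "r \<le> K" and J: "?J r i i'"
    then show "i < length ?w" "i' < length ?w'" "?w ! i = ?w' ! i'"
      using len[of "Suc r"] by (force simp: nth_append)+
  next
    fix r j assume "r < K" "j < length ?w"
    then show "\<exists>j'. ?J r j j'" using pos[of j] start[of _ r] by metis
  next
    fix r i i' assume "r < K" "?J (Suc r) i i'"
    moreover have "I (Suc r) k k'" if "I (Suc (Suc r)) k k'" for k k'
      using fo that \<open>r < K\<close> unfolding forth_def by blast
    ultimately show "?J r i i'" by blast
  next
    fix r i i' j assume "r < K" "?J (Suc r) i i'" "j < length ?w"
    then show "\<exists>j'. ?J r j j' \<and> same_view ?w i j ?w' i' j'" by (intro step)
  qed
qed

section \<open>From games to a syntactic congruence of finite index\<close>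

lemma bisim_context:
  assumes "bisim (Suc K) u u'"
  shows "bisim K (x @ u @ y) (x @ u' @ y)"
proof -
  from assms obtain I where I: "forth (Suc K) u u' I" "forth (Suc K) u' u (\<lambda>r i i'. I r i' i)"
    by (auto simp: bisim_def)
  let ?J = "\<lambda>r i i'. (i < length x \<and> i' = i) \<or>
       (\<exists>k k'. i = length x + k \<and> i' = length x + k' \<and> I (Suc r) k k') \<or>
       (\<exists>k<length y. i = length x + length u + k \<and> i' = length x + length u' + k)"
  have "forth K (x @ u @ y) (x @ u' @ y) ?J" using forth_context[OF I] .
  moreover have "forth K (x @ u' @ y) (x @ u @ y) (\<lambda>r i i'. ?J r i' i)"
  proof -
    have "(\<lambda>r i i'. ?J r i' i) = (\<lambda>r i i'. (i < length x \<and> i' = i) \<or>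
       (\<exists>k k'. i = length x + k \<and> i' = length x + k' \<and> I (Suc r) k' k) \<or>
       (\<exists>k<length y. i = length x + length u' + k \<and> i' = length x + length u + k))"
      by (intro ext) blast
    then show ?thesis using forth_context[OF I(2) I(1)] by simp
  qed
  ultimately show ?thesis unfolding bisim_def by blast
qed

text \<open>The syntactic congruence tests a word in all contexts; passing to a context costs one
  round, hence \<open>Suc (qd f)\<close>.\<close>

lemma bisim_synclass:
  assumes "sentence f" and "L = {w. sat w (\<lambda>_. 0) f}" and "bisim (Suc (qd f)) u u'"
  shows "synclass L u = synclass L u'"
  unfolding synclass_eq_iff assms(2) mem_Collect_eq
  using bisim_sentence[OF bisim_context[OF assms(3)] assms(1) order_refl] by blast

text \<open>The \<open>r\<close>-round type of a position is coded as a natural number, so that the types of all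
  depths live in one HOL type.\<close>

lemma finite_position_types:
  obtains T :: "nat \<Rightarrow> ('a::finite) list \<Rightarrow> nat \<Rightarrow> nat"
  where "\<And>r. finite {T r w i | w i. True}"
    and "\<And>r w i w' i'. i < length w \<Longrightarrow> i' < length w' \<Longrightarrow> T r w i = T r w' i' \<Longrightarrow> w ! i = w' ! i'"
    and "\<And>r w i w' i'. T (Suc r) w i = T (Suc r) w' i' \<Longrightarrow> T r w i = T r w' i' \<and>
        (\<forall>j<length w. \<exists>j'<length w'. T r w j = T r w' j' \<and> same_view w i j w' i' j')"
proof -
  \<comment> \<open>\<open>V\<close> refines a typing \<open>t\<close> by the views that a position
    has of all typed positions. Its set of values is finite when that of \<open>t\<close> is, so
    \<open>N\<close> can code it injectively by numbers and the refinement can be iterated.\<close>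
  define V where "V = (\<lambda>t (w :: 'a list) (i :: nat). (t w i :: nat,
    {(t w j :: nat, i < j, j < i, bet w i j) | j. j < length w}))"
  define N where "N = (\<lambda>t (w :: 'a list) (i :: nat).
    to_nat_on {V t w i | w i. True} (V t w i))"
  have fin: "finite {V t w i | w i. True}" if "finite {t w i | w i. True}" for t
  proof -
    let ?A = "{t w i | w i. True}"
    have "{V t w i | w i. True} \<subseteq> ?A \<times> Pow (?A \<times> UNIV \<times> UNIV \<times> UNIV)"
      unfolding V_def by blast
    then show ?thesis using that finite_subset by fastforce
  qed
  define T where "T = rec_nat (\<lambda>w i. to_nat_on (UNIV :: 'a set) (w ! i)) (\<lambda>_. N)"
  have T0: "T 0 w i = to_nat_on (UNIV :: 'a set) (w ! i)" for w i by (simp add: T_def)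
  have TS: "T (Suc r) = N (T r)" for r by (simp add: T_def)
  have finT: "finite {T r w i | w i. True}" for r
  proof (induction r)
    case 0
    have "{T 0 w i | w i. True} \<subseteq> range (to_nat_on (UNIV :: 'a set))" by (auto simp: T0)
    then show ?case by (rule finite_subset) simp
  next
    case (Suc r)
    have "{T (Suc r) w i | w i. True} \<subseteq>
        to_nat_on {V (T r) w i | w i. True} ` {V (T r) w i | w i. True}"
      by (auto simp: TS N_def)
    then show ?case by (rule finite_subset) (rule finite_imageI[OF fin[OF Suc]])
  qed
  have VS: "V (T r) w i = V (T r) w' i'" if "T (Suc r) w i = T (Suc r) w' i'" for r w i w' i'
    using that inj_on_to_nat_on[OF countable_finite[OF fin[OF finT[of r]]]]
    unfolding TS N_def inj_on_def by blast
  have step: "T r w i = T r w' i' \<and>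
      (\<forall>j<length w. \<exists>j'<length w'. T r w j = T r w' j' \<and> same_view w i j w' i' j')"
    if "T (Suc r) w i = T (Suc r) w' i'" for r w i w' i'
  proof (intro conjI allI impI)
    from VS[OF that] show "T r w i = T r w' i'" by (simp add: V_def)
    fix j assume "j < length w"
    then have "(T r w j, i < j, j < i, bet w i j) \<in> snd (V (T r) w i)"
      by (auto simp: V_def)
    then have "(T r w j, i < j, j < i, bet w i j) \<in> snd (V (T r) w' i')"
      using VS[OF that] by simp
    then show "\<exists>j'<length w'. T r w j = T r w' j' \<and> same_view w i j w' i' j'"
      by (auto simp: V_def same_view_def)
  qed
  have "w ! i = w' ! i'" if "T r w i = T r w' i'" for r w i w' i'
    using that
  proof (induction r)
    case 0
    then show ?case by (simp add: T0)
  next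
    case (Suc r)
    then show ?case using step by blast
  qed
  then show ?thesis using that[OF finT _ step] by blast
qed

text \<open>A word is summarised by the set \<open>W\<close> of the types of its positions at full
  depth. Words with the same summary are bisimilar, positions of equal type facing each other, and
  only finitely many summaries exist.\<close>

lemma finite_range_synclass:
  fixes L :: "'a::finite list set"
  assumes "sentence f" and "L = {w. sat w (\<lambda>_. 0) f}"
  shows "finite (range (synclass L))"
proof -
  define K where "K = Suc (qd f)"
  obtain T :: "nat \<Rightarrow> 'a list \<Rightarrow> nat \<Rightarrow> nat" where fin: "\<And>r. finite {T r w i | w i. True}"
    and letter: "\<And>r w i w' i'. i < length w \<Longrightarrow> i' < length w' \<Longrightarrow> T r w i = T r w' i' \<Longrightarrow> w ! i = w' ! i'"
    and step: "\<And>r w i w' i'. T (Suc r) w i = T (Suc r) w' i' \<Longrightarrow> T r w i = T r w' i' \<and>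
        (\<forall>j<length w. \<exists>j'<length w'. T r w j = T r w' j' \<and> same_view w i j w' i' j')"
    by (rule finite_position_types) blast
  define W where "W = (\<lambda>w. T K w ` {..<length w})"
  \<comment> \<open>Equal types of full depth give equal types of every smaller depth, so the start
    clause of \<open>forth\<close> holds for each number of rounds.\<close>
  have down: "\<exists>j'<length w'. T r w j = T r w' j'"
    if "W w = W w'" "r \<le> K" "j < length w" for w w' r j
  proof -
    from that(1,3) obtain j' where j': "j' < length w'" "T K w j = T K w' j'"
      unfolding W_def by (metis imageE imageI lessThan_iff)
    have "T (K - d) w j = T (K - d) w' j'" for d
    proof (induction d)
      case (Suc d)
      show ?case
      proof (cases "d < K")
        case True
        then have "K - d = Suc (K - Suc d)" by simp
        with Suc step show ?thesis by metis
      next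
        case False
        then show ?thesis using Suc by simp
      qed
    qed (simp add: j')
    from this[of "K - r"] that(2) j' show ?thesis by auto
  qed
  have forth: "forth K w w' (\<lambda>r i i'. i < length w \<and> i' < length w' \<and> T r w i = T r w' i')"
    if "W w = W w'" for w w'
    unfolding forth_def using letter down[OF that] step by (meson less_imp_le)
  have "synclass L u = synclass L u'" if "W u = W u'" for u u'
  proof (rule bisim_synclass[OF assms])
    have "(\<lambda>r i i'. i < length u' \<and> i' < length u \<and> T r u' i = T r u i') =
      (\<lambda>r i i'. i' < length u \<and> i < length u' \<and> T r u i' = T r u' i)"
      by (intro ext) auto
    then have "forth K u' u (\<lambda>r i i'. i' < length u \<and> i < length u' \<and> T r u i' = T r u' i)"
      using forth[OF that[symmetric]] by (simp only:)
    with forth[OF that] show "bisim (Suc (qd f)) u u'"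
      unfolding bisim_def K_def by blast
  qed
  then have eq: "synclass L u = synclass L (SOME v. W v = W u)" for u
    by (metis (mono_tags, lifting) someI_ex)
  have "range (synclass L) \<subseteq> (\<lambda>s. synclass L (SOME u. W u = s)) ` range W"
  proof (rule image_subsetI)
    show "synclass L u \<in> (\<lambda>s. synclass L (SOME u. W u = s)) ` range W" for u
      by (rule image_eqI[of _ _ "W u"], rule eq, rule rangeI)
  qed
  moreover have "finite (range W)"
  proof (rule finite_subset)
    show "range W \<subseteq> Pow {T K w i | w i. True}" unfolding W_def by blast
    show "finite (Pow {T K w i | w i. True})" using fin[of K] by (rule finite_Pow_iff[THEN iffD2])
  qed
  ultimately show ?thesis using finite_subset by blast
qed

section \<open>Games on products of factors with the same letters\<close>

text \<open>Positions are addressed by factor number and offset, so that a strategy can treat the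
  two separately.\<close>

definition tpos :: "'a list list \<Rightarrow> nat \<Rightarrow> nat \<Rightarrow> nat" where
  "tpos ts t p = length (concat (take t ts)) + p"

lemma tpos_cases:
  assumes "i < length (concat ts)"
  obtains t p where "t < length ts" "p < length (ts ! t)" "i = tpos ts t p"
  using assms
proof (induction ts arbitrary: i thesis)
  case (Cons u ts)
  show ?case
  proof (cases "i < length u")
    case True
    then show ?thesis using Cons.prems(1)[of 0 i] by (simp add: tpos_def)
  next
    case False
    then have "i - length u < length (concat ts)" using Cons.prems(2) by simp
    then obtain t p where "t < length ts" "p < length (ts ! t)" "i - length u = tpos ts t p"
      using Cons.IH by blast
    then show ?thesis using Cons.prems(1)[of "Suc t" p] False by (simp add: tpos_def)
  qed
qed simp

lemma concat_split_nth:
  assumes "t < length ts"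
  shows "concat ts = concat (take t ts) @ ts ! t @ concat (drop (Suc t) ts)"
proof -
  have "concat ts = concat (take t ts @ ts ! t # drop (Suc t) ts)"
    using id_take_nth_drop[OF assms] by (rule arg_cong)
  then show ?thesis by simp
qed

lemma nth_tpos:
  assumes "t < length ts" "p < length (ts ! t)"
  shows "tpos ts t p < length (concat ts)" "concat ts ! tpos ts t p = ts ! t ! p"
  unfolding concat_split_nth[OF assms(1)] tpos_def using assms(2) by (simp_all add: nth_append)

lemma bet_tpos_same:
  assumes "t < length ts" "p < length (ts ! t)" "p' < length (ts ! t)"
  shows "bet (concat ts) (tpos ts t p) (tpos ts t p') = bet (ts ! t) p p'"
  unfolding concat_split_nth[OF assms(1)] tpos_def bet_def
  using assms(2,3) by (simp add: min_def max_def)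

lemma tpos_less:
  assumes "t < s" "s < length ts" "p < length (ts ! t)"
  shows "tpos ts t p < tpos ts s p'"
    and "p' < length (ts ! s) \<Longrightarrow> bet (concat ts) (tpos ts t p) (tpos ts s p') =
      set (drop (Suc p) (ts ! t)) \<union> (\<Union>k\<in>{t<..<s}. set (ts ! k)) \<union> set (take p' (ts ! s))"
proof -
  define A where "A = take t ts"
  define M where "M = drop (Suc t) (take s ts)"
  have tk: "take s ts = A @ [ts ! t] @ M"
    using id_take_nth_drop[of t "take s ts"] assms by (simp add: A_def M_def min_def)
  show "tpos ts t p < tpos ts s p'"
    using assms by (simp add: tpos_def tk A_def[symmetric])
  have M: "set (concat M) = (\<Union>k\<in>{t<..<s}. set (ts ! k))"
  proof -
    have "x \<in> set M \<longleftrightarrow> (\<exists>k<s. Suc t \<le> k \<and> ts ! k = x)" for x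
      using assms by (simp add: M_def in_set_drop_iff min_def cong: conj_cong)
    then have "set M = (\<lambda>k. ts ! k) ` {t<..<s}" by (auto simp: Suc_le_eq)
    then show ?thesis by auto
  qed
  assume p': "p' < length (ts ! s)"
  have "ts = take s ts @ [ts ! s] @ drop (Suc s) ts"
    using id_take_nth_drop[of s ts] assms by simp
  then have "ts = A @ [ts ! t] @ M @ [ts ! s] @ drop (Suc s) ts" unfolding tk by simp
  then have "concat ts = concat (A @ [ts ! t] @ M @ [ts ! s] @ drop (Suc s) ts)"
    by (rule arg_cong)
  also have "\<dots> = concat A @ ts ! t @ concat M @ ts ! s @ concat (drop (Suc s) ts)" by simp
  finally have "bet (concat ts) (tpos ts t p) (tpos ts s p') =
      set (drop (Suc p) (ts ! t)) \<union> set (concat M) \<union> set (take p' (ts ! s))"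
    using assms p' by (simp add: tpos_def tk A_def[symmetric] bet_def Un_assoc)
  then show "bet (concat ts) (tpos ts t p) (tpos ts s p') =
      set (drop (Suc p) (ts ! t)) \<union> (\<Union>k\<in>{t<..<s}. set (ts ! k)) \<union> set (take p' (ts ! s))"
    unfolding M .
qed

text \<open>Between two positions in non-adjacent factors all letters of \<open>B\<close> occur, so beyond distance
  one the game on the factors is insensitive to everything but the order.\<close>

definition adjacent_view :: "nat \<Rightarrow> nat \<Rightarrow> nat \<Rightarrow> nat \<Rightarrow> bool" where
  "adjacent_view t s t' s' \<longleftrightarrow>
     (s = t \<and> s' = t') \<or> (s = Suc t \<and> s' = Suc t') \<or> (t = Suc s \<and> t' = Suc s') \<or>
     (Suc t < s \<and> Suc t' < s') \<or> (Suc s < t \<and> Suc s' < t')"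

text \<open>Besides the ends of the two factors holding the pebbles, only whole factors lie between
  them: none in both words when the factors are adjacent, and otherwise at least one in both words,
  contributing exactly \<open>B\<close>.\<close>

lemma same_view_tpos:
  assumes B: "\<And>v. v \<in> set ts \<union> set ts' \<Longrightarrow> set v = B"
    and view: "adjacent_view t s t' s'"
    and eq: "ts ! t = ts' ! t'" "ts ! s = ts' ! s'"
    and len: "t < length ts" "s < length ts" "t' < length ts'" "s' < length ts'"
    and p: "p < length (ts ! t)" "p' < length (ts ! s)"
  shows "same_view (concat ts) (tpos ts t p) (tpos ts s p')
    (concat ts') (tpos ts' t' p) (tpos ts' s' p')"
proof -
  have *: "same_view (concat ts) (tpos ts t p) (tpos ts s p')
      (concat ts') (tpos ts' t' p) (tpos ts' s' p')"
    if eq: "ts ! t = ts' ! t'" "ts ! s = ts' ! s'"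
      and view: "s = Suc t \<and> s' = Suc t' \<or> Suc t < s \<and> Suc t' < s'"
      and len: "s < length ts" "s' < length ts'"
      and p: "p < length (ts ! t)" "p' < length (ts ! s)"
    for t s t' s' p p'
  proof -
    have "t < s" "t' < s'" using view by auto
    have "(\<Union>k\<in>{t<..<s}. set (ts ! k)) = (\<Union>k\<in>{t'<..<s'}. set (ts' ! k))"
      using view
    proof (elim disjE conjE)
      assume "Suc t < s" "Suc t' < s'"
      then have "{t<..<s} \<noteq> {}" "{t'<..<s'} \<noteq> {}" by auto
      moreover have "set (ts ! k) = B" if "k \<in> {t<..<s}" for k using that len B by auto
      moreover have "set (ts' ! k) = B" if "k \<in> {t'<..<s'}" for k using that len B by auto
      ultimately show ?thesis by simp
    next
      assume "s = Suc t" "s' = Suc t'"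
      then have "{t<..<s} = {}" "{t'<..<s'} = {}" by auto
      then show ?thesis by simp
    qed
    then show ?thesis
      using tpos_less[OF \<open>t < s\<close> len(1) p(1), of p'] tpos_less[OF \<open>t' < s'\<close> len(2), of p p'] p eq
      by (auto simp: same_view_def)
  qed
  consider "s = t \<and> s' = t'" | "s = Suc t \<and> s' = Suc t' \<or> Suc t < s \<and> Suc t' < s'"
    | "t = Suc s \<and> t' = Suc s' \<or> Suc s < t \<and> Suc s' < t'"
    using view unfolding adjacent_view_def by blast
  then show ?thesis
  proof cases
    case 1
    with bet_tpos_same[of t ts p p'] bet_tpos_same[of t' ts' p p'] eq len p show ?thesis
      by (auto simp: same_view_def tpos_def)
  next
    case 2
    show ?thesis by (rule *) fact+
  next
    case 3
    show ?thesis by (rule same_view_swap, rule *) fact+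
  qed
qed

text \<open>A strategy \<open>J\<close> on whole factors lifts to letters by keeping the offset
  inside the factor. Facing factors are equal words, so letters and views inside them agree; what
  lies between two factors is controlled by \<open>adjacent_view\<close>.\<close>

lemma forth_concat:
  assumes B: "\<And>v. v \<in> set ts \<union> set ts' \<Longrightarrow> set v = B"
    and letter: "\<And>r t t'. J r t t' \<Longrightarrow> t < length ts \<and> t' < length ts' \<and> ts ! t = ts' ! t'"
    and start: "\<And>r s. r < K \<Longrightarrow> s < length ts \<Longrightarrow> \<exists>s'. J r s s'"
    and step: "\<And>r t t' s. r < K \<Longrightarrow> J (Suc r) t t' \<Longrightarrow> s < length ts \<Longrightarrow>
      \<exists>s'. J r s s' \<and> adjacent_view t s t' s'"
    and down: "\<And>r t t'. r < K \<Longrightarrow> J (Suc r) t t' \<Longrightarrow> J r t t'"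
  shows "forth K (concat ts) (concat ts')
    (\<lambda>r i i'. \<exists>t t' p. J r t t' \<and> p < length (ts ! t) \<and> i = tpos ts t p \<and> i' = tpos ts' t' p)"
    (is "forth K ?w ?w' ?I")
  unfolding forth_def
proof (intro conjI allI impI)
  fix r i i' assume "?I r i i'"
  then obtain t t' p where *: "J r t t'" "p < length (ts ! t)" "i = tpos ts t p" "i' = tpos ts' t' p"
    by blast
  with letter[OF *(1)] nth_tpos[of t ts p] nth_tpos[of t' ts' p]
  show "i < length ?w" "i' < length ?w'" "?w ! i = ?w' ! i'" by auto
next
  fix r j assume r: "r < K" and "j < length ?w"
  then obtain s p where *: "s < length ts" "p < length (ts ! s)" "j = tpos ts s p"
    by (elim tpos_cases)
  with start[OF r *(1)] show "\<exists>j'. ?I r j j'" by blast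
next
  fix r i i' assume "r < K" "?I (Suc r) i i'"
  then show "?I r i i'" using down by blast
next
  fix r i i' j assume r: "r < K" and "?I (Suc r) i i'" and "j < length ?w"
  then obtain t t' p s p' where *: "J (Suc r) t t'" "p < length (ts ! t)" "i = tpos ts t p"
      "i' = tpos ts' t' p" "s < length ts" "p' < length (ts ! s)" "j = tpos ts s p'"
    by (elim exE conjE tpos_cases) blast
  from step[OF r *(1,5)] obtain s' where s': "J r s s'" "adjacent_view t s t' s'" by blast
  show "\<exists>j'. ?I r j j' \<and> same_view ?w i j ?w' i' j'"
  proof (rule exI[of _ "tpos ts' s' p'"], rule conjI)
    show "?I r j (tpos ts' s' p')"
      using s'(1) *(6,7) by (intro exI[of _ s] exI[of _ s'] exI[of _ p']) simp
    show "same_view ?w i j ?w' i' (tpos ts' s' p')"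
      using same_view_tpos[OF B s'(2)] letter[OF *(1)] letter[OF s'(1)] * by auto
  qed
qed

text \<open>With \<open>r\<close> rounds left, factors within distance \<open>a r\<close> of either end are matched by counting from
  that end, and factors in the middle by their neighbourhoods of radius \<open>r\<close>.  The margin \<open>a r\<close>
  shrinks with \<open>r\<close>, which leaves room beside a middle factor for an answer in the middle.\<close>

lemma tokens_step:
  fixes ts ts' :: "'b list" and c :: nat
  defines "a \<equiv> \<lambda>r. (2 * r + 2) * c"
  defines "near \<equiv> \<lambda>r t t'. \<forall>d\<le>r. ts ! (t + d) = ts' ! (t' + d) \<and> ts ! (t - d) = ts' ! (t' - d)"
  defines "J \<equiv> \<lambda>r t t'. (t = t' \<and> t < a r) \<or>
      (t < length ts \<and> t' < length ts' \<and> length ts - t = length ts' - t' \<and> length ts - t \<le> a r) \<or>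
      (a r \<le> t \<and> t + a r < length ts \<and> a r \<le> t' \<and> t' + a r < length ts' \<and> near r t t')"
  assumes ts: "ts = P @ Q @ P" "ts' = P @ Q' @ P" and P: "(2 * K + 4) * c \<le> length P" and c: "K < c"
    and place: "\<And>r s b. r < K \<Longrightarrow> c \<le> s \<Longrightarrow> s + c < length ts \<Longrightarrow>
      b \<in> {a r, length ts' - a r - c} \<Longrightarrow> \<exists>s'. b \<le> s' \<and> s' < b + c \<and> near r s s'"
  shows "r \<le> K \<Longrightarrow> J r t t' \<Longrightarrow> t < length ts \<and> t' < length ts' \<and> ts ! t = ts' ! t'"
    and "r < K \<Longrightarrow> s < length ts \<Longrightarrow> \<exists>s'. J r s s'"
    and "r < K \<Longrightarrow> J (Suc r) t t' \<Longrightarrow> J r t t'"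
    and "r < K \<Longrightarrow> J (Suc r) t t' \<Longrightarrow> s < length ts \<Longrightarrow> \<exists>s'. J r s s' \<and> adjacent_view t s t' s'"
proof -
  let ?l = "length ts" and ?l' = "length ts'" and ?N = "length P"
  have a_mono: "a r \<le> a r'" if "r \<le> r'" for r r' using that by (simp add: a_def)
  \<comment> \<open>Each round releases 2c further factors at either end: one segment of length c
    for the answer and one that keeps the answer more than one factor away from the other
    pebble.\<close>
  have a_Suc: "a (Suc r) = a r + 2 * c" for r by (simp add: a_def algebra_simps)
  have aN: "a r + 2 * c \<le> ?N" if "r \<le> K" for r
  proof -
    have "(2 * r + 4) * c \<le> (2 * K + 4) * c" using that by (intro mult_le_mono1) simp
    moreover have "a r + 2 * c = (2 * r + 4) * c" by (simp add: a_def algebra_simps)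
    ultimately show ?thesis using P by linarith
  qed
  have l: "2 * ?N \<le> ?l" "2 * ?N \<le> ?l'" by (simp_all add: ts)
  have a2: "2 * c \<le> a r" for r by (simp add: a_def)
  have pre: "ts ! i = ts' ! i" if "i < ?N" for i using that by (simp add: ts nth_append)
  have suf: "ts ! i = ts' ! i'" if "i < ?l" "?l - i = ?l' - i'" "?l - i \<le> ?N" for i i'
  proof -
    have "i' < ?l'" using that by linarith
    have "ts ! i = P ! (i - (?l - ?N))" "ts' ! i' = P ! (i' - (?l' - ?N))"
      using that \<open>i' < ?l'\<close> by (auto simp: ts nth_append add.commute)
    moreover have "i - (?l - ?N) = i' - (?l' - ?N)" using that l \<open>i' < ?l'\<close> by linarith
    ultimately show ?thesis by simp
  qed
  have mirror: "\<exists>s'. s' < ?l' \<and> ?l - s = ?l' - s'" if "s < ?l" "?l - s \<le> ?N" for s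
    using that l by (intro exI[of _ "?l' - (?l - s)"]) linarith
  \<comment> \<open>More than r factors before the end of the left copy of \<open>P\<close>, a
    factor may face itself, either by its count from the left or because its whole neighbourhood
    lies in \<open>P\<close>. \<open>copyR\<close> is the mirror image.\<close>
  have copyL: "J r s s" if "s + r < ?N" "r \<le> K" for s r
  proof (cases "s < a r")
    case False
    have "near r s s" using that pre by (auto simp: near_def)
    with False that aN[OF that(2)] l c show ?thesis unfolding J_def by auto
  qed (simp add: J_def)
  have copyR: "J r s s'" if "s < ?l" "?l - s = ?l' - s'" "?l - s + r \<le> ?N" "r \<le> K" for s s' r
  proof (cases "?l - s \<le> a r")
    case True
    with that show ?thesis unfolding J_def by auto
  next
    case False
    have "near r s s'" unfolding near_def
    proof (intro allI impI conjI)
      fix d assume "d \<le> r"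
      have "a r \<ge> c" using a2[of r] by simp
      then have "s + d < ?l" "s' + d < ?l'" "d \<le> s" "d \<le> s'"
        using False \<open>d \<le> r\<close> that c l by linarith+
      with that \<open>d \<le> r\<close> show "ts ! (s + d) = ts' ! (s' + d)" "ts ! (s - d) = ts' ! (s' - d)"
        by (auto intro!: suf)
    qed
    moreover have "a r \<le> s" "a r \<le> s'" "s + a r < ?l" "s' + a r < ?l'"
      using False that l aN[OF that(4)] by linarith+
    ultimately show ?thesis unfolding J_def by simp
  qed
  show "t < ?l \<and> t' < ?l' \<and> ts ! t = ts' ! t'" if "r \<le> K" "J r t t'" for r t t'
  proof -
    have "near r t t' \<Longrightarrow> ts ! t = ts' ! t'" by (auto simp: near_def dest: spec[of _ 0])
    then show ?thesis
      using that(2) pre[of t] suf[of t t'] aN[OF that(1)] l unfolding J_def by auto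
  qed
  show down: "J r t t'" if r: "r < K" and J: "J (Suc r) t t'" for r t t'
  proof -
    have *: "a (Suc r) + 2 * c \<le> ?N" using aN[of "Suc r"] r by simp
    consider (L) "t = t'" "t < a (Suc r)"
      | (R) "t < ?l" "?l - t = ?l' - t'" "?l - t \<le> a (Suc r)"
      | (M) "a (Suc r) \<le> t" "t + a (Suc r) < ?l" "a (Suc r) \<le> t'" "t' + a (Suc r) < ?l'"
          "near (Suc r) t t'"
      using J unfolding J_def by blast
    then show ?thesis
    proof cases
      case L
      then show ?thesis using copyL[of t r] r c * by simp
    next
      case R
      then show ?thesis using copyR[of t t' r] r c * by simp
    next
      case M
      then show ?thesis using a_Suc[of r] unfolding J_def near_def by auto
    qed
  qed
  have mid: "\<exists>s'. b \<le> s' \<and> s' < b + c \<and> J r s s'"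
    if "r < K" "a r \<le> s" "s + a r < ?l" "b \<in> {a r, ?l' - a r - c}" for r s b
  proof -
    have "c \<le> s" "s + c < ?l" using that a2[of r] by linarith+
    from place[OF that(1) this that(4)] obtain s' where "b \<le> s'" "s' < b + c" "near r s s'"
      by blast
    moreover from this have "a r \<le> s'" "s' + a r < ?l'"
      using that(1,4) aN[of r] l c by auto
    ultimately show ?thesis using that unfolding J_def by blast
  qed
  \<comment> \<open>Answers in the outermost segment of the middle, on the left or on the right as
    the order of the pebbles demands.\<close>
  have midL: "\<exists>s'. s' < a r + c \<and> J r s s'"
    and midR: "\<exists>s'. ?l' - a r - c \<le> s' \<and> J r s s'"
    if "r < K" "a r \<le> s" "s + a r < ?l" for r s
    using mid[OF that, of "a r"] mid[OF that, of "?l' - a r - c"] by blast+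
  show "\<exists>s'. J r s s'" if r: "r < K" and s: "s < ?l" for r s
  proof -
    have *: "a r + 2 * c \<le> ?N" using aN[of r] r by simp
    consider "s < a r" | "?l - s \<le> a r" | "a r \<le> s" "s + a r < ?l" using s by linarith
    then show ?thesis
    proof cases
      case 1
      then show ?thesis using copyL[of s r] r c * by auto
    next
      case 2
      then obtain s' where "?l - s = ?l' - s'" using mirror[of s] s * by auto
      then have "J r s s'" using 2 r c s * by (intro copyR) linarith+
      then show ?thesis by blast
    next
      case 3
      then show ?thesis using mid[OF r] by blast
    qed
  qed
  show "\<exists>s'. J r s s' \<and> adjacent_view t s t' s'"
    if r: "r < K" and J: "J (Suc r) t t'" and s: "s < ?l" for r t t' s
  proof -
    have *: "a (Suc r) + 2 * c \<le> ?N" "a (Suc r) = a r + 2 * c" "2 * c \<le> a r" "Suc r < c"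
      using aN[of "Suc r"] a_Suc[of r] a2[of r] r c by simp_all
    note arith = * l
    consider (far_left) "Suc s < t" | (left) "t = Suc s" | (eq) "s = t" | (right) "s = Suc t"
      | (far_right) "Suc t < s" by linarith
    note pos = this
    consider (L) "t = t'" "t < a (Suc r)"
      | (R) "t < ?l" "t' < ?l'" "?l - t = ?l' - t'" "?l - t \<le> a (Suc r)"
      | (M) "a (Suc r) \<le> t" "t + a (Suc r) < ?l" "a (Suc r) \<le> t'" "t' + a (Suc r) < ?l'"
          "near (Suc r) t t'"
      using J unfolding J_def by blast
    then show ?thesis
    proof cases
      case L
      from pos show ?thesis
      proof cases
        case far_right
        show ?thesis
        proof (cases "s + r < ?N")
          case True
          then show ?thesis using far_right copyL[of s r] r L
            by (intro exI[of _ s]) (simp add: adjacent_view_def)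
        next
          case False
          show ?thesis
          proof (cases "?l - s \<le> a r")
            case True
            then obtain s' where s': "s' < ?l'" "?l - s = ?l' - s'" using mirror[of s] s arith by auto
            then have "J r s s'" using True r c s arith by (intro copyR) linarith+
            moreover have "Suc t' < s'" using s' True L arith by linarith
            ultimately show ?thesis using far_right by (auto simp: adjacent_view_def)
          next
            case False2: False
            have "a r \<le> s" "s + a r < ?l" using False False2 arith by linarith+
            from midR[OF r this] obtain s' where "?l' - a r - c \<le> s'" "J r s s'" by blast
            moreover from this have "Suc t' < s'" using L arith by linarith
            ultimately show ?thesis using far_right by (auto simp: adjacent_view_def)
          qed
        qed
      qed (use copyL[of s r] r L arith in \<open>auto simp: adjacent_view_def intro!: exI[of _ s]\<close>)+
    next
      case R
      \<comment> \<open>Both s and t are counted from the right end here, so the answer keeps its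
        distance to the facing pebble.\<close>
      have copy: ?thesis if near_end: "?l - s + r \<le> ?N"
      proof -
        obtain s' where s': "s' < ?l'" "?l - s = ?l' - s'" using mirror[of s] s near_end by auto
        then have "J r s s'" using near_end r s by (intro copyR) linarith+
        moreover have "s + ?l' = s' + ?l" "t + ?l' = t' + ?l" using s s' R by linarith+
        then have "adjacent_view t s t' s'"
          using pos unfolding adjacent_view_def by linarith
        ultimately show ?thesis by blast
      qed
      show ?thesis
      proof (cases "?l - s + r \<le> ?N")
        case False
        have far: "Suc s < t" using False R arith by linarith
        show ?thesis
        proof (cases "s < a r")
          case True
          then show ?thesis using copyL[of s r] r R arith far
            by (intro exI[of _ s]) (auto simp: adjacent_view_def)
        next
          case False2: False
          have "a r \<le> s" "s + a r < ?l" using False False2 arith by linarith+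
          from midL[OF r this] obtain s' where "s' < a r + c" "J r s s'" by blast
          moreover from this have "Suc s' < t'" using R arith by linarith
          ultimately show ?thesis using far by (auto simp: adjacent_view_def)
        qed
      qed (rule copy)
    next
      case M
      have n: "ts ! (t + d) = ts' ! (t' + d)" "ts ! (t - d) = ts' ! (t' - d)"
        if "d \<le> Suc r" for d using M(5) that unfolding near_def by blast+
      have "1 \<le> t" "1 \<le> t'" using M arith by linarith+
      \<comment> \<open>A move to a neighbouring factor is answered by the neighbour, whose
        neighbourhood of radius r lies within the one of radius \<open>Suc r\<close> around
        t.\<close>
      have "near r (Suc t) (Suc t')"
        unfolding near_def
      proof (intro allI impI conjI)
        fix k assume "k \<le> r"
        then show "ts ! (Suc t + k) = ts' ! (Suc t' + k)" using n(1)[of "Suc k"] by simp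
        show "ts ! (Suc t - k) = ts' ! (Suc t' - k)"
          using n(1)[of 1] n(2)[of "k - 1"] \<open>k \<le> r\<close> by (cases k) simp_all
      qed
      then have nbr_right: "J r (Suc t) (Suc t')" using M arith unfolding J_def by auto
      have "near r (t - 1) (t' - 1)"
        unfolding near_def
      proof (intro allI impI conjI)
        fix k assume "k \<le> r"
        then show "ts ! (t - 1 - k) = ts' ! (t' - 1 - k)" using n(2)[of "Suc k"] by simp
        show "ts ! (t - 1 + k) = ts' ! (t' - 1 + k)"
          using n(2)[of 1] n(1)[of "k - 1"] \<open>k \<le> r\<close> \<open>1 \<le> t\<close> \<open>1 \<le> t'\<close> by (cases k) simp_all
      qed
      then have nbr_left: "J r (t - 1) (t' - 1)" using M arith unfolding J_def by auto
      from pos show ?thesis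
      proof cases
        case far_left
        show ?thesis
        proof (cases "s < a r")
          case True
          then show ?thesis using copyL[of s r] r M arith far_left
            by (intro exI[of _ s]) (auto simp: adjacent_view_def)
        next
          case False
          have "a r \<le> s" "s + a r < ?l" using False far_left M arith by linarith+
          from midL[OF r this] obtain s' where "s' < a r + c" "J r s s'" by blast
          moreover from this have "Suc s' < t'" using M arith by linarith
          ultimately show ?thesis using far_left by (auto simp: adjacent_view_def)
        qed
      next
        case far_right
        show ?thesis
        proof (cases "?l - s \<le> a r")
          case True
          then obtain s' where s': "s' < ?l'" "?l - s = ?l' - s'" using mirror[of s] s arith by auto
          then have "J r s s'" using True r c s arith by (intro copyR) linarith+
          moreover have "Suc t' < s'" using s' True M arith by linarith
          ultimately show ?thesis using far_right by (auto simp: adjacent_view_def)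
        next
          case False
          have "a r \<le> s" "s + a r < ?l" using False far_right M arith by linarith+
          from midR[OF r this] obtain s' where "?l' - a r - c \<le> s'" "J r s s'" by blast
          moreover from this have "Suc t' < s'" using M arith by linarith
          ultimately show ?thesis using far_right by (auto simp: adjacent_view_def)
        qed
      next
        case left
        with nbr_left \<open>1 \<le> t'\<close> show ?thesis
          by (intro exI[of _ "t' - 1"]) (auto simp: adjacent_view_def)
      next
        case eq
        with down[OF r J] show ?thesis by (auto simp: adjacent_view_def)
      next
        case right
        with nbr_right show ?thesis by (auto simp: adjacent_view_def)
      qed
    qed
  qed
qed

section \<open>Factors padded by copies of an idempotent\<close>

definition blk :: "nat \<Rightarrow> 'a list \<Rightarrow> 'a list \<Rightarrow> 'a list list" where
  "blk p E v = replicate p E @ [E @ v @ E] @ replicate p E"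

text \<open>The copies of \<open>E\<close> around each \<open>E v E\<close> serve the game: a
  neighbourhood of radius p meets at most one of the words \<open>E v E\<close>. All blocks have 2p
  + 1 entries, whatever v is, so block number and offset come from division.\<close>

definition toks :: "nat \<Rightarrow> 'a list \<Rightarrow> 'a list list \<Rightarrow> 'a list list" where
  "toks p E vs = concat (map (blk p E) vs)"

lemma toks_append [simp]: "toks p E (us @ vs) = toks p E us @ toks p E vs"
  by (simp add: toks_def)

lemma set_toks: "v \<in> set (toks p E vs) \<Longrightarrow> v = E \<or> (\<exists>u\<in>set vs. v = E @ u @ E)"
  by (auto simp: toks_def blk_def)

lemma length_toks [simp]: "length (toks p E vs) = (2 * p + 1) * length vs"
  by (induction vs) (auto simp: toks_def blk_def)

lemma nth_toks:
  assumes "k < length vs" "i < 2 * p + 1"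
  shows "toks p E vs ! (k * (2 * p + 1) + i) = (if i = p then E @ vs ! k @ E else E)"
  using assms
proof (induction vs arbitrary: k)
  case (Cons v vs)
  have blk: "blk p E v ! i = (if i = p then E @ v @ E else E)" "length (blk p E v) = 2 * p + 1"
    using Cons.prems(2) by (auto simp: blk_def nth_append nth_Cons')
  show ?case
  proof (cases k)
    case 0
    with blk Cons.prems(2) show ?thesis by (simp add: toks_def nth_append)
  next
    case (Suc k')
    have "toks p E (v # vs) ! (k * (2 * p + 1) + i) =
        (blk p E v @ toks p E vs) ! (length (blk p E v) + (k' * (2 * p + 1) + i))"
      by (simp add: toks_def Suc blk(2) add_ac)
    also have "\<dots> = toks p E vs ! (k' * (2 * p + 1) + i)" by (rule nth_append_length_plus)
    finally show ?thesis using Cons by (simp add: Suc)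
  qed
qed simp

text \<open>A shift by d \<le> p that leaves block k stops in the padding of the neighbouring block,
  on the near side of its middle, so the only \<open>E v E\<close> it can meet is the one of block
  k.\<close>

lemma toks_window:
  assumes "k < length vs" "i < 2 * p + 1" "d \<le> p"
  shows "k * (2 * p + 1) + i + d < length (toks p E vs) \<Longrightarrow>
      toks p E vs ! (k * (2 * p + 1) + i + d) = (if i + d = p then E @ vs ! k @ E else E)"
    and "d \<le> k * (2 * p + 1) + i \<Longrightarrow>
      toks p E vs ! (k * (2 * p + 1) + i - d) = (if i = p + d then E @ vs ! k @ E else E)"
proof -
  let ?q = "2 * p + 1"
  assume len: "k * ?q + i + d < length (toks p E vs)"
  show "toks p E vs ! (k * ?q + i + d) = (if i + d = p then E @ vs ! k @ E else E)"
  proof (cases "i + d < ?q")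
    case True
    then show ?thesis using nth_toks[OF assms(1) True, of E] by (simp only: add.assoc)
  next
    case False
    have eq: "k * ?q + i + d = Suc k * ?q + (i + d - ?q)" using False by simp
    have "Suc k < length vs"
    proof (rule ccontr)
      assume "\<not> Suc k < length vs"
      then have "length vs \<le> Suc k" by simp
      then have "length vs * ?q \<le> Suc k * ?q" by (rule mult_le_mono1)
      then show False using len False by (simp add: mult.commute)
    qed
    from nth_toks[OF this, of "i + d - ?q" p E] False assms(2,3) show ?thesis unfolding eq by auto
  qed
next
  let ?q = "2 * p + 1"
  assume d: "d \<le> k * ?q + i"
  show "toks p E vs ! (k * ?q + i - d) = (if i = p + d then E @ vs ! k @ E else E)"
  proof (cases "d \<le> i")
    case True
    then have "k * ?q + i - d = k * ?q + (i - d)" by simp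
    with nth_toks[OF assms(1), of "i - d" p E] assms(2) True show ?thesis by auto
  next
    case False
    with d obtain k' where k: "k = Suc k'" by (cases k) auto
    have "k * ?q + i - d = k' * ?q + (i + ?q - d)" using False assms(3) by (simp add: k)
    with nth_toks[of k' vs "i + ?q - d" p E] assms False k show ?thesis by auto
  qed
qed

text \<open>The neighbourhood of \<open>s\<close> depends only on its offset in its block and on the
  v of that block. Every v occurs in \<open>F\<close>, so the copy of \<open>F\<close> between
  \<open>X\<close> and \<open>Y\<close> has a block of the same kind, and the same offset there is
  the answer. Nonempty \<open>X\<close> and \<open>Y\<close> keep its neighbourhood inside the
  word.\<close>

lemma toks_placement:
  assumes "set vs \<subseteq> set F" "Y \<noteq> []" "X \<noteq> []" "r \<le> p" "b = (2 * p + 1) * length X"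
    and s: "(2 * p + 1) * length F \<le> s" "s + (2 * p + 1) * length F < length (toks p E vs)"
    and F: "F \<noteq> []"
  shows "\<exists>s'. b \<le> s' \<and> s' < b + (2 * p + 1) * length F \<and>
     (\<forall>d\<le>r. toks p E vs ! (s + d) = toks p E (X @ F @ Y) ! (s' + d) \<and>
            toks p E vs ! (s - d) = toks p E (X @ F @ Y) ! (s' - d))"
proof -
  let ?q = "2 * p + 1"
  define k where "k = s div ?q"
  define i where "i = s mod ?q"
  have sk: "s = k * ?q + i" unfolding k_def i_def by (rule div_mult_mod_eq[symmetric])
  have i: "i < ?q" by (simp add: i_def)
  have Fq: "?q \<le> ?q * length F" using F by (cases F) auto
  have k: "k < length vs" unfolding k_def
    using s(2) by (simp add: div_less_iff_less_mult mult.commute)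
  then obtain l where l: "l < length F" "F ! l = vs ! k"
    using assms(1) by (metis in_set_conv_nth nth_mem subsetD)
  define k' where "k' = length X + l"
  have k': "k' < length (X @ F @ Y)" "(X @ F @ Y) ! k' = vs ! k"
    using l by (auto simp: k'_def nth_append)
  have len2: "k' * ?q + ?q + ?q \<le> length (toks p E (X @ F @ Y))"
  proof -
    have "Suc (Suc k') \<le> length (X @ F @ Y)" using l assms(2) by (cases Y) (auto simp: k'_def)
    then have "Suc (Suc k') * ?q \<le> length (X @ F @ Y) * ?q" by (rule mult_le_mono1)
    then show ?thesis by (simp add: algebra_simps)
  qed
  have k'1: "?q \<le> k' * ?q" using assms(3) by (cases X) (auto simp: k'_def)
  show ?thesis
  proof (intro exI[of _ "k' * ?q + i"] conjI allI impI)
    show "b \<le> k' * ?q + i" by (simp add: assms(5) k'_def algebra_simps)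
    have "Suc l * ?q \<le> length F * ?q" using l by (intro mult_le_mono1) simp
    then show "k' * ?q + i < b + ?q * length F"
      using i by (simp add: assms(5) k'_def algebra_simps)
    fix d assume "d \<le> r"
    then have d: "d \<le> p" using assms(4) by simp
    have 1: "k * ?q + i + d < length (toks p E vs)"
      using s(2) Fq d unfolding sk by linarith
    have 2: "k' * ?q + i + d < length (toks p E (X @ F @ Y))"
      using len2 i d by linarith
    have 3: "d \<le> k * ?q + i" using s(1) Fq d unfolding sk by linarith
    have 4: "d \<le> k' * ?q + i" using k'1 d by linarith
    show "toks p E vs ! (s + d) = toks p E (X @ F @ Y) ! (k' * ?q + i + d)"
      unfolding sk toks_window(1)[OF k i d 1] toks_window(1)[OF k'(1) i d 2] k'(2) ..
    show "toks p E vs ! (s - d) = toks p E (X @ F @ Y) ! (k' * ?q + i - d)"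
      unfolding sk toks_window(2)[OF k i d 3] toks_window(2)[OF k'(1) i d 4] k'(2) ..
  qed
qed

lemma length_pw [simp]: "length (pw k u) = k * length u"
  by (induction k) auto

text \<open>One copy of \<open>F\<close> yields c factors, and n copies on either side are exactly
  the margin that \<open>tokens_step\<close> asks for. Both places b where an answer may be demanded
  are a multiple of c away from an end, so a complete copy of \<open>F\<close> starts there.\<close>

lemma bisim_toks:
  fixes K :: nat and E :: "'a list"
  defines "n \<equiv> 2 * K + 4"
  assumes F: "F \<noteq> []" "\<And>v. v \<in> set F \<Longrightarrow> set v \<subseteq> set E"
    and m: "set m \<subseteq> set F" "set m' \<subseteq> set F"
  shows "bisim K (concat (toks K E (pw n F @ m @ pw n F))) (concat (toks K E (pw n F @ m' @ pw n F)))"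
proof -
  define c where "c = (2 * K + 1) * length F"
  define W where "W = (\<lambda>m. toks K E (pw n F @ m @ pw n F))"
  define J where "J = (\<lambda>ts ts' r t t'. r \<le> K \<and> ((t = t' \<and> t < (2 * r + 2) * c) \<or>
      (t < length ts \<and> t' < length ts' \<and> length ts - t = length ts' - t' \<and>
        length ts - t \<le> (2 * r + 2) * c) \<or>
      ((2 * r + 2) * c \<le> t \<and> t + (2 * r + 2) * c < length ts \<and>
       (2 * r + 2) * c \<le> t' \<and> t' + (2 * r + 2) * c < length ts' \<and>
       (\<forall>d\<le>r. ts ! (t + d) = (ts' :: 'a list list) ! (t' + d) \<and> ts ! (t - d) = ts' ! (t' - d)))))"
  define I where "I = (\<lambda>ts ts' r i i'. \<exists>t t' p. J ts ts' r t t' \<and> p < length (ts ! t) \<and>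
      i = tpos ts t p \<and> i' = tpos ts' t' p)"
  have forth: "forth K (concat (W m)) (concat (W m')) (I (W m) (W m'))"
    and letter: "\<And>r t t'. J (W m) (W m') r t t' \<Longrightarrow>
      t < length (W m) \<and> t' < length (W m') \<and> W m ! t = W m' ! t'"
    if m: "set m \<subseteq> set F" "set m' \<subseteq> set F" for m m'
  proof -
    have Wm: "W m = toks K E (pw n F) @ toks K E m @ toks K E (pw n F)" for m
      by (simp add: W_def)
    have lenP: "(2 * K + 4) * c \<le> length (toks K E (pw n F))" by (simp only: length_toks length_pw n_def c_def mult.left_commute order_refl)
    have "length F \<ge> 1" using F(1) by (cases F) auto
    then have "(2 * K + 1) * 1 \<le> c" unfolding c_def by (rule mult_le_mono2)
    then have Kc: "K < c" by simp
    have lenW: "length (W m) = 2 * (n * c) + (2 * K + 1) * length m" for m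
      by (simp add: W_def c_def algebra_simps)
    have setW: "set (pw n F @ m @ pw n F) \<subseteq> set F" if "set m \<subseteq> set F" for m
      using that set_pw_subset[of n F] by auto
    have place: "\<exists>s'. b \<le> s' \<and> s' < b + c \<and>
        (\<forall>d\<le>r. W m ! (s + d) = W m' ! (s' + d) \<and> W m ! (s - d) = W m' ! (s' - d))"
      if r: "r < K" and s: "c \<le> s" "s + c < length (W m)"
        and b: "b \<in> {(2 * r + 2) * c, length (W m') - (2 * r + 2) * c - c}" for r s b
    proof -
      \<comment> \<open>The copies of \<open>F\<close> that are left over once 2r + 2 outer copies
        and the one holding the answer are set apart.\<close>
      define j where "j = n - (2 * r + 3)"
      have n: "n = (2 * r + 2) + (1 + j)" "n = j + (1 + (2 * r + 2))" "j \<ge> 1"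
        using r by (simp_all add: j_def n_def)
      have ne: "pw k F \<noteq> []" if "k \<ge> 1" for k using F(1) that by (cases k) auto
      have "\<exists>X Y. X \<noteq> [] \<and> Y \<noteq> [] \<and> pw n F @ m' @ pw n F = X @ F @ Y \<and> b = (2 * K + 1) * length X"
        using b
      proof (elim insertE emptyE)
        assume b: "b = (2 * r + 2) * c"
        show ?thesis
        proof (intro exI conjI)
          show "pw (2 * r + 2) F \<noteq> []" "pw j F @ m' @ pw n F \<noteq> []"
            using F(1) ne[of j] n(3) by simp_all
          show "pw n F @ m' @ pw n F = pw (2 * r + 2) F @ F @ pw j F @ m' @ pw n F"
            by (subst n(1)) (simp only: pw_add pw_1 append.assoc)
          show "b = (2 * K + 1) * length (pw (2 * r + 2) F)" by (simp only: b c_def length_pw mult.left_commute)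
        qed
      next
        assume b: "b = length (W m') - (2 * r + 2) * c - c"
        show ?thesis
        proof (intro exI conjI)
          show "pw n F @ m' @ pw j F \<noteq> []" "pw (2 * r + 2) F \<noteq> []"
            using F(1) ne[of j] n(3) by simp_all
          have "pw n F = pw j F @ F @ pw (2 * r + 2) F"
            by (subst n(2)) (simp only: pw_add pw_1)
          then show "pw n F @ m' @ pw n F = (pw n F @ m' @ pw j F) @ F @ pw (2 * r + 2) F"
            by (simp only: append.assoc)
          have nc: "n * c = j * c + c + (2 * r + 2) * c" by (subst n(2)) (simp add: algebra_simps)
          have "(2 * K + 1) * length (pw n F @ m' @ pw j F) = n * c + (2 * K + 1) * length m' + j * c"
            by (simp add: c_def algebra_simps)
          then show "b = (2 * K + 1) * length (pw n F @ m' @ pw j F)"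
            unfolding b lenW using nc by linarith
        qed
      qed
      then obtain X Y where XY: "X \<noteq> []" "Y \<noteq> []" "pw n F @ m' @ pw n F = X @ F @ Y"
        "b = (2 * K + 1) * length X" by blast
      show ?thesis
        using toks_placement[OF setW[OF m(1)] XY(2,1) less_imp_le[OF r] XY(4) _ _ F(1), of s E] s
        unfolding W_def XY(3) c_def by blast
    qed
    note step = tokens_step[OF Wm[of m] Wm[of m'] lenP Kc place, of r for r]
    show letter: "t < length (W m) \<and> t' < length (W m') \<and> W m ! t = W m' ! t'"
      if "J (W m) (W m') r t t'" for r t t'
      using that step(1) unfolding J_def by blast
    show "forth K (concat (W m)) (concat (W m')) (I (W m) (W m'))"
      unfolding I_def
    proof (rule forth_concat[where B = "set E"])
      fix v assume "v \<in> set (W m) \<union> set (W m')"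
      then have "v = E \<or> (\<exists>u\<in>set F. v = E @ u @ E)"
        using set_toks[of v K E] setW[OF m(1)] setW[OF m(2)] unfolding W_def by blast
      then show "set v = set E"
      proof (elim disjE bexE)
        fix u assume "u \<in> set F" "v = E @ u @ E"
        with F(2)[of u] show ?thesis by auto
      qed simp
    next
      fix r t t' assume "J (W m) (W m') r t t'"
      then show "t < length (W m) \<and> t' < length (W m') \<and> W m ! t = W m' ! t'"
        by (rule letter)
    next
      fix r s assume "r < K" "s < length (W m)"
      with step(2)[of r s] show "\<exists>s'. J (W m) (W m') r s s'" unfolding J_def by auto
    next
      fix r t t' assume "r < K" "J (W m) (W m') (Suc r) t t'"
      with step(3)[of r t t'] show "J (W m) (W m') r t t'" unfolding J_def by auto
    next
      fix r t t' s assume "r < K" "J (W m) (W m') (Suc r) t t'" "s < length (W m)"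
      with step(4)[of r t t' s] show "\<exists>s'. J (W m) (W m') r s s' \<and> adjacent_view t s t' s'"
        unfolding J_def by auto
    qed
  qed
  have J_sym: "J ts ts' r t t' \<longleftrightarrow> J ts' ts r t' t" for ts ts' r t t'
    unfolding J_def by auto
  have "(\<lambda>r i i'. I (W m) (W m') r i' i) = I (W m') (W m)"
  proof (intro ext)
    fix r i i'
    show "I (W m) (W m') r i' i \<longleftrightarrow> I (W m') (W m) r i i'"
      unfolding I_def using letter[OF m] J_sym[of "W m" "W m'"] by metis
  qed
  with forth[OF m] forth[OF m(2,1)] show ?thesis
    unfolding bisim_def W_def by metis
qed

section \<open>Necessity: the identity of DA in the local monoids\<close>

lemma synclass_concat_cong:
  "(\<And>v. v \<in> set vs \<Longrightarrow> synclass L (f v) = synclass L (g v)) \<Longrightarrow>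
   synclass L (concat (map f vs)) = synclass L (concat (map g vs))"
proof (induction vs)
  case (Cons v vs)
  have "synclass L (f v @ concat (map f vs)) = synclass L (g v @ concat (map g vs))"
    by (intro synclass_append_cong Cons) simp_all
  then show ?case by simp
qed simp

text \<open>The padding needed by the game disappears in the monoid, since \<open>E\<close> is
  idempotent.\<close>

lemma synclass_toks:
  assumes "synclass L (E @ E) = synclass L E"
  shows "synclass L (concat (toks p E vs)) = synclass L (concat (map (\<lambda>v. E @ v @ E) vs))"
proof -
  have pad: "synclass L (pw p E @ E) = synclass L E" "synclass L (E @ pw p E) = synclass L E" for p
  proof -
    show 1: "synclass L (E @ pw p E) = synclass L E" for p
    proof (induction p)
      case (Suc p)
      with synclass_append_cong[OF refl Suc, of E] assms show ?case by simp
    qed simp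
    show "synclass L (pw p E @ E) = synclass L E" using 1 by (simp add: pw_commute[symmetric])
  qed
  have "synclass L (concat (blk p E v)) = synclass L (E @ v @ E)" for v
  proof -
    have "synclass L ((pw p E @ E) @ v @ (E @ pw p E)) = synclass L (E @ v @ E)"
      by (intro synclass_append_cong pad refl)
    then show ?thesis by (simp add: blk_def pw_def)
  qed
  then have "synclass L (concat (map (\<lambda>v. concat (blk p E v)) vs)) =
      synclass L (concat (map (\<lambda>v. E @ v @ E) vs))"
    by (intro synclass_concat_cong)
  moreover have "concat (toks p E vs) = concat (map (\<lambda>v. concat (blk p E v)) vs)"
    by (induction vs) (simp_all add: toks_def)
  ultimately show ?thesis by simp
qed

text \<open>This is the identity defining \<open>DA\<close>, for the local monoid at the idempotent \<open>E\<close>.\<close>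

lemma definable_local_identity:
  assumes f: "sentence f" "L = {w. sat w (\<lambda>_. 0) f}"
    and E: "synclass L (E @ E) = synclass L E"
    and F: "\<And>v. v \<in> set F \<Longrightarrow> set v \<subseteq> set E" and m: "set m \<subseteq> set F" "F \<noteq> []"
  defines "h \<equiv> \<lambda>vs. concat (map (\<lambda>v. E @ v @ E) vs)"
  assumes idem: "synclass L (h F @ h F) = synclass L (h F)"
  shows "synclass L (h F @ h m @ h F) = synclass L (h F)"
proof -
  \<comment> \<open>The exponent matching \<open>Suc (qd f)\<close> rounds, the extra round being
    spent on the contexts of the syntactic congruence.\<close>
  define n where "n = 2 * Suc (qd f) + 4"
  have h: "h (u @ v) = h u @ h v" for u v by (simp add: h_def)
  have hF: "synclass L (h (pw k F)) = synclass L (h F)" if "k \<ge> 1" for k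
    using that
  proof (induction k rule: dec_induct)
    case (step k)
    with synclass_append_cong[OF refl step.IH, of "h F"] idem show ?case by (simp add: h)
  qed (simp add: h_def)
  have n: "n \<ge> 1" by (simp add: n_def)
  let ?t = "\<lambda>m. concat (toks (Suc (qd f)) E (pw n F @ m @ pw n F))"
  have sandwich: "synclass L (?t m) = synclass L (h F @ h m @ h F)" for m
  proof -
    have "synclass L (?t m) = synclass L (h (pw n F @ m @ pw n F))"
      unfolding h_def by (rule synclass_toks[OF E])
    also have "\<dots> = synclass L (h F @ h m @ h F)"
      unfolding h by (intro synclass_append_cong hF n refl)
    finally show ?thesis .
  qed
  have "bisim (Suc (qd f)) (?t m) (?t [])"
    unfolding n_def using m F by (intro bisim_toks) auto
  from bisim_synclass[OF f this] have "synclass L (h F @ h m @ h F) = synclass L (h F @ h [] @ h F)"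
    unfolding sandwich .
  then show ?thesis using idem by (simp add: h_def)
qed


text \<open>An element of the submonoid belonging to an idempotent \<open>g\<close> of the local
  monoid is a product of words \<open>E v E\<close>, each of them a factor of \<open>g\<close>.
  Writing \<open>g\<close> through every one of these factors in turn gives a word for
  \<open>g\<close> in which all of them occur, as the identity for definable languages
  demands.\<close>

theorem definable_imp_MeDA:
  fixes L :: "'a::finite list set"
  assumes "FO2Inv_definable L"
  shows "MeDA (syntactic_monoid L)"
proof -
  let ?M = "syntactic_monoid L"
  from assms obtain f where f: "sentence f" "L = {w. sat w (\<lambda>_. 0) f}"
    by (auto simp: FO2Inv_definable_def)
  have fin: "finite (range (synclass L))" by (rule finite_range_synclass[OF f])
  have "DA (local_monoid ?M e)" if e: "Defs.idem ?M e" for e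
  proof -
    let ?N = "local_monoid ?M e"
    from e obtain x where x: "e = synclass L x" by (auto simp: idem_def)
    let ?B = "letters_above L x"
    have xx: "synclass L (x @ x) = synclass L x" using e by (simp add: idem_def x)
    \<comment> \<open>The word s b t represents the idempotent \<open>e\<close>, so putting it in
      front of \<open>E\<close> keeps the class and adds the letter b.\<close>
    have cover: "\<exists>E. synclass L E = synclass L x \<and> set bs \<subseteq> set E" if "set bs \<subseteq> ?B" for bs
      using that
    proof (induction bs)
      case (Cons b bs)
      then obtain E where E: "synclass L E = synclass L x" "set bs \<subseteq> set E" by auto
      from Cons.prems obtain s t where "synclass L x = synclass L (s @ [b] @ t)"
        by (auto simp: letters_above_def)
      then have "synclass L ((s @ [b] @ t) @ E) = synclass L (x @ x)"
        by (intro synclass_append_cong E(1)) (rule sym)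
      then have "synclass L ((s @ [b] @ t) @ E) = synclass L x" by (simp only: xx)
      moreover have "set (b # bs) \<subseteq> set ((s @ [b] @ t) @ E)" using E(2) by auto
      ultimately show ?case by blast
    qed auto
    obtain bs where bs: "set bs = ?B" using finite_list[OF finite] by blast
    obtain E where Ex: "synclass L E = synclass L x" and "?B \<subseteq> set E"
      using cover[of bs] unfolding bs by blast
    moreover have "set E \<subseteq> ?B" by (rule set_subset_letters_above) (rule Ex[symmetric])
    ultimately have setE: "set E = ?B" by blast
    have E: "synclass L E = e" unfolding x by (rule Ex)
    have EE: "synclass L (E @ E) = synclass L E"
      using synclass_append_cong[OF Ex Ex] by (simp only: Ex xx)
    have carr: "carrier ?N = {synclass L (E @ v @ E) | v. set v \<subseteq> set E}"
    proof -
      have "carrier ?N = (\<lambda>v. synclass L (x @ v @ x)) ` lists ?B"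
        unfolding x by (simp add: local_monoid_def eMe_e_syntactic_monoid)
      also have "\<dots> = (\<lambda>v. synclass L (E @ v @ E)) ` lists ?B"
        by (intro image_cong refl synclass_append_cong) (simp_all add: E x)
      also have "\<dots> = {synclass L (E @ v @ E) | v. set v \<subseteq> set E}" unfolding setE by blast
      finally show ?thesis .
    qed
    have mult: "synclass L u \<otimes>\<^bsub>?N\<^esub> synclass L v = synclass L (u @ v)" for u v
      by (simp add: local_monoid_def)
    have one: "\<one>\<^bsub>?N\<^esub> = synclass L E" by (simp add: local_monoid_def E)
    have monoid: "monoid ?N" unfolding x using xx by (rule monoid_local_monoid)
    interpret N: monoid ?N by (rule monoid)
    have "carrier ?N \<subseteq> range (synclass L)" unfolding carr by blast
    then have finN: "finite (carrier ?N)" using fin by (rule finite_subset)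
    define h where "h = (\<lambda>vs. concat (map (\<lambda>v. E @ v @ E) vs))"
    have h_app: "h (u @ v) = h u @ h v" and h_single: "h [a] = E @ a @ E" for u v a
      by (simp_all add: h_def)
    have absorb: "synclass L (w @ E @ E @ u) = synclass L (w @ E @ u)" for w u
      using synclass_append_cong[OF refl synclass_append_cong[OF EE refl]] by simp
    have hE: "synclass L (w @ E @ h vs @ u) = synclass L (w @ h vs @ u)" if "vs \<noteq> []" for w vs u
      using that absorb[of w] by (cases vs) (auto simp: h_def)
    have "eMe_e ?N g = {g}" if g: "Defs.idem ?N g" for g
    proof -
      have gN: "g \<in> carrier ?N" and gg: "g \<otimes>\<^bsub>?N\<^esub> g = g" using g by (simp_all add: idem_def)
      define above where "above = (\<lambda>v. set v \<subseteq> set E \<and> J_le ?N g (synclass L (E @ v @ E)))"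
      \<comment> \<open>An upper bound for the submonoid generated by the elements above
        \<open>g\<close>; the outer \<open>E\<close> on both sides turns the empty product into the
        unit.\<close>
      define Z where "Z = {synclass L (E @ h vs @ E) | vs. \<forall>v\<in>set vs. above v}"
      have hN: "synclass L (E @ h vs @ E) \<in> carrier ?N" if "\<forall>v\<in>set vs. above v" for vs
      proof -
        have "set (h vs) \<subseteq> set E" using that by (auto simp: h_def above_def)
        then show ?thesis unfolding carr by blast
      qed
      have "submonoid Z ?N"
      proof (rule submonoid.intro)
        show "Z \<subseteq> carrier ?N" using hN by (auto simp: Z_def)
        show "\<one>\<^bsub>?N\<^esub> \<in> Z" unfolding Z_def one
          using EE by (intro CollectI exI[of _ "[]"]) (simp add: h_def)
        fix a b assume "a \<in> Z" "b \<in> Z"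
        then obtain us vs where ab: "a = synclass L (E @ h us @ E)" "b = synclass L (E @ h vs @ E)"
          "\<forall>v\<in>set us. above v" "\<forall>v\<in>set vs. above v" unfolding Z_def by blast
        have "a \<otimes>\<^bsub>?N\<^esub> b = synclass L (E @ h (us @ vs) @ E)"
        proof -
          have "a \<otimes>\<^bsub>?N\<^esub> b = synclass L ((E @ h us @ E) @ E @ h vs @ E)" by (simp add: ab mult)
          also have "\<dots> = synclass L ((E @ h us) @ E @ h vs @ E)"
            using absorb[of "E @ h us" "h vs @ E"] by simp
          also have "\<dots> = synclass L ((E @ h us) @ h vs @ E)"
            using hE[of vs "E @ h us" E] absorb[of "E @ h us" "[]"] by (cases "vs = []") (auto simp: h_def)
          finally show ?thesis by (simp add: h_app)
        qed
        then show "a \<otimes>\<^bsub>?N\<^esub> b \<in> Z" unfolding Z_def using ab(3,4)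
          by (intro CollectI exI[of _ "us @ vs"]) auto
      qed
      moreover have "{m \<in> carrier ?N. J_le ?N g m} \<subseteq> Z"
      proof
        fix m assume "m \<in> {m \<in> carrier ?N. J_le ?N g m}"
        then obtain v where v: "m = synclass L (E @ v @ E)" "above v"
          unfolding carr above_def by blast
        have "m = synclass L (E @ h [v] @ E)"
          using absorb[of "[]" "v @ E @ E"] absorb[of "E @ v" "[]"] by (simp add: v h_single)
        with v(2) show "m \<in> Z" unfolding Z_def by (intro CollectI exI[of _ "[v]"]) simp
      qed
      ultimately have Me: "Me ?N g \<subseteq> Z" unfolding Me_def by (rule gen_submonoid_minimal)
      have "g \<otimes>\<^bsub>?N\<^esub> z \<otimes>\<^bsub>?N\<^esub> g = g" if "z \<in> Z" for z
      proof -
        from that obtain vs where z: "z = synclass L (E @ h vs @ E)" "\<forall>v\<in>set vs. above v"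
          unfolding Z_def by blast
        have "\<exists>s t. set s \<subseteq> set E \<and> set t \<subseteq> set E \<and> g = synclass L (h [s, v, t])"
          if "above v" for v
        proof -
          from that obtain s t where st: "s \<in> carrier ?N" "t \<in> carrier ?N"
            "g = s \<otimes>\<^bsub>?N\<^esub> synclass L (E @ v @ E) \<otimes>\<^bsub>?N\<^esub> t"
            unfolding above_def J_le_def by blast
          then obtain s' t' where "s = synclass L (E @ s' @ E)" "t = synclass L (E @ t' @ E)"
            "set s' \<subseteq> set E" "set t' \<subseteq> set E" unfolding carr by blast
          with st(3) show ?thesis by (intro exI[of _ s'] exI[of _ t']) (simp add: mult h_def)
        qed
        then obtain S T where ST: "\<And>v. above v \<Longrightarrow> set (S v) \<subseteq> set E \<and> set (T v) \<subseteq> set E \<and>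
            g = synclass L (h [S v, v, T v])" by metis
        \<comment> \<open>Each triple represents \<open>g\<close>, hence so does the whole
          concatenation, as \<open>g\<close> is idempotent.\<close>
        define F where "F = concat (map (\<lambda>v. [S v, v, T v]) vs)"
        show ?thesis
        proof (cases "vs = []")
          case True
          then have "z = \<one>\<^bsub>?N\<^esub>" using EE by (simp add: z one h_def)
          with gg gN show ?thesis by simp
        next
          case False
          then have Fne: "F \<noteq> []" by (cases vs) (auto simp: F_def)
          have "synclass L (h (concat (map (\<lambda>v. [S v, v, T v]) us))) = g"
            if "\<forall>v\<in>set us. above v" "us \<noteq> []" for us
            using that
          proof (induction us)
            case (Cons u us)
            then have "above u" by simp
            from ST[OF this] have u: "synclass L (h [S u, u, T u]) = g" by (elim conjE) (rule sym)
            show ?case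
            proof (cases "us = []")
              case True
              with u show ?thesis by simp
            next
              case False
              with Cons have "synclass L (h (concat (map (\<lambda>v. [S v, v, T v]) us))) = g" by simp
              then have "g \<otimes>\<^bsub>?N\<^esub> g =
                  synclass L (h [S u, u, T u] @ h (concat (map (\<lambda>v. [S v, v, T v]) us)))"
                unfolding mult[symmetric] using u by simp
              then show ?thesis unfolding h_app[symmetric] gg by simp
            qed
          qed simp
          from this[OF z(2) False] have hF: "synclass L (h F) = g" by (simp add: F_def)
          have "synclass L (h F @ h F) = synclass L (h F)"
            using gg unfolding hF[symmetric] mult .
          moreover have "set vs \<subseteq> set F" by (auto simp: F_def)
          moreover have "set v \<subseteq> set E" if "v \<in> set F" for v
          proof -
            from that obtain u where u: "u \<in> set vs" "v = S u \<or> v = u \<or> v = T u"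
              unfolding F_def by auto
            then have "above u" using z(2) by blast
            moreover from this have "set u \<subseteq> set E" unfolding above_def by blast
            ultimately show ?thesis using ST[of u] u(2) by metis
          qed
          ultimately have "synclass L (h F @ h vs @ h F) = synclass L (h F)"
            unfolding h_def by (intro definable_local_identity[OF f EE _ _ Fne])
          moreover have "g \<otimes>\<^bsub>?N\<^esub> z \<otimes>\<^bsub>?N\<^esub> g = synclass L (h F @ h vs @ h F)"
            using hE[OF False, of "h F" "E @ h F"] hE[OF Fne, of "h F @ h vs" "[]"]
            unfolding hF[symmetric] z(1) by (simp add: mult)
          ultimately show ?thesis by (simp add: hF)
        qed
      qed
      moreover have "\<one>\<^bsub>?N\<^esub> \<in> Me ?N g"
        unfolding Me_def
        by (intro submonoid.one_closed submonoid_gen_submonoid[OF monoid]) auto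
      then have "g \<in> eMe_e ?N g" using gg gN unfolding eMe_e_def
        by (intro CollectI exI[of _ "\<one>\<^bsub>?N\<^esub>"]) simp
      ultimately show ?thesis using Me unfolding eMe_e_def by blast
    qed
    then show ?thesis using monoid finN by (simp add: DA_def)
  qed
  then show ?thesis
    using monoid_syntactic_monoid[of L] fin by (simp add: MeDA_def)
qed

section \<open>Temporal definability over words\<close>

text \<open>Unary temporal logic with next, previous, future and past, represented by the properties
  it expresses and not by formulas. The last rule closes it under agreement at positions of the
  word, as values at other indices are arbitrary.\<close>

inductive tdef :: "('s list \<Rightarrow> nat \<Rightarrow> bool) \<Rightarrow> bool" where
  tdef_letter: "tdef (\<lambda>w i. w ! i = c)"
| tdef_not: "tdef P \<Longrightarrow> tdef (\<lambda>w i. \<not> P w i)"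
| tdef_and: "tdef P \<Longrightarrow> tdef Q \<Longrightarrow> tdef (\<lambda>w i. P w i \<and> Q w i)"
| tdef_next: "tdef P \<Longrightarrow> tdef (\<lambda>w i. Suc i < length w \<and> P w (Suc i))"
| tdef_prev: "tdef P \<Longrightarrow> tdef (\<lambda>w i. 0 < i \<and> P w (i - 1))"
| tdef_fut: "tdef P \<Longrightarrow> tdef (\<lambda>w i. \<exists>j. i < j \<and> j < length w \<and> P w j)"
| tdef_past: "tdef P \<Longrightarrow> tdef (\<lambda>w i. \<exists>j<i. P w j)"
| tdef_cong: "tdef P \<Longrightarrow> (\<And>w i. i < length w \<Longrightarrow> P w i \<longleftrightarrow> Q w i) \<Longrightarrow> tdef Q"

lemma tdef_or: "tdef P \<Longrightarrow> tdef Q \<Longrightarrow> tdef (\<lambda>w i. P w i \<or> Q w i)"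
  using tdef_not[OF tdef_and[OF tdef_not tdef_not, of P Q]] by simp

lemma tdef_True: "tdef (\<lambda>w i. True)"
  using tdef_or[OF tdef_letter tdef_not[OF tdef_letter], of undefined undefined] by simp

lemma tdef_const: "tdef (\<lambda>w i. b)"
  using tdef_True tdef_not[OF tdef_True] by (cases b) simp_all

lemma tdef_shift: "tdef P \<Longrightarrow> tdef (\<lambda>w i. i + k < length w \<and> P w (i + k))"
proof (induction k)
  case 0
  then show ?case by (auto intro: tdef_cong)
next
  case (Suc k)
  from tdef_next[OF Suc.IH[OF Suc.prems]] show ?case
    by (rule tdef_cong) auto
qed

lemma tdef_back: "tdef P \<Longrightarrow> tdef (\<lambda>w i. k \<le> i \<and> P w (i - k))"
proof (induction k)
  case (Suc k)
  from tdef_prev[OF Suc.IH[OF Suc.prems]] show ?case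
  proof (rule tdef_cong)
    show "(0 < i \<and> k \<le> i - 1 \<and> P w (i - 1 - k)) = (Suc k \<le> i \<and> P w (i - Suc k))" for w i
      by (cases i) auto
  qed
qed simp

lemma tdef_ev: "tdef P \<Longrightarrow> tdef (\<lambda>w i. \<exists>j. i \<le> j \<and> j < length w \<and> P w j)"
  by (rule tdef_cong[OF tdef_or[OF _ tdef_fut]]) (auto simp: le_less)

lemma tdef_factor: "tdef (\<lambda>w i. take (length x) (drop i w) = x)"
proof (induction x)
  case Nil
  then show ?case using tdef_True by simp
next
  case (Cons c x)
  from tdef_and[OF tdef_letter[of c] tdef_or[OF tdef_const[of "x = []"] tdef_next[OF Cons.IH]]]
  show ?case
  proof (rule tdef_cong)
    fix w :: "'a list" and i assume i: "i < length w"
    then have "drop i w = w ! i # drop (Suc i) w" by (simp add: Cons_nth_drop_Suc)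
    then show "(w ! i = c \<and> (x = [] \<or> Suc i < length w \<and> take (length x) (drop (Suc i) w) = x)) =
        (take (length (c # x)) (drop i w) = c # x)"
      using i by (cases "Suc i = length w") auto
  qed
qed

text \<open>If membership in the segment is itself expressible, by \<open>ins\<close>, every
  temporal move can be guarded by it and stays inside the segment.\<close>

lemma tdef_relativize:
  assumes "tdef P"
    and inside: "tdef ins" "\<And>w i. i < length w \<Longrightarrow> ins w i \<longleftrightarrow> lo w \<le> i \<and> i < hi w"
      "\<And>w. hi w \<le> length w"
  shows "\<exists>Q. tdef Q \<and> (\<forall>w i. lo w \<le> i \<longrightarrow> i < hi w \<longrightarrow>
           (Q w i \<longleftrightarrow> P (drop (lo w) (take (hi w) w)) (i - lo w)))"
  using assms(1)
proof induction
  case (tdef_letter c)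
  show ?case
  proof (intro exI conjI allI impI)
    fix w i assume "lo w \<le> i" "i < hi w"
    then show "(w ! i = c) = (drop (lo w) (take (hi w) w) ! (i - lo w) = c)"
      using inside(3)[of w] by simp
  qed (rule tdef.tdef_letter)
next
  case (tdef_not P)
  then obtain Q where "tdef Q" "\<forall>w i. lo w \<le> i \<longrightarrow> i < hi w \<longrightarrow>
      (Q w i \<longleftrightarrow> P (drop (lo w) (take (hi w) w)) (i - lo w))" by blast
  then show ?case by (intro exI[of _ "\<lambda>w i. \<not> Q w i"]) (simp add: tdef.tdef_not)
next
  case (tdef_and P P')
  then obtain Q Q' where "tdef Q" "tdef Q'" "\<forall>w i. lo w \<le> i \<longrightarrow> i < hi w \<longrightarrow>
      (Q w i \<longleftrightarrow> P (drop (lo w) (take (hi w) w)) (i - lo w))"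
    "\<forall>w i. lo w \<le> i \<longrightarrow> i < hi w \<longrightarrow>
      (Q' w i \<longleftrightarrow> P' (drop (lo w) (take (hi w) w)) (i - lo w))" by blast
  then show ?case by (intro exI[of _ "\<lambda>w i. Q w i \<and> Q' w i"]) (simp add: tdef.tdef_and)
next
  case (tdef_next P)
  then obtain Q where Q: "tdef Q" "\<And>w i. lo w \<le> i \<Longrightarrow> i < hi w \<Longrightarrow>
      (Q w i \<longleftrightarrow> P (drop (lo w) (take (hi w) w)) (i - lo w))" by blast
  show ?case
  proof (intro exI conjI allI impI)
    show "tdef (\<lambda>w i. Suc i < length w \<and> ins w (Suc i) \<and> Q w (Suc i))"
      by (intro tdef.tdef_next tdef.tdef_and inside Q)
    fix w i assume "lo w \<le> i" "i < hi w"
    then show "(Suc i < length w \<and> ins w (Suc i) \<and> Q w (Suc i)) =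
      (Suc (i - lo w) < length (drop (lo w) (take (hi w) w)) \<and>
       P (drop (lo w) (take (hi w) w)) (Suc (i - lo w)))"
      using inside(2)[of "Suc i" w] inside(3)[of w] Q(2)[of w "Suc i"] by (auto simp: Suc_diff_le)
  qed
next
  case (tdef_prev P)
  then obtain Q where Q: "tdef Q" "\<And>w i. lo w \<le> i \<Longrightarrow> i < hi w \<Longrightarrow>
      (Q w i \<longleftrightarrow> P (drop (lo w) (take (hi w) w)) (i - lo w))" by blast
  show ?case
  proof (intro exI conjI allI impI)
    show "tdef (\<lambda>w i. 0 < i \<and> ins w (i - 1) \<and> Q w (i - 1))"
      by (intro tdef.tdef_prev tdef.tdef_and inside Q)
    fix w i assume "lo w \<le> i" "i < hi w"
    then show "(0 < i \<and> ins w (i - 1) \<and> Q w (i - 1)) =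
      (0 < i - lo w \<and> P (drop (lo w) (take (hi w) w)) (i - lo w - 1))"
      using inside(2)[of "i - 1" w] inside(3)[of w] Q(2)[of w "i - 1"]
      by (cases "i = lo w") (auto simp: diff_diff_left add.commute)
  qed
next
  case (tdef_fut P)
  then obtain Q where Q: "tdef Q" "\<And>w i. lo w \<le> i \<Longrightarrow> i < hi w \<Longrightarrow>
      (Q w i \<longleftrightarrow> P (drop (lo w) (take (hi w) w)) (i - lo w))" by blast
  show ?case
  proof (intro exI conjI allI impI)
    show "tdef (\<lambda>w i. \<exists>j. i < j \<and> j < length w \<and> ins w j \<and> Q w j)"
      by (intro tdef.tdef_fut tdef.tdef_and inside Q)
    fix w i assume i: "lo w \<le> i" "i < hi w"
    let ?u = "drop (lo w) (take (hi w) w)"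
    have len: "length ?u = hi w - lo w" using inside(3)[of w] by simp
    show "(\<exists>j. i < j \<and> j < length w \<and> ins w j \<and> Q w j) =
      (\<exists>j. i - lo w < j \<and> j < length ?u \<and> P ?u j)"
    proof
      assume "\<exists>j. i < j \<and> j < length w \<and> ins w j \<and> Q w j"
      then obtain j where "i < j" "j < length w" "ins w j" "Q w j" by blast
      then show "\<exists>j. i - lo w < j \<and> j < length ?u \<and> P ?u j"
        using inside(2)[of j w] Q(2)[of w j] i unfolding len by (intro exI[of _ "j - lo w"]) auto
    next
      assume "\<exists>j. i - lo w < j \<and> j < length ?u \<and> P ?u j"
      then obtain j where "i - lo w < j" "j < hi w - lo w" "P ?u j" unfolding len by blast
      then show "\<exists>j. i < j \<and> j < length w \<and> ins w j \<and> Q w j"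
        using inside(2)[of "j + lo w" w] inside(3)[of w] Q(2)[of w "j + lo w"] i
        by (intro exI[of _ "j + lo w"]) auto
    qed
  qed
next
  case (tdef_past P)
  then obtain Q where Q: "tdef Q" "\<And>w i. lo w \<le> i \<Longrightarrow> i < hi w \<Longrightarrow>
      (Q w i \<longleftrightarrow> P (drop (lo w) (take (hi w) w)) (i - lo w))" by blast
  show ?case
  proof (intro exI conjI allI impI)
    show "tdef (\<lambda>w i. \<exists>j<i. ins w j \<and> Q w j)"
      by (intro tdef.tdef_past tdef.tdef_and inside Q)
    fix w i assume i: "lo w \<le> i" "i < hi w"
    let ?u = "drop (lo w) (take (hi w) w)"
    show "(\<exists>j<i. ins w j \<and> Q w j) = (\<exists>j<i - lo w. P ?u j)"
    proof
      assume "\<exists>j<i. ins w j \<and> Q w j"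
      then obtain j where "j < i" "ins w j" "Q w j" by blast
      then show "\<exists>j<i - lo w. P ?u j"
        using inside(2)[of j w] inside(3)[of w] Q(2)[of w j] i by (intro exI[of _ "j - lo w"]) auto
    next
      assume "\<exists>j<i - lo w. P ?u j"
      then obtain j where "j < i - lo w" "P ?u j" by blast
      then show "\<exists>j<i. ins w j \<and> Q w j"
        using inside(2)[of "j + lo w" w] inside(3)[of w] Q(2)[of w "j + lo w"] i
        by (intro exI[of _ "j + lo w"]) auto
    qed
  qed
next
  case (tdef_cong P P')
  then obtain Q where Q: "tdef Q" "\<And>w i. lo w \<le> i \<Longrightarrow> i < hi w \<Longrightarrow>
      (Q w i \<longleftrightarrow> P (drop (lo w) (take (hi w) w)) (i - lo w))" by blast
  show ?case
  proof (intro exI conjI allI impI)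
    fix w i assume i: "lo w \<le> i" "i < hi w"
    then have "i - lo w < length (drop (lo w) (take (hi w) w))" using inside(3)[of w] by simp
    with Q(2)[OF i] tdef_cong.hyps(2) show "Q w i = P' (drop (lo w) (take (hi w) w)) (i - lo w)"
      by blast
  qed (rule Q)
qed

lemma tdef_reverse:
  "tdef P \<Longrightarrow> \<exists>Q. tdef Q \<and> (\<forall>w i. i < length w \<longrightarrow> (Q w i \<longleftrightarrow> P (rev w) (length w - 1 - i)))"
proof (induction rule: tdef.induct)
  case (tdef_letter c)
  show ?case
    by (intro exI[of _ "\<lambda>w i. w ! i = c"]) (simp add: tdef.tdef_letter rev_nth)
next
  case (tdef_not P)
  then obtain Q where "tdef Q" "\<forall>w i. i < length w \<longrightarrow> (Q w i \<longleftrightarrow> P (rev w) (length w - 1 - i))"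
    by blast
  then show ?case by (intro exI[of _ "\<lambda>w i. \<not> Q w i"]) (simp add: tdef.tdef_not)
next
  case (tdef_and P P')
  then obtain Q Q' where "tdef Q" "tdef Q'"
    "\<forall>w i. i < length w \<longrightarrow> (Q w i \<longleftrightarrow> P (rev w) (length w - 1 - i))"
    "\<forall>w i. i < length w \<longrightarrow> (Q' w i \<longleftrightarrow> P' (rev w) (length w - 1 - i))"
    by blast
  then show ?case by (intro exI[of _ "\<lambda>w i. Q w i \<and> Q' w i"]) (simp add: tdef.tdef_and)
next
  case (tdef_next P)
  then obtain Q where Q: "tdef Q" "\<And>w i. i < length w \<Longrightarrow> (Q w i \<longleftrightarrow> P (rev w) (length w - 1 - i))"
    by blast
  show ?case
  proof (intro exI conjI allI impI)
    show "tdef (\<lambda>w i. 0 < i \<and> Q w (i - 1))" using Q(1) by (rule tdef.tdef_prev)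
    fix w :: "'a list" and i assume i: "i < length w"
    show "(0 < i \<and> Q w (i - 1)) =
        (Suc (length w - 1 - i) < length (rev w) \<and> P (rev w) (Suc (length w - 1 - i)))"
    proof (cases i)
      case (Suc j)
      then have "Suc (length w - 1 - i) = length w - 1 - j" using i by simp
      with Q(2)[of j w] i Suc show ?thesis by auto
    qed (use i in auto)
  qed
next
  case (tdef_prev P)
  then obtain Q where Q: "tdef Q" "\<And>w i. i < length w \<Longrightarrow> (Q w i \<longleftrightarrow> P (rev w) (length w - 1 - i))"
    by blast
  show ?case
  proof (intro exI conjI allI impI)
    show "tdef (\<lambda>w i. Suc i < length w \<and> Q w (Suc i))" using Q(1) by (rule tdef.tdef_next)
    fix w :: "'a list" and i assume i: "i < length w"
    show "(Suc i < length w \<and> Q w (Suc i)) =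
        (0 < length w - 1 - i \<and> P (rev w) (length w - 1 - i - 1))"
    proof (cases "Suc i < length w")
      case True
      with Q(2)[OF True] i show ?thesis by (simp add: diff_diff_left)
    qed (use i in auto)
  qed
next
  case (tdef_fut P)
  then obtain Q where Q: "tdef Q" "\<And>w i. i < length w \<Longrightarrow> (Q w i \<longleftrightarrow> P (rev w) (length w - 1 - i))"
    by blast
  show ?case
  proof (intro exI conjI allI impI)
    show "tdef (\<lambda>w i. \<exists>j<i. Q w j)" using Q(1) by (rule tdef.tdef_past)
    fix w :: "'a list" and i assume i: "i < length w"
    show "(\<exists>j<i. Q w j) = (\<exists>j. length w - 1 - i < j \<and> j < length (rev w) \<and> P (rev w) j)"
    proof
      assume "\<exists>j<i. Q w j"
      then obtain j where "j < i" "Q w j" by blast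
      with i Q(2)[of j w] show "\<exists>j. length w - 1 - i < j \<and> j < length (rev w) \<and> P (rev w) j"
        by (intro exI[of _ "length w - 1 - j"]) auto
    next
      assume "\<exists>j. length w - 1 - i < j \<and> j < length (rev w) \<and> P (rev w) j"
      then obtain j where "length w - 1 - i < j" "j < length w" "P (rev w) j" by auto
      with i Q(2)[of "length w - 1 - j" w] show "\<exists>j<i. Q w j"
        by (intro exI[of _ "length w - 1 - j"]) auto
    qed
  qed
next
  case (tdef_past P)
  then obtain Q where Q: "tdef Q" "\<And>w i. i < length w \<Longrightarrow> (Q w i \<longleftrightarrow> P (rev w) (length w - 1 - i))"
    by blast
  show ?case
  proof (intro exI conjI allI impI)
    show "tdef (\<lambda>w i. \<exists>j. i < j \<and> j < length w \<and> Q w j)" using Q(1) by (rule tdef.tdef_fut)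
    fix w :: "'a list" and i assume i: "i < length w"
    show "(\<exists>j. i < j \<and> j < length w \<and> Q w j) = (\<exists>j<length w - 1 - i. P (rev w) j)"
    proof
      assume "\<exists>j. i < j \<and> j < length w \<and> Q w j"
      then obtain j where "i < j" "j < length w" "Q w j" by blast
      with i Q(2)[of j w] show "\<exists>j<length w - 1 - i. P (rev w) j"
        by (intro exI[of _ "length w - 1 - j"]) auto
    next
      assume "\<exists>j<length w - 1 - i. P (rev w) j"
      then obtain j where "j < length w - 1 - i" "P (rev w) j" by auto
      with i Q(2)[of "length w - 1 - j" w] show "\<exists>j. i < j \<and> j < length w \<and> Q w j"
        by (intro exI[of _ "length w - 1 - j"]) auto
    qed
  qed
next
  case (tdef_cong P P')
  then obtain Q where Q: "tdef Q" "\<And>w i. i < length w \<Longrightarrow> (Q w i \<longleftrightarrow> P (rev w) (length w - 1 - i))"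
    by blast
  show ?case
  proof (intro exI conjI allI impI)
    fix w :: "'a list" and i assume i: "i < length w"
    then have "length w - 1 - i < length (rev w)" by simp
    with Q(2)[OF i] tdef_cong.hyps(2) show "Q w i = P' (rev w) (length w - 1 - i)" by blast
  qed (rule Q)
qed

text \<open>A formula is evaluated at the first position of a word, so it says nothing about the empty
  word, whose membership is left open.\<close>

definition tdef_on :: "'s list set \<Rightarrow> 's list set \<Rightarrow> bool" where
  "tdef_on A D \<longleftrightarrow> (\<exists>P. tdef P \<and> (\<forall>w\<in>A. w \<noteq> [] \<longrightarrow> (w \<in> D \<longleftrightarrow> P w 0)))"

lemma tdef_onI: "tdef P \<Longrightarrow> (\<And>w. w \<in> A \<Longrightarrow> w \<noteq> [] \<Longrightarrow> w \<in> D \<longleftrightarrow> P w 0) \<Longrightarrow> tdef_on A D"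
  unfolding tdef_on_def by blast

lemma tdef_on_cong: "tdef_on A D \<Longrightarrow> (\<And>w. w \<in> A \<Longrightarrow> w \<in> D \<longleftrightarrow> w \<in> D') \<Longrightarrow> tdef_on A D'"
  unfolding tdef_on_def by blast

lemma tdef_on_subset: "tdef_on A D \<Longrightarrow> B \<subseteq> A \<Longrightarrow> tdef_on B D"
  unfolding tdef_on_def by blast

lemma tdef_on_Compl:
  assumes "tdef_on A D"
  shows "tdef_on A (- D)"
proof -
  from assms obtain P where "tdef P" "\<forall>w\<in>A. w \<noteq> [] \<longrightarrow> (w \<in> D \<longleftrightarrow> P w 0)"
    unfolding tdef_on_def by blast
  then show ?thesis by (intro tdef_onI[OF tdef_not[of P]]) auto
qed

lemma tdef_on_Int:
  assumes "tdef_on A D" "tdef_on A D'"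
  shows "tdef_on A (D \<inter> D')"
proof -
  from assms obtain P P' where "tdef P" "tdef P'"
    "\<forall>w\<in>A. w \<noteq> [] \<longrightarrow> (w \<in> D \<longleftrightarrow> P w 0)" "\<forall>w\<in>A. w \<noteq> [] \<longrightarrow> (w \<in> D' \<longleftrightarrow> P' w 0)"
    unfolding tdef_on_def by blast
  then show ?thesis by (intro tdef_onI[OF tdef_and[of P P']]) auto
qed

lemma tdef_on_Un: "tdef_on A D \<Longrightarrow> tdef_on A D' \<Longrightarrow> tdef_on A (D \<union> D')"
  using tdef_on_Compl[OF tdef_on_Int[OF tdef_on_Compl tdef_on_Compl, of A D D']] by simp

lemma tdef_on_const: "tdef_on A {w. b}"
  by (rule tdef_onI[OF tdef_const[of b]]) simp

lemma tdef_on_UN: "finite I \<Longrightarrow> (\<And>i. i \<in> I \<Longrightarrow> tdef_on A (D i)) \<Longrightarrow> tdef_on A (\<Union>i\<in>I. D i)"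
proof (induction rule: finite_induct)
  case empty
  then show ?case using tdef_on_const[of A False] by simp
qed (simp add: tdef_on_Un)

lemma tdef_on_INT:
  assumes "finite I" "\<And>i. i \<in> I \<Longrightarrow> tdef_on A (D i)"
  shows "tdef_on A (\<Inter>i\<in>I. D i)"
proof -
  have "tdef_on A (- (\<Union>i\<in>I. - D i))" by (intro tdef_on_Compl tdef_on_UN assms)
  then show ?thesis by (rule tdef_on_cong) auto
qed

text \<open>Within \<open>A\<close>, the set \<open>D\<close> is a union of fibres of
  \<open>f\<close>, of which there are finitely many.\<close>

lemma tdef_on_finite_cases:
  assumes "finite (f ` A)" and "\<And>d. d \<in> f ` A \<Longrightarrow> tdef_on A {w. f w = d}"
    and "\<And>w w'. w \<in> A \<Longrightarrow> w' \<in> A \<Longrightarrow> f w = f w' \<Longrightarrow> w \<in> D \<Longrightarrow> w' \<in> D"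
  shows "tdef_on A D"
proof -
  have "tdef_on A (\<Union>d\<in>f ` (A \<inter> D). {w. f w = d})"
  proof (rule tdef_on_UN)
    show "finite (f ` (A \<inter> D))" by (rule finite_subset[OF _ assms(1)]) blast
    show "tdef_on A {w. f w = d}" if "d \<in> f ` (A \<inter> D)" for d using assms(2) that by blast
  qed
  then show ?thesis
  proof (rule tdef_on_cong)
    fix w assume w: "w \<in> A"
    show "w \<in> (\<Union>d\<in>f ` (A \<inter> D). {w. f w = d}) \<longleftrightarrow> w \<in> D"
    proof
      assume "w \<in> (\<Union>d\<in>f ` (A \<inter> D). {w. f w = d})"
      then obtain w' where w': "w' \<in> A" "w' \<in> D" "f w = f w'" by blast
      from assms(3)[OF w'(1) w w'(3)[symmetric] w'(2)] show "w \<in> D" .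
    qed (use w in blast)
  qed
qed

lemma tdef_on_rev:
  assumes "tdef_on A D"
  shows "tdef_on (rev ` A) {w. rev w \<in> D}"
proof -
  from assms obtain P where P: "tdef P" "\<forall>w\<in>A. w \<noteq> [] \<longrightarrow> (w \<in> D \<longleftrightarrow> P w 0)"
    unfolding tdef_on_def by blast
  from tdef_reverse[OF P(1)] obtain Q where Q: "tdef Q"
    "\<And>w i. i < length w \<Longrightarrow> (Q w i \<longleftrightarrow> P (rev w) (length w - 1 - i))" by blast
  \<comment> \<open>The first position of \<open>rev w\<close> is the last one of \<open>w\<close>;
    the formula gets there by looking for a position without a successor.\<close>
  let ?last = "\<lambda>w i. \<not> (Suc i < length w \<and> True)"
  have "tdef (\<lambda>w i. \<exists>j. i \<le> j \<and> j < length w \<and> ?last w j \<and> Q w j)"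
    by (intro tdef_ev tdef_and tdef_not tdef_next tdef_True Q)
  then show ?thesis
  proof (rule tdef_onI)
    fix w assume w: "w \<in> rev ` A" "w \<noteq> []"
    have "(\<exists>j. 0 \<le> j \<and> j < length w \<and> ?last w j \<and> Q w j) \<longleftrightarrow> Q w (length w - 1)"
    proof
      assume "\<exists>j. 0 \<le> j \<and> j < length w \<and> ?last w j \<and> Q w j"
      then obtain j where "j < length w" "\<not> Suc j < length w" "Q w j" by blast
      moreover from this have "j = length w - 1" by linarith
      ultimately show "Q w (length w - 1)" by simp
    next
      assume "Q w (length w - 1)"
      with w show "\<exists>j. 0 \<le> j \<and> j < length w \<and> ?last w j \<and> Q w j"
        by (intro exI[of _ "length w - 1"]) auto
    qed
    also have "\<dots> \<longleftrightarrow> P (rev w) 0" using Q(2)[of "length w - 1" w] w(2) by simp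
    also have "\<dots> \<longleftrightarrow> w \<in> {w. rev w \<in> D}" using P(2) w by auto
    finally show "w \<in> {w. rev w \<in> D} \<longleftrightarrow>
        (\<exists>j. 0 \<le> j \<and> j < length w \<and> ?last w j \<and> Q w j)" by simp
  qed
qed

lemma tdef_on_prefix:
  assumes "tdef_on B D" and "\<And>v. x @ v \<in> A \<Longrightarrow> v \<in> B"
  shows "tdef_on A {x @ v | v. v \<in> D}"
proof -
  from assms obtain P where P: "tdef P" "\<forall>w\<in>B. w \<noteq> [] \<longrightarrow> (w \<in> D \<longleftrightarrow> P w 0)"
    unfolding tdef_on_def by blast
  let ?k = "length x"
  have "tdef (\<lambda>w i. ?k \<le> i \<and> True)" by (intro tdef_back tdef_True)
  from tdef_relativize[OF P(1) this, of "\<lambda>_. ?k" length] obtain Q where Q: "tdef Q"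
    "\<And>w i. ?k \<le> i \<Longrightarrow> i < length w \<Longrightarrow> Q w i \<longleftrightarrow> P (drop ?k w) (i - ?k)" by auto
  \<comment> \<open>If nothing follows \<open>x\<close>, there is no position at which to evaluate
    \<open>Q\<close>, and membership of the empty word enters as a constant.\<close>
  have "tdef (\<lambda>w i. take ?k (drop i w) = x \<and>
      ((i + ?k < length w \<and> Q w (i + ?k)) \<or> (\<not> (i + ?k < length w \<and> True) \<and> [] \<in> D)))"
    by (intro tdef_and tdef_or tdef_not tdef_shift tdef_factor tdef_const Q)
  then show ?thesis
  proof (rule tdef_onI)
    fix w assume w: "w \<in> A" "w \<noteq> []"
    have eq: "w \<in> {x @ v | v. v \<in> D} \<longleftrightarrow> take ?k w = x \<and> drop ?k w \<in> D"
    proof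
      assume r: "take ?k w = x \<and> drop ?k w \<in> D"
      then have "w = x @ drop ?k w" using append_take_drop_id[of ?k w] by simp
      with r show "w \<in> {x @ v | v. v \<in> D}" by blast
    qed auto
    show "w \<in> {x @ v | v. v \<in> D} \<longleftrightarrow> take ?k (drop 0 w) = x \<and>
      ((0 + ?k < length w \<and> Q w (0 + ?k)) \<or> (\<not> (0 + ?k < length w \<and> True) \<and> [] \<in> D))"
    proof (cases "take ?k w = x")
      case True
      then have "x @ drop ?k w = w" using append_take_drop_id[of ?k w] by simp
      then have "drop ?k w \<in> B" using w(1) assms(2)[of "drop ?k w"] by simp
      with P(2) Q(2)[of ?k w] True show ?thesis unfolding eq by (cases "?k < length w") auto
    next
      case False
      then show ?thesis unfolding eq by simp
    qed
  qed
qed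

text \<open>An unambiguous product: c completes the first occurrence of \<open>q\<close>, so the
  word determines the cut. All of that occurrence except c stays at the end of the left
  factor.\<close>

definition marked_product :: "'s list \<Rightarrow> 's list set \<Rightarrow> 's list set \<Rightarrow> 's list set" where
  "marked_product q D1 D2 = {u @ c # v | u c v. u \<in> D1 \<and> v \<in> D2 \<and>
     (\<exists>x. u @ [c] = x @ q) \<and> (\<forall>x y. u \<noteq> x @ q @ y)}"

lemma factor_at_iff:
  "length q \<le> i \<and> i \<le> length w \<and> take (length q) (drop (i - length q) w) = q \<longleftrightarrow>
   (\<exists>x y. w = x @ q @ y \<and> i = length x + length q)"
proof
  assume *: "length q \<le> i \<and> i \<le> length w \<and> take (length q) (drop (i - length q) w) = q"
  have "w = take (i - length q) w @ take (length q) (drop (i - length q) w) @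
      drop (length q) (drop (i - length q) w)" by (simp only: append_take_drop_id)
  with * show "\<exists>x y. w = x @ q @ y \<and> i = length x + length q"
    by (intro exI[of _ "take (i - length q) w"]
        exI[of _ "drop (length q) (drop (i - length q) w)"]) auto
qed auto

text \<open>The position where the first occurrence of \<open>q\<close> ends is expressible, and so
  are the segments before and after it; the formulas for the two factors are relativized to these
  segments.\<close>

lemma tdef_on_marked_product:
  assumes "tdef_on B1 D1" "tdef_on B2 D2" and q: "q \<noteq> []"
    and A: "\<And>u c v. u @ c # v \<in> A \<Longrightarrow> (\<exists>x. u @ [c] = x @ q) \<Longrightarrow> (\<forall>x y. u \<noteq> x @ q @ y) \<Longrightarrow>
      u \<in> B1 \<and> v \<in> B2"
  shows "tdef_on A (marked_product q D1 D2)"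
proof -
  from assms obtain P1 P2 where P: "tdef P1" "\<forall>w\<in>B1. w \<noteq> [] \<longrightarrow> (w \<in> D1 \<longleftrightarrow> P1 w 0)"
    "tdef P2" "\<forall>w\<in>B2. w \<noteq> [] \<longrightarrow> (w \<in> D2 \<longleftrightarrow> P2 w 0)"
    unfolding tdef_on_def by blast
  define M where "M = (\<lambda>w i. length q - 1 \<le> i \<and>
    take (length q) (drop (i - (length q - 1)) w) = (q :: 'a list))"
  have M_tl: "tdef M" unfolding M_def by (intro tdef_back tdef_factor)
  have M_iff: "M w i \<longleftrightarrow> (\<exists>x y. w = x @ q @ y \<and> Suc i = length x + length q)" if "i < length w" for w i
    using factor_at_iff[of q "Suc i" w] that q by (cases q) (auto simp: M_def)
  \<comment> \<open>If \<open>q\<close> does not occur, the default makes the left segment the whole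
    word and the right one empty, in agreement with the formulas for the segments.\<close>
  define cut where "cut = (\<lambda>w. if \<exists>i<length w. M w i then LEAST i. M w i else length w)"
  have cut_least: "M w (cut w)" "cut w < length w" if "\<exists>i<length w. M w i" for w
    using that LeastI_ex[of "M w"] Least_le[of "M w"] unfolding cut_def
    by (auto intro: le_less_trans)
  have cut_before: "\<not> M w j" if "j < cut w" "j < length w" for w j
    using that not_less_Least[of j "M w"] unfolding cut_def by (auto split: if_splits)
  have cut_le: "cut w \<le> length w" for w
    using cut_least(2)[of w] unfolding cut_def by (cases "\<exists>i<length w. M w i") auto
  have before: "(\<forall>j<i. \<not> M w j) \<longleftrightarrow> i \<le> cut w" if "i < length w" for w i
  proof
    assume "\<forall>j<i. \<not> M w j"
    then show "i \<le> cut w" using cut_least[of w] that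
      by (cases "\<exists>i<length w. M w i") (auto simp: cut_def not_less[symmetric])
  next
    assume "i \<le> cut w"
    then show "\<forall>j<i. \<not> M w j" using cut_before[of _ w] that by auto
  qed
  have cut_factors: "take (cut w) w @ w ! cut w # drop (Suc (cut w)) w = w"
    "\<exists>x. take (cut w) w @ [w ! cut w] = x @ q" "\<forall>y z. take (cut w) w \<noteq> y @ q @ z"
    if "\<exists>i<length w. M w i" for w
  proof -
    note c = cut_least[OF that]
    show "take (cut w) w @ w ! cut w # drop (Suc (cut w)) w = w"
      using id_take_nth_drop[OF c(2)] by (rule sym)
    from c obtain x y where xy: "w = x @ q @ y" "Suc (cut w) = length x + length q"
      using M_iff by blast
    have "take (cut w) w @ [w ! cut w] = take (Suc (cut w)) w"
      using c(2) by (simp add: take_Suc_conv_app_nth)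
    also have "\<dots> = take (length x + length q) (x @ q @ y)" unfolding xy(2) by (simp only: xy(1)[symmetric])
    also have "\<dots> = x @ q" by simp
    finally show "\<exists>x. take (cut w) w @ [w ! cut w] = x @ q" ..
    show "\<forall>y z. take (cut w) w \<noteq> y @ q @ z"
    proof (intro allI notI)
      fix y z assume e: "take (cut w) w = y @ q @ z"
      have len: "length y + length q \<le> cut w" using c(2) arg_cong[OF e, of length] by simp
      have "w = y @ q @ (z @ drop (cut w) w)"
        using append_take_drop_id[of "cut w" w] unfolding e by simp
      moreover define j where "j = length y + length q - 1"
      have j: "Suc j = length y + length q" "j < cut w" using len q by (cases q; simp add: j_def)+
      ultimately have "M w j" using M_iff[of j w] c(2) by auto
      with j(2) cut_before c(2) show False by (meson less_trans)
    qed
  qed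
  have "tdef (\<lambda>w i. \<not> M w i \<and> \<not> (\<exists>j<i. M w j))" by (intro tdef_and tdef_not tdef_past M_tl)
  note ins1 = this
  have ins1': "(\<not> M w i \<and> \<not> (\<exists>j<i. M w j)) \<longleftrightarrow> 0 \<le> i \<and> i < cut w" if "i < length w" for w i
  proof
    assume *: "\<not> M w i \<and> \<not> (\<exists>j<i. M w j)"
    then have "i \<le> cut w" using before[OF that] by blast
    moreover have "i \<noteq> cut w"
    proof
      assume "i = cut w"
      with that have "\<exists>i<length w. M w i" unfolding cut_def by (metis less_irrefl)
      with cut_least(1) * \<open>i = cut w\<close> show False by blast
    qed
    ultimately show "0 \<le> i \<and> i < cut w" by simp
  next
    assume "0 \<le> i \<and> i < cut w"
    then show "\<not> M w i \<and> \<not> (\<exists>j<i. M w j)" using before[OF that] cut_before that by auto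
  qed
  from tdef_relativize[where lo = "\<lambda>_. 0" and hi = cut, OF P(1) ins1 ins1' cut_le]
  obtain Q1 where Q1: "tdef Q1" "\<And>w i. i < cut w \<Longrightarrow> Q1 w i \<longleftrightarrow> P1 (take (cut w) w) i"
    by auto
  have ins2: "tdef (\<lambda>w i. \<exists>j<i. M w j)" by (intro tdef_past M_tl)
  have ins2': "(\<exists>j<i. M w j) \<longleftrightarrow> Suc (cut w) \<le> i \<and> i < length w" if "i < length w" for w i
    using before[OF that] that by auto
  from tdef_relativize[where lo = "\<lambda>w. Suc (cut w)" and hi = length, OF P(3) ins2 ins2' order_refl]
  obtain Q2 where Q2: "tdef Q2"
    "\<And>w i. Suc (cut w) \<le> i \<Longrightarrow> i < length w \<Longrightarrow>
      Q2 w i \<longleftrightarrow> P2 (drop (Suc (cut w)) w) (i - Suc (cut w))"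
    by auto
  \<comment> \<open>An empty factor offers no position for evaluation. The left one is empty if the
    first occurrence of \<open>q\<close> ends at the first position, the right one if it ends at the
    last; the constants \<open>[] \<in> D1\<close> and \<open>[] \<in> D2\<close> then take
    over.\<close>
  let ?left = "\<lambda>w i. (M w i \<and> [] \<in> D1) \<or> (\<not> M w i \<and> Q1 w i)"
  let ?right = "\<lambda>w i. (Suc i < length w \<and> Q2 w (Suc i)) \<or> (\<not> (Suc i < length w \<and> True) \<and> [] \<in> D2)"
  let ?F = "\<lambda>w i. ?left w i \<and>
    (\<exists>j. i \<le> j \<and> j < length w \<and> (M w j \<and> \<not> (\<exists>k<j. M w k)) \<and> ?right w j)"
  have "tdef ?F"
    by (intro tdef_and tdef_or tdef_not tdef_ev tdef_past tdef_next tdef_const tdef_True M_tl Q1 Q2)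
  then show ?thesis
  proof (rule tdef_onI)
    fix w assume w: "w \<in> A" "w \<noteq> []"
    have first: "M w j \<and> \<not> (\<exists>k<j. M w k) \<longleftrightarrow> j = cut w \<and> (\<exists>i<length w. M w i)" if "j < length w" for j
    proof
      assume *: "M w j \<and> \<not> (\<exists>k<j. M w k)"
      then have "j \<le> cut w" using before[OF that] by blast
      moreover have "\<not> j < cut w" using * cut_before that by blast
      ultimately show "j = cut w \<and> (\<exists>i<length w. M w i)" using * that by auto
    next
      assume "j = cut w \<and> (\<exists>i<length w. M w i)"
      then show "M w j \<and> \<not> (\<exists>k<j. M w k)" using before[OF that] cut_least(1) by auto
    qed
    have "w \<in> marked_product q D1 D2 \<longleftrightarrow>
      (\<exists>i<length w. M w i) \<and> take (cut w) w \<in> D1 \<and> drop (Suc (cut w)) w \<in> D2"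
    proof
      assume "w \<in> marked_product q D1 D2"
      then obtain u c v x where *: "w = u @ c # v" "u \<in> D1" "v \<in> D2" "u @ [c] = x @ q"
        "\<forall>x y. u \<noteq> x @ q @ y" unfolding marked_product_def by blast
      have len: "length u < length w" "Suc (length u) = length x + length q"
        using *(1) arg_cong[OF *(4), of length] by simp_all
      have "w = x @ q @ v" using *(1,4) by (metis append.assoc append_Cons append_Nil)
      then have "M w (length u)" using M_iff[OF len(1)] len(2) by blast
      moreover have "\<not> M w k" if "k < length u" for k
      proof
        assume "M w k"
        moreover have "k < length w" using that len(1) by simp
        ultimately obtain y z where yz: "w = y @ q @ z" "Suc k = length y + length q"
          using M_iff by blast
        have "length y + length q \<le> length u" using that yz(2) by simp
        then have "take (length u) w = y @ q @ take (length u - length y - length q) z"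
          unfolding yz(1) by simp
        then have "u = y @ q @ take (length u - length y - length q) z" using *(1) by simp
        with *(5) show False by blast
      qed
      ultimately have "length u = cut w" using first[OF len(1)] by blast
      moreover have "\<exists>i<length w. M w i" using \<open>M w (length u)\<close> len(1) by blast
      ultimately show "(\<exists>i<length w. M w i) \<and> take (cut w) w \<in> D1 \<and> drop (Suc (cut w)) w \<in> D2"
        using * by (simp add: \<open>length u = cut w\<close>[symmetric])
    next
      assume r: "(\<exists>i<length w. M w i) \<and> take (cut w) w \<in> D1 \<and> drop (Suc (cut w)) w \<in> D2"
      note c = cut_least[OF conjunct1[OF r]]
      note cf = cut_factors[OF conjunct1[OF r]]
      show "w \<in> marked_product q D1 D2"
        unfolding marked_product_def
      proof (rule CollectI, rule exI[of _ "take (cut w) w"], rule exI[of _ "w ! cut w"],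
          rule exI[of _ "drop (Suc (cut w)) w"], intro conjI)
        show "w = take (cut w) w @ w ! cut w # drop (Suc (cut w)) w" by (rule cf(1)[symmetric])
        show "take (cut w) w \<in> D1" "drop (Suc (cut w)) w \<in> D2" using r by blast+
      qed (rule cf(2,3))+
    qed
    also have "\<dots> \<longleftrightarrow> ?F w 0"
    proof (cases "\<exists>i<length w. M w i")
      case True
      note c = cut_least[OF True]
      have "take (cut w) w @ w ! cut w # drop (Suc (cut w)) w \<in> A"
        using w(1) by (simp only: cut_factors(1)[OF True])
      from A[OF this] cut_factors(2,3)[OF True]
      have B: "take (cut w) w \<in> B1" "drop (Suc (cut w)) w \<in> B2" by blast+
      have "?left w 0 \<longleftrightarrow> take (cut w) w \<in> D1"
      proof (cases "cut w = 0")
        case True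
        then show ?thesis using c(1) by simp
      next
        case False
        then have "\<not> M w 0" using cut_before[of 0 w] w(2) by simp
        moreover have "take (cut w) w \<noteq> []" using False w(2) by simp
        ultimately show ?thesis using Q1(2)[of 0 w] P(2) B(1) False by simp
      qed
      moreover have "?right w (cut w) \<longleftrightarrow> drop (Suc (cut w)) w \<in> D2"
        using Q2(2)[of w "Suc (cut w)"] P(4) B(2) by (cases "Suc (cut w) < length w") auto
      moreover have "(\<exists>j. 0 \<le> j \<and> j < length w \<and> (M w j \<and> \<not> (\<exists>k<j. M w k)) \<and> ?right w j) \<longleftrightarrow>
          ?right w (cut w)"
      proof
        assume "\<exists>j. 0 \<le> j \<and> j < length w \<and> (M w j \<and> \<not> (\<exists>k<j. M w k)) \<and> ?right w j"
        then obtain j where "j < length w" "M w j \<and> \<not> (\<exists>k<j. M w k)" "?right w j" by blast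
        with first show "?right w (cut w)" by blast
      next
        assume "?right w (cut w)"
        with first[OF c(2)] c True show "\<exists>j. 0 \<le> j \<and> j < length w \<and> (M w j \<and> \<not> (\<exists>k<j. M w k)) \<and> ?right w j"
          by blast
      qed
      ultimately show ?thesis using True by blast
    next
      case False
      then show ?thesis by blast
    qed
    finally show "w \<in> marked_product q D1 D2 \<longleftrightarrow> ?F w 0" .
  qed
qed

section \<open>Congruences that are locally in DA\<close>

text \<open>A finite aperiodic quotient of the free monoid, given by its value map.
  \<open>local_DA\<close> is the law of DA for two elements of the local monoid at an idempotent
  represented by a nonempty word. Absorption is asked of both \<open>a\<close> and \<open>b\<close>:
  reversal exchanges the two, so the axioms are invariant under it.\<close>

locale locally_DA =
  fixes val :: "'s list \<Rightarrow> 'm"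
  assumes finite_val: "finite (range val)"
    and cong: "val u = val u' \<Longrightarrow> val v = val v' \<Longrightarrow> val (u @ v) = val (u' @ v')"
    and aperiodic: "\<exists>k\<ge>1. val (pw (Suc k) u) = val (pw k u)"
    and local_DA: "\<lbrakk>x \<noteq> []; val (x @ x) = val x; a = x @ a' @ x; b = x @ b' @ x\<rbrakk> \<Longrightarrow>
      \<exists>k. val (pw k (a @ b) @ b @ pw k (a @ b)) = val (pw k (a @ b)) \<and>
          val (pw k (a @ b) @ a @ pw k (a @ b)) = val (pw k (a @ b))"

lemma locally_DA_rev:
  assumes "locally_DA val"
  shows "locally_DA (\<lambda>w. val (rev w))"
proof -
  interpret locally_DA val by fact
  show ?thesis
  proof
    show "finite (range (\<lambda>w. val (rev w)))"
      by (rule finite_subset[OF _ finite_val]) auto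
    show "val (rev (u @ v)) = val (rev (u' @ v'))"
      if "val (rev u) = val (rev u')" "val (rev v) = val (rev v')" for u u' v v'
      using cong[OF that(2,1)] by simp
    show "\<exists>k\<ge>1. val (rev (pw (Suc k) u)) = val (rev (pw k u))" for u
      unfolding rev_pw by (rule aperiodic)
    show "\<exists>k. val (rev (pw k (a @ b) @ b @ pw k (a @ b))) = val (rev (pw k (a @ b))) \<and>
          val (rev (pw k (a @ b) @ a @ pw k (a @ b))) = val (rev (pw k (a @ b)))"
      if "x \<noteq> []" "val (rev (x @ x)) = val (rev x)" "a = x @ a' @ x" "b = x @ b' @ x" for x a b a' b'
      using local_DA[of "rev x" "rev b" "rev b'" "rev a" "rev a'"] that by (auto simp: rev_pw)
  qed
qed

context locally_DA
begin

lemma cong_left: "val u = val u' \<Longrightarrow> val (u @ v) = val (u' @ v)"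
  by (rule cong) simp_all

lemma cong_right: "val v = val v' \<Longrightarrow> val (u @ v) = val (u @ v')"
  by (rule cong) simp_all

lemma aperiodic_add: "\<exists>k\<ge>1. \<forall>l. val (pw (k + l) u) = val (pw k u)"
proof -
  obtain k where k: "k \<ge> 1" "val (pw (Suc k) u) = val (pw k u)" using aperiodic by blast
  have "val (pw (k + l) u) = val (pw k u)" for l
  proof (induction l)
    case (Suc l)
    have "val (u @ pw (k + l) u) = val (u @ pw k u)" using Suc by (rule cong_right)
    with k(2) show ?case by simp
  qed simp
  with k(1) show ?thesis by blast
qed

lemma fix_pw: "val (u @ z) = val u \<Longrightarrow> val (u @ pw k z) = val u"
proof (induction k)
  case (Suc k)
  have "val ((u @ z) @ pw k z) = val (u @ pw k z)" using Suc.prems by (rule cong_left)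
  with Suc show ?case by simp
qed simp

section \<open>Windows and staying inside an \<R>-class\<close>

definition "window_size = card (range val)"

text \<open>Pigeonhole: of the prefixes of \<open>p\<close>, one more in number than the values, two
  have equal value. The shorter one absorbs the factor between them and therefore an idempotent
  power of that factor.\<close>

lemma window_split:
  assumes "length p = window_size"
  obtains p' p'' x where "p = p' @ p''" "x \<noteq> []" "val (x @ x) = val x" "val (p' @ x) = val p'"
proof -
  have "card ((\<lambda>i. val (take i p)) ` {0..length p}) \<le> card (range val)"
    by (rule card_mono[OF finite_val]) auto
  also have "\<dots> < card {0..length p}" by (simp add: assms window_size_def)
  finally have "\<not> inj_on (\<lambda>i. val (take i p)) {0..length p}" by (rule pigeonhole)
  then obtain i j where "i \<in> {0..length p}" "j \<in> {0..length p}" "i \<noteq> j" "val (take i p) = val (take j p)"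
    unfolding inj_on_def by blast
  then obtain i j where ij: "i < j" "j \<le> length p" "val (take i p) = val (take j p)"
    by (metis atLeastAtMost_iff nat_neq_iff)
  define z where "z = drop i (take j p)"
  have z: "z \<noteq> []" "take j p = take i p @ z"
    using ij append_take_drop_id[of i "take j p"] by (auto simp: z_def)
  obtain k where k: "k \<ge> 1" "\<forall>l. val (pw (k + l) z) = val (pw k z)" using aperiodic_add by blast
  show ?thesis
  proof (rule that)
    show "p = take i p @ drop i p" by simp
    show "pw k z \<noteq> []" using k(1) z(1) by (cases k) auto
    show "val (pw k z @ pw k z) = val (pw k z)" using k(2)[rule_format, of k] by (simp add: pw_add)
    show "val (take i p @ pw k z) = val (take i p)"
      by (rule fix_pw) (simp add: z(2)[symmetric] ij(3))
  qed
qed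

text \<open>Reading \<open>w\<close> after \<open>u\<close> does not leave the \<R>-class of
  \<open>u\<close>.\<close>

definition stable :: "'s list \<Rightarrow> 's list \<Rightarrow> bool" where
  "stable u w \<longleftrightarrow> (\<exists>v. val (u @ w @ v) = val u)"

lemma stable_prefix: "stable u (w @ w') \<Longrightarrow> stable u w"
  unfolding stable_def by (metis append.assoc)

text \<open>The two loops \<open>a\<close>, \<open>b\<close> at the idempotent inside the window \<open>p\<close> lead from the second occurrence of
  the window to the first one and back; \<open>(a b)^k b (a b)^k = (a b)^k\<close> lets \<open>b\<close>, which begins with the
  step \<open>c\<close>, be taken from the second occurrence.\<close>

lemma stable_window_step:
  assumes p: "length p = window_size"
    and first: "stable u (y1 @ p @ [c] @ y2)" and second: "stable u (y3 @ p)"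
  shows "stable u (y3 @ p @ [c])"
proof -
  from p obtain p' p'' x where x: "p = p' @ p''" "x \<noteq> []" "val (x @ x) = val x" "val (p' @ x) = val p'"
    by (rule window_split)
  from first obtain v where v: "val (u @ (y1 @ p @ [c] @ y2) @ v) = val u" unfolding stable_def by blast
  from second obtain z where z: "val (u @ (y3 @ p) @ z) = val u" unfolding stable_def by blast
  \<comment> \<open>Loops are based at the place between \<open>p'\<close> and \<open>p''\<close>,
    where an \<open>x\<close> may be inserted freely; \<open>r\<close> is this place in the second
    occurrence. The words \<open>z\<close> and \<open>v\<close> lead back to \<open>u\<close>:
    \<open>a\<close> returns by \<open>z\<close> and enters the first occurrence, \<open>b\<close>
    takes the step c there, returns by \<open>v\<close> and enters the second.\<close>
  define a where "a = x @ (p'' @ z @ y1 @ p') @ x"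
  define b where "b = x @ (p'' @ [c] @ y2 @ v @ y3 @ p') @ x"
  define r where "r = u @ y3 @ p'"
  have p'x: "val (l @ p' @ x @ m) = val (l @ p' @ m)" for l m
    using cong_right[OF cong_left[OF x(4), of m], of l] by simp
  have uz: "val (u @ y3 @ p @ z @ m) = val (u @ m)" for m using cong_left[OF z, of m] by simp
  have uv: "val (u @ y1 @ p @ [c] @ y2 @ v @ m) = val (u @ m)" for m using cong_left[OF v, of m] by simp
  have ra: "val (r @ a @ m) = val (u @ y1 @ p' @ m)" for m
  proof -
    have "val (r @ a @ m) = val ((u @ y3) @ p' @ x @ p'' @ z @ y1 @ p' @ x @ m)"
      by (simp add: r_def a_def)
    also have "\<dots> = val ((u @ y3) @ p' @ p'' @ z @ y1 @ p' @ x @ m)" by (rule p'x)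
    also have "\<dots> = val (u @ y3 @ p @ z @ y1 @ p' @ x @ m)" by (simp add: x(1))
    also have "\<dots> = val (u @ y1 @ p' @ x @ m)" by (rule uz)
    also have "\<dots> = val (u @ y1 @ p' @ m)" using p'x[of "u @ y1" m] by simp
    finally show ?thesis .
  qed
  have rb: "val (r @ b @ m) = val (u @ y3 @ p @ [c] @ y2 @ v @ y3 @ p' @ m)" for m
  proof -
    have "val (r @ b @ m) = val ((u @ y3) @ p' @ x @ p'' @ [c] @ y2 @ v @ y3 @ p' @ x @ m)"
      by (simp add: r_def b_def)
    also have "\<dots> = val ((u @ y3) @ p' @ p'' @ [c] @ y2 @ v @ y3 @ p' @ x @ m)" by (rule p'x)
    also have "\<dots> = val ((u @ y3 @ p @ [c] @ y2 @ v @ y3) @ p' @ x @ m)" by (simp add: x(1))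
    also have "\<dots> = val ((u @ y3 @ p @ [c] @ y2 @ v @ y3) @ p' @ m)" by (rule p'x)
    finally show ?thesis by simp
  qed
  have rab: "val (r @ (a @ b)) = val r"
  proof -
    have "val (r @ a @ b) = val (u @ y1 @ p' @ b)" by (rule ra)
    also have "\<dots> = val ((u @ y1) @ p' @ x @ p'' @ [c] @ y2 @ v @ y3 @ p' @ x @ [])"
      by (simp add: b_def)
    also have "\<dots> = val ((u @ y1) @ p' @ p'' @ [c] @ y2 @ v @ y3 @ p' @ x @ [])" by (rule p'x)
    also have "\<dots> = val ((u @ y1 @ p @ [c] @ y2 @ v @ y3) @ p' @ x @ [])" by (simp add: x(1))
    also have "\<dots> = val ((u @ y1 @ p @ [c] @ y2 @ v @ y3) @ p' @ [])" by (rule p'x)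
    also have "\<dots> = val (u @ y1 @ p @ [c] @ y2 @ v @ y3 @ p')" by simp
    also have "\<dots> = val r" unfolding uv r_def ..
    finally show ?thesis .
  qed
  obtain k where k: "val (pw k (a @ b) @ b @ pw k (a @ b)) = val (pw k (a @ b))"
    using local_DA[OF x(2,3) a_def b_def] by blast
  have rk: "val (r @ pw k (a @ b)) = val r" by (rule fix_pw[OF rab])
  have "val (r @ b @ pw k (a @ b)) = val ((r @ pw k (a @ b)) @ b @ pw k (a @ b))"
    using cong_left[OF rk, of "b @ pw k (a @ b)"] by simp
  also have "\<dots> = val (r @ pw k (a @ b))" using cong_right[OF k, of r] by simp
  finally have "val (r @ b @ pw k (a @ b)) = val r" using rk by simp
  then have "val (u @ y3 @ p @ [c] @ y2 @ v @ y3 @ p' @ pw k (a @ b)) = val r" unfolding rb .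
  from cong_left[OF this, of "p'' @ z"]
  have "val (u @ (y3 @ p @ [c]) @ (y2 @ v @ y3 @ p' @ pw k (a @ b) @ p'' @ z)) = val (u @ y3 @ p @ z)"
    by (simp add: r_def x(1))
  also have "\<dots> = val u" using z by simp
  finally show ?thesis unfolding stable_def by blast
qed

end

definition factors :: "nat \<Rightarrow> 's list \<Rightarrow> 's list set" where
  "factors n w = {q. length q = n \<and> (\<exists>x y. w = x @ q @ y)}"

lemma factors_append: "factors n u \<union> factors n v \<subseteq> factors n (u @ v)"
proof -
  have "\<exists>x' y'. (x @ q @ y) @ v = x' @ q @ y'" "\<exists>x' y'. u @ (x @ q @ y) = x' @ q @ y'" for x q y
    by (metis append.assoc)+
  then show ?thesis unfolding factors_def by blast
qed

lemma factors_rev: "factors n (rev w) = rev ` factors n w"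
proof -
  have "factors n (rev w) \<subseteq> rev ` factors n w" for w :: "'a list"
  proof
    fix q assume "q \<in> factors n (rev w)"
    then obtain x y where "length q = n" "rev w = x @ q @ y" unfolding factors_def by blast
    then have "w = rev y @ rev q @ rev x" by (metis rev_append rev_rev_ident append.assoc)
    with \<open>length q = n\<close> have "rev q \<in> factors n w" unfolding factors_def by auto
    then show "q \<in> rev ` factors n w" by (metis imageI rev_rev_ident)
  qed
  from this[of w] this[of "rev w"] show ?thesis by auto
qed

lemma factors_finite:
  assumes "finite S"
  shows "finite {q. set q \<subseteq> S \<and> length q = n}"
  using finite_lists_length_eq[OF assms] .

context locally_DA
begin

text \<open>Induction on the prefixes of \<open>w'\<close>: short ones are prefixes of
  \<open>w\<close>, and the last letter of a longer one completes a window that also occurs in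
  \<open>w\<close>, where that letter was read stably.\<close>

lemma stable_determined:
  assumes "take window_size w = take window_size w'"
    and "factors (Suc window_size) w' \<subseteq> factors (Suc window_size) w" and "stable u w"
  shows "stable u w'"
proof -
  have "stable u v" if "\<exists>v'. w' = v @ v'" for v
    using that
  proof (induction v rule: rev_induct)
    case Nil
    then show ?case by (auto simp: stable_def intro: exI[of _ "[]"])
  next
    case (snoc c v)
    then obtain v' where v': "w' = (v @ [c]) @ v'" by blast
    then have "stable u v" using snoc.IH by simp
    show ?case
    proof (cases "length v < window_size")
      case True
      then have "take (length (v @ [c])) (take window_size w') = v @ [c]" unfolding v' by simp
      then have "w = (v @ [c]) @ drop (length (v @ [c])) w"
        unfolding assms(1)[symmetric] using True
        by (metis append_take_drop_id length_append_singleton min.absorb1 Suc_leI take_take)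
      with assms(3) stable_prefix show ?thesis by metis
    next
      case False
      define y3 where "y3 = take (length v - window_size) v"
      define p where "p = drop (length v - window_size) v"
      have v: "v = y3 @ p" "length p = window_size" using False by (auto simp: y3_def p_def)
      have "w' = y3 @ (p @ [c]) @ v'" using v' v(1) by simp
      then have "p @ [c] \<in> factors (Suc window_size) w'" using v(2) unfolding factors_def by auto
      with assms(2) obtain y1 y2 where "w = y1 @ (p @ [c]) @ y2" unfolding factors_def by blast
      then have "stable u (y1 @ p @ [c] @ y2)" using assms(3) by simp
      from stable_window_step[OF v(2) this, of y3] \<open>stable u v\<close> show ?thesis by (simp add: v(1))
    qed
  qed
  from this[of w'] show ?thesis by simp
qed

definition R_eq :: "'s list \<Rightarrow> 's list \<Rightarrow> bool" where
  "R_eq u v \<longleftrightarrow> (\<exists>x. val (u @ x) = val v) \<and> (\<exists>x. val (v @ x) = val u)"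

lemma R_eq_cong: "val u = val u' \<Longrightarrow> R_eq u v \<longleftrightarrow> R_eq u' v"
  unfolding R_eq_def using cong_left by metis

lemma stable_cong: "val w = val w' \<Longrightarrow> stable u w \<longleftrightarrow> stable u w'"
  unfolding stable_def using cong cong_left by metis

lemma stable_R_eq:
  assumes "stable u w"
  shows "R_eq (u @ w) v \<longleftrightarrow> R_eq u v"
proof -
  from assms obtain z where z: "val (u @ w @ z) = val u" unfolding stable_def by blast
  show ?thesis
  proof
    assume "R_eq (u @ w) v"
    then obtain x y where xy: "val ((u @ w) @ x) = val v" "val (v @ y) = val (u @ w)"
      unfolding R_eq_def by blast
    have "val (u @ (w @ x)) = val v" using xy(1) by simp
    moreover have "val (v @ (y @ z)) = val u" using cong_left[OF xy(2), of z] z by simp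
    ultimately show "R_eq u v" unfolding R_eq_def by blast
  next
    assume "R_eq u v"
    then obtain x y where xy: "val (u @ x) = val v" "val (v @ y) = val u"
      unfolding R_eq_def by blast
    have "val ((u @ w) @ (z @ x)) = val v" using cong_left[OF z, of x] xy(1) by simp
    moreover have "val (v @ (y @ w)) = val (u @ w)" using cong_left[OF xy(2), of w] by simp
    ultimately show "R_eq (u @ w) v" unfolding R_eq_def by blast
  qed
qed

text \<open>Green's \<H>-classes are trivial in an aperiodic monoid: \<open>u\<close> is equivalent
  to s u x, hence to \<open>pw k s @ u @ pw k x\<close>, and since one more \<open>x\<close> at the
  end changes nothing, \<open>u\<close> is equivalent to u x, that is to \<open>v\<close>.\<close>

lemma R_and_L_imp_eq:
  assumes "val (u @ x) = val v" "val (s @ v) = val u" "val (t @ u) = val v"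
  shows "val u = val v"
proof -
  obtain k where k: "val (pw (Suc k) x) = val (pw k x)" using aperiodic by blast
  have "val (pw k s @ u @ pw k x) = val u" if "val (s @ u @ x) = val u" for k s
  proof (induction k)
    case (Suc k)
    have "pw (Suc k) s @ u @ pw (Suc k) x = pw k s @ (s @ u @ x) @ pw k x"
      by (simp add: pw_commute)
    then have "val (pw (Suc k) s @ u @ pw (Suc k) x) = val (pw k s @ u @ pw k x)"
      using cong[OF refl cong_left[OF that]] by metis
    with Suc show ?case by simp
  qed simp
  moreover have "val (s @ u @ x) = val u"
    using cong_right[OF assms(1), of s] assms(2) by simp
  ultimately have *: "val (pw k s @ u @ pw k x) = val u" .
  have "val u = val (pw k s @ u @ pw (Suc k) x)"
    using cong_right[OF k, of "pw k s @ u"] * by simp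
  also have "\<dots> = val ((pw k s @ u @ pw k x) @ x)" by (simp add: pw_commute)
  also have "\<dots> = val v" using cong_left[OF *, of x] assms(1) by simp
  finally show ?thesis .
qed

end

section \<open>Definability of \<R>-classes\<close>

lemma tdef_on_factor:
  assumes "q \<noteq> []"
  shows "tdef_on A {w. q \<in> factors (length q) w}"
proof (rule tdef_onI[OF tdef_ev[OF tdef_factor[of q]]])
  fix w :: "'a list" assume "w \<noteq> []"
  show "w \<in> {w. q \<in> factors (length q) w} \<longleftrightarrow>
      (\<exists>j. 0 \<le> j \<and> j < length w \<and> take (length q) (drop j w) = q)"
  proof
    assume "w \<in> {w. q \<in> factors (length q) w}"
    then obtain x y where "w = x @ q @ y" unfolding factors_def by blast
    with assms show "\<exists>j. 0 \<le> j \<and> j < length w \<and> take (length q) (drop j w) = q"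
      by (intro exI[of _ "length x"]) auto
  next
    assume "\<exists>j. 0 \<le> j \<and> j < length w \<and> take (length q) (drop j w) = q"
    then obtain j where "take (length q) (drop j w) = q" by blast
    moreover have "w = take j w @ take (length q) (drop j w) @ drop (length q) (drop j w)"
      by (simp only: append_take_drop_id)
    ultimately have "w = take j w @ q @ drop (length q) (drop j w)" by simp
    then show "w \<in> {w. q \<in> factors (length q) w}" unfolding factors_def by blast
  qed
qed

lemma tdef_on_take: "tdef_on A {w. take n w = x}"
proof -
  have "tdef (\<lambda>w i. length x \<le> n \<and> take (length x) (drop i w) = x \<and>
      (length x = n \<or> \<not> (i + length x < length w \<and> True)))"
    by (intro tdef_and tdef_or tdef_not tdef_const tdef_factor tdef_shift tdef_True)
  then show ?thesis
  proof (rule tdef_onI)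
    fix w :: "'a list"
    show "w \<in> {w. take n w = x} \<longleftrightarrow> length x \<le> n \<and> take (length x) (drop 0 w) = x \<and>
        (length x = n \<or> \<not> (0 + length x < length w \<and> True))"
      by (cases "n \<le> length w") (auto simp: not_less min_def)
  qed
qed

text \<open>Over a finite alphabet there are finitely many possible windows, so the exact set of
  factors is a finite conjunction of occurrences and absences.\<close>

lemma tdef_on_window_data:
  assumes "finite S"
  shows "tdef_on {w. set w \<subseteq> S} {w. (take n w, factors (Suc n) w) = d}"
proof (cases d)
  case (Pair x V)
  let ?Q = "{q. set q \<subseteq> S \<and> length q = Suc n}"
  define F where "F = (\<lambda>q. if q \<in> V then {w. q \<in> factors (length q) w} else - {w. q \<in> factors (length q) w})"
  show ?thesis
  proof (cases "V \<subseteq> ?Q")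
    case True
    have "tdef_on {w. set w \<subseteq> S} (F q)" if "q \<in> ?Q" for q
    proof -
      have "q \<noteq> []" using that by auto
      from tdef_on_factor[OF this] tdef_on_Compl[OF tdef_on_factor[OF this]]
      show ?thesis by (simp add: F_def)
    qed
    then have "tdef_on {w. set w \<subseteq> S} ({w. take n w = x} \<inter> (\<Inter>q\<in>?Q. F q))"
      by (intro tdef_on_Int tdef_on_take tdef_on_INT factors_finite[OF assms])
    then show ?thesis
    proof (rule tdef_on_cong)
      fix w assume "w \<in> {w. set w \<subseteq> S}"
      then have sub: "factors (Suc n) w \<subseteq> ?Q" unfolding factors_def by auto
      have "w \<in> F q \<longleftrightarrow> (q \<in> V \<longleftrightarrow> q \<in> factors (Suc n) w)" if "q \<in> ?Q" for q
        using that by (auto simp: F_def)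
      then have "w \<in> (\<Inter>q\<in>?Q. F q) \<longleftrightarrow> (\<forall>q\<in>?Q. q \<in> V \<longleftrightarrow> q \<in> factors (Suc n) w)" by simp
      also have "\<dots> \<longleftrightarrow> factors (Suc n) w = V" using sub True by blast
      finally show "w \<in> {w. take n w = x} \<inter> (\<Inter>q\<in>?Q. F q) \<longleftrightarrow>
          w \<in> {w. (take n w, factors (Suc n) w) = d}" by (simp add: Pair)
    qed
  next
    case False
    show ?thesis
    proof (rule tdef_on_cong[OF tdef_on_const[of _ False]])
      fix w assume "w \<in> {w. set w \<subseteq> S}"
      then have "factors (Suc n) w \<subseteq> ?Q" unfolding factors_def by auto
      with False show "w \<in> {w. False} \<longleftrightarrow> w \<in> {w. (take n w, factors (Suc n) w) = d}"
        by (auto simp: Pair)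
    qed
  qed
qed

lemma finite_window_data:
  assumes "finite S"
  shows "finite ((\<lambda>w. (take n w, factors (Suc n) w)) ` {w. set w \<subseteq> S})"
proof (rule finite_subset)
  show "(\<lambda>w. (take n w, factors (Suc n) w)) ` {w. set w \<subseteq> S} \<subseteq>
      {x. set x \<subseteq> S \<and> length x \<le> n} \<times> Pow {q. set q \<subseteq> S \<and> length q = Suc n}"
    by (auto simp: factors_def dest: in_set_takeD)
  show "finite ({x. set x \<subseteq> S \<and> length x \<le> n} \<times> Pow {q. set q \<subseteq> S \<and> length q = Suc n})"
    using finite_lists_length_le[OF assms] factors_finite[OF assms] by simp
qed

context locally_DA
begin

lemma tdef_on_stable:
  assumes "finite S"
  shows "tdef_on {w. set w \<subseteq> S} {w. stable u w}"
proof (rule tdef_on_finite_cases)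
  show "finite ((\<lambda>w. (take window_size w, factors (Suc window_size) w)) ` {w. set w \<subseteq> S})"
    by (rule finite_window_data[OF assms])
  show "tdef_on {w. set w \<subseteq> S} {w. (take window_size w, factors (Suc window_size) w) = d}" for d
    by (rule tdef_on_window_data[OF assms])
  show "w' \<in> {w. stable u w}"
    if "(take window_size w, factors (Suc window_size) w) = (take window_size w', factors (Suc window_size) w')"
      "w \<in> {w. stable u w}" for w w'
    using stable_determined[of w w' u] that by simp
qed

text \<open>The right ideal generated by \<open>val u\<close>. It shrinks strictly whenever the
  \<R>-class drops and serves as the measure of the inner induction.\<close>

definition reach :: "'s list \<Rightarrow> 'm set" where
  "reach u = {val (u @ v) | v. True}"

lemma card_reach_less:
  assumes "\<not> stable u w"
  shows "card (reach (u @ w)) < card (reach u)"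
proof (rule psubset_card_mono)
  show "finite (reach u)"
    by (rule finite_subset[OF _ finite_val]) (auto simp: reach_def)
  have "reach (u @ w) \<subseteq> reach u" by (auto simp: reach_def)
  moreover have "val u \<in> reach u" unfolding reach_def by (metis (mono_tags) append_Nil2 mem_Collect_eq)
  moreover have "val u \<notin> reach (u @ w)"
  proof
    assume "val u \<in> reach (u @ w)"
    then obtain v where "val u = val ((u @ w) @ v)" unfolding reach_def by blast
    then have "val (u @ w @ v) = val u" by simp
    with assms show False unfolding stable_def by blast
  qed
  ultimately show "reach (u @ w) \<subset> reach u" by blast
qed

definition words_over :: "'s set \<Rightarrow> 's list set \<Rightarrow> 's list set" where
  "words_over S W = {w. set w \<subseteq> S \<and> factors (Suc window_size) w \<subseteq> W}"

lemma words_over_append: "u @ v \<in> words_over S W \<Longrightarrow> u \<in> words_over S W \<and> v \<in> words_over S W"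
  using factors_append[of "Suc window_size" u v] unfolding words_over_def by auto

lemma unstable_split:
  assumes "\<not> stable u w"
  obtains x c v where "w = x @ c # v" "stable u x" "\<not> stable u (x @ [c])"
proof -
  have "\<exists>x c v. w = x @ c # v \<and> stable u x \<and> \<not> stable u (x @ [c])" using assms
  proof (induction w rule: rev_induct)
    case Nil
    moreover have "stable u []" unfolding stable_def by (rule exI[of _ "[]"]) simp
    ultimately show ?case by blast
  next
    case (snoc d w)
    show ?case
    proof (cases "stable u w")
      case False
      with snoc.IH obtain x c v where "w = x @ c # v" "stable u x" "\<not> stable u (x @ [c])" by blast
      then show ?thesis by (intro exI[of _ x] exI[of _ c] exI[of _ "v @ [d]"]) simp
    qed (use snoc.prems in blast)
  qed
  with that show ?thesis by blast
qed

text \<open>A word that is not stable leaves the \<open>R\<close>-class of \<open>u\<close> at a letter \<open>c\<close>; either it does so early, or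
  the window ending in \<open>c\<close> occurs there for the first time, so that it is absent from the part
  before \<open>c\<close>.\<close>

lemma tdef_on_R_eq:
  assumes S: "finite S" and W: "W \<subseteq> {q. set q \<subseteq> S \<and> length q = Suc window_size}"
    and IH: "\<And>q s. q \<in> W \<Longrightarrow> tdef_on (words_over S (W - {q})) {w. val w = val s}"
  shows "tdef_on (words_over S W) {w. R_eq (u @ w) r}"
proof (induction "card (reach u)" arbitrary: u rule: less_induct)
  case less
  let ?A = "words_over S W"
  obtain T where T: "finite T" "val ` T = range val"
    using finite_subset_image[OF finite_val order_refl] by (metis)
  \<comment> \<open>Descriptions of the first drop: \<open>I1\<close> lists the early ones by the
    prefix read, \<open>I2\<close> the late ones by the window \<open>q\<close> that ends at the
    drop and a representative \<open>s\<close> of the value before it. The letter read at a late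
    drop is \<open>last q\<close>.\<close>
  define I1 where "I1 = {(x, c). set x \<subseteq> S \<and> length x \<le> window_size \<and> c \<in> S \<and> \<not> stable u (x @ [c])}"
  define I2 where "I2 = {(q, s). q \<in> W \<and> s \<in> T \<and> \<not> stable u (s @ [last q])}"
  define D1 where "D1 = (\<lambda>(x, c). {(x @ [c]) @ v | v. v \<in> {v. R_eq ((u @ x @ [c]) @ v) r}})"
  define D2 where "D2 = (\<lambda>(q, s). marked_product q {w. val w = val s}
    {v. R_eq ((u @ s @ [last q]) @ v) r})"
  have W_fin: "finite W" using W factors_finite[OF S] finite_subset by blast
  have I1_fin: "finite I1"
    by (rule finite_subset[of _ "{x. set x \<subseteq> S \<and> length x \<le> window_size} \<times> S"])
      (use finite_lists_length_le[OF S] S in \<open>auto simp: I1_def\<close>)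
  have I2_fin: "finite I2"
    by (rule finite_subset[of _ "W \<times> T"]) (use W_fin T in \<open>auto simp: I2_def\<close>)
  have D1: "tdef_on ?A (D1 i)" if i: "i \<in> I1" for i
  proof -
    obtain x c where xc: "i = (x, c)" "\<not> stable u (x @ [c])" using i by (auto simp: I1_def)
    show ?thesis unfolding D1_def xc(1) prod.case
    proof (rule tdef_on_prefix)
      show "tdef_on ?A {v. R_eq ((u @ x @ [c]) @ v) r}"
        by (rule less) (rule card_reach_less[OF xc(2)])
      show "v \<in> ?A" if "(x @ [c]) @ v \<in> ?A" for v using words_over_append[OF that] by simp
    qed
  qed
  have D2: "tdef_on ?A (D2 i)" if i: "i \<in> I2" for i
  proof -
    obtain q s where qs: "i = (q, s)" "q \<in> W" "\<not> stable u (s @ [last q])" using i by (auto simp: I2_def)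
    have q: "length q = Suc window_size" using qs(2) W by blast
    show ?thesis unfolding D2_def qs(1) prod.case
    proof (rule tdef_on_marked_product)
      \<comment> \<open>The part before the first occurrence of \<open>q\<close> admits one window
        fewer, so the outer induction knows its value; the part after it is read from a smaller
        right ideal.\<close>
      show "tdef_on (words_over S (W - {q})) {w. val w = val s}" by (rule IH[OF qs(2)])
      show "tdef_on ?A {v. R_eq ((u @ s @ [last q]) @ v) r}"
        by (rule less) (rule card_reach_less[OF qs(3)])
      show "q \<noteq> []" using q by auto
      fix x c v assume w: "x @ c # v \<in> ?A" and no: "\<forall>y z. x \<noteq> y @ q @ z"
      from words_over_append[OF w] have x: "x \<in> ?A" by simp
      from words_over_append[of "x @ [c]" v] w have v: "v \<in> ?A" by simp
      have "q \<notin> factors (Suc window_size) x" using no unfolding factors_def by blast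
      with x v show "x \<in> words_over S (W - {q}) \<and> v \<in> ?A" unfolding words_over_def by blast
    qed
  qed
  have stab: "tdef_on ?A {w. stable u w}"
    by (rule tdef_on_subset[OF tdef_on_stable[OF S]]) (auto simp: words_over_def)
  have "tdef_on ?A (({w. stable u w} \<inter> {w. R_eq u r}) \<union> ((\<Union>i\<in>I1. D1 i) \<union> (\<Union>i\<in>I2. D2 i)))"
    by (intro tdef_on_Un tdef_on_Int tdef_on_UN tdef_on_const stab I1_fin I2_fin D1 D2)
  then show ?case
  proof (rule tdef_on_cong)
    fix w assume wA: "w \<in> ?A"
    show "w \<in> ({w. stable u w} \<inter> {w. R_eq u r}) \<union> ((\<Union>i\<in>I1. D1 i) \<union> (\<Union>i\<in>I2. D2 i)) \<longleftrightarrow>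
        w \<in> {w. R_eq (u @ w) r}"
    proof
      assume "w \<in> ({w. stable u w} \<inter> {w. R_eq u r}) \<union> ((\<Union>i\<in>I1. D1 i) \<union> (\<Union>i\<in>I2. D2 i))"
      then consider (stable) "stable u w" "R_eq u r"
        | (early) x c where "w \<in> D1 (x, c)" | (late) q s where "(q, s) \<in> I2" "w \<in> D2 (q, s)"
        by (auto split: if_splits)
      then show "w \<in> {w. R_eq (u @ w) r}"
      proof cases
        case stable
        then show ?thesis using stable_R_eq by blast
      next
        case early
        then show ?thesis unfolding D1_def by auto
      next
        case late
        then obtain x c v y where *: "w = x @ c # v" "val x = val s"
          "R_eq ((u @ s @ [last q]) @ v) r" "x @ [c] = y @ q"
          unfolding D2_def marked_product_def by auto
        have "q \<noteq> []" using late(1) W by (auto simp: I2_def)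
        then have "last q = c" using arg_cong[OF *(4), of last] by simp
        then have "val (u @ w) = val ((u @ s @ [last q]) @ v)"
          using cong_right[OF cong_left[OF *(2), of "c # v"], of u] by (simp add: *(1))
        with R_eq_cong *(3) show ?thesis by blast
      qed
    next
      assume "w \<in> {w. R_eq (u @ w) r}"
      then have R: "R_eq (u @ w) r" by simp
      show "w \<in> ({w. stable u w} \<inter> {w. R_eq u r}) \<union> ((\<Union>i\<in>I1. D1 i) \<union> (\<Union>i\<in>I2. D2 i))"
      proof (cases "stable u w")
        case True
        then show ?thesis using R stable_R_eq by blast
      next
        case False
        then obtain x c v where xcv: "w = x @ c # v" "stable u x" "\<not> stable u (x @ [c])"
          by (rule unstable_split)
        have S': "set x \<subseteq> S" "c \<in> S" using wA by (auto simp: words_over_def xcv(1))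
        show ?thesis
        proof (cases "length x \<le> window_size")
          case True
          then have "(x, c) \<in> I1" using S' xcv(3) by (auto simp: I1_def)
          moreover have "w \<in> D1 (x, c)" using R by (auto simp: D1_def xcv(1))
          ultimately show ?thesis by blast
        next
          case long: False
          define y p where "y = take (length x - window_size) x" and "p = drop (length x - window_size) x"
          have x: "x = y @ p" "length p = window_size" using long by (auto simp: y_def p_def)
          let ?q = "p @ [c]"
          have q: "?q \<in> W"
          proof -
            have "w = y @ ?q @ v" by (simp add: xcv(1) x(1))
            then have "?q \<in> factors (Suc window_size) w" using x(2) unfolding factors_def by auto
            then show ?thesis using wA unfolding words_over_def by blast
          qed
          \<comment> \<open>Were the window already inside \<open>x\<close>, its last step would
            have been taken stably there, and stability would carry over to the repetition of that
            step after \<open>x\<close>.\<close>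
          have fresh: "x \<noteq> y1 @ ?q @ y2" for y1 y2
          proof
            assume "x = y1 @ ?q @ y2"
            then have "stable u (y1 @ p @ [c] @ y2)" using xcv(2) by simp
            from stable_window_step[OF x(2) this, of y] xcv(2,3) show False by (simp add: x(1))
          qed
          have "val x \<in> val ` T" by (simp add: T(2))
          then obtain s where s: "s \<in> T" "val x = val s" by blast
          have "val (x @ [c]) = val (s @ [last ?q])" using cong_left[OF s(2), of "[c]"] by simp
          then have "(?q, s) \<in> I2" using q s(1) xcv(3) stable_cong unfolding I2_def by blast
          moreover have "w \<in> D2 (?q, s)"
          proof -
            have "val (u @ w) = val ((u @ s @ [last ?q]) @ v)"
              using cong_right[OF cong_left[OF s(2), of "c # v"], of u] by (simp add: xcv(1))
            then have "R_eq ((u @ s @ [last ?q]) @ v) r" using R R_eq_cong by blast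
            moreover have "x @ [c] = y @ ?q" by (simp add: x(1))
            ultimately show ?thesis
              unfolding D2_def marked_product_def using xcv(1) s(2) fresh by blast
          qed
          ultimately show ?thesis by blast
        qed
      qed
    qed
  qed
qed

end

section \<open>Both reading directions together\<close>

lemma (in locally_DA) window_size_rev: "card (range (\<lambda>w. val (rev w))) = window_size"
proof -
  have "range (\<lambda>w. val (rev w)) = val ` range rev" by (simp only: image_image)
  also have "range rev = (UNIV :: 's list set)" by (rule surjI[of _ rev]) simp
  finally show ?thesis by (simp add: window_size_def)
qed

lemma (in locally_DA) rev_words_over:
  "rev ` words_over S W = locally_DA.words_over (\<lambda>w. val (rev w)) S (rev ` W)"
proof (rule Set.set_eqI)
  fix w
  interpret r: locally_DA "\<lambda>w. val (rev w)" by (rule locally_DA_rev) unfold_locales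
  have ws: "r.window_size = window_size" by (simp add: r.window_size_def window_size_rev)
  have "w \<in> rev ` words_over S W \<longleftrightarrow> rev w \<in> words_over S W"
    by (metis imageE imageI rev_rev_ident)
  also have "\<dots> \<longleftrightarrow> w \<in> r.words_over S (rev ` W)"
  proof -
    have "factors n (rev w) \<subseteq> W \<longleftrightarrow> factors n w \<subseteq> rev ` W" for n
      unfolding factors_rev by (auto simp: image_subset_iff image_iff) (metis rev_rev_ident)+
    then show ?thesis unfolding words_over_def r.words_over_def ws by simp
  qed
  finally show "w \<in> rev ` words_over S W \<longleftrightarrow> w \<in> r.words_over S (rev ` W)" .
qed

lemma tdef_on_val:
  assumes "finite S" and "finite W" and "locally_DA val"
    and "W \<subseteq> {q. set q \<subseteq> S \<and> length q = Suc (locally_DA.window_size val)}"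
  shows "tdef_on (locally_DA.words_over val S W) {w. val w = val s}"
  using assms(2-4)
proof (induction "card W" arbitrary: val W s rule: less_induct)
  case less
  interpret locally_DA val by fact
  interpret r: locally_DA "\<lambda>w. val (rev w)" by (rule locally_DA_rev) fact
  have ws: "r.window_size = window_size" by (simp add: r.window_size_def window_size_rev)
  let ?A = "words_over S W"
  have R: "tdef_on ?A {w. R_eq ([] @ w) s}"
  proof (rule tdef_on_R_eq)
    show "tdef_on (words_over S (W - {q})) {w. val w = val s}" if "q \<in> W" for q s
    proof (rule less)
      show "card (W - {q}) < card W" using less.prems(1) that by (rule card_Diff1_less)
    qed (use less.prems locally_DA_axioms in auto)
  qed (use assms(1) less.prems in auto)
  have revW: "rev ` W \<subseteq> {q. set q \<subseteq> S \<and> length q = Suc r.window_size}"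
  proof (rule image_subsetI)
    fix q assume "q \<in> W"
    then have "set q \<subseteq> S \<and> length q = Suc window_size" using less.prems(3) by blast
    then show "rev q \<in> {q. set q \<subseteq> S \<and> length q = Suc r.window_size}" by (simp add: ws)
  qed
  have L: "tdef_on (r.words_over S (rev ` W)) {w. r.R_eq ([] @ w) (rev s)}"
  proof (rule r.tdef_on_R_eq)
    show "tdef_on (r.words_over S (rev ` W - {q})) {w. val (rev w) = val (rev s)}"
      if "q \<in> rev ` W" for q s
    proof (rule less)
      have "card (rev ` W - {q}) < card (rev ` W)"
        using that less.prems(1) by (intro card_Diff1_less) auto
      then show "card (rev ` W - {q}) < card W"
        using card_image[of rev W] inj_on_rev by simp
    qed (use less.prems revW in \<open>auto intro: r.locally_DA_axioms\<close>)
  qed (use assms(1) revW in auto)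
  have "rev ` r.words_over S (rev ` W) = ?A"
    unfolding rev_words_over[symmetric] by (simp add: image_image)
  with tdef_on_rev[OF L] have L': "tdef_on ?A {w. r.R_eq (rev w) (rev s)}" by simp
  have "tdef_on ?A ({w. R_eq ([] @ w) s} \<inter> {w. r.R_eq (rev w) (rev s)})"
    by (rule tdef_on_Int[OF R L'])
  then show ?case
  proof (rule tdef_on_cong)
    fix w
    have "val w = val s" if "R_eq w s" "r.R_eq (rev w) (rev s)"
    proof -
      from that(1) obtain x where "val (w @ x) = val s" unfolding R_eq_def by blast
      moreover from that(2) obtain y z where "val (rev (rev w @ y)) = val (rev (rev s))"
        "val (rev (rev s @ z)) = val (rev (rev w))"
        unfolding r.R_eq_def by blast
      ultimately show ?thesis using R_and_L_imp_eq[of w x s "rev z" "rev y"] by simp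
    qed
    moreover have "R_eq w s \<and> r.R_eq (rev w) (rev s)" if "val w = val s"
      unfolding R_eq_def r.R_eq_def using that by (auto intro!: exI[of _ "[]"])
    ultimately show "w \<in> {w. R_eq ([] @ w) s} \<inter> {w. r.R_eq (rev w) (rev s)} \<longleftrightarrow> w \<in> {w. val w = val s}"
      by auto
  qed
qed

theorem locally_DA_tdef:
  assumes "locally_DA val" and "finite S"
  shows "tdef_on {w. set w \<subseteq> S} {w. val w = val s}"
proof -
  interpret locally_DA val by fact
  let ?W = "{q. set q \<subseteq> S \<and> length q = Suc window_size}"
  have "tdef_on (words_over S ?W) {w. val w = val s}"
    using assms factors_finite[OF assms(2)] by (intro tdef_on_val) auto
  moreover have "{w. set w \<subseteq> S} \<subseteq> words_over S ?W"
    unfolding words_over_def factors_def by auto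
  ultimately show ?thesis by (rule tdef_on_subset)
qed

section \<open>Translation into two-variable logic\<close>

fun flip_var :: "var \<Rightarrow> var" where
  "flip_var VX = VY"
| "flip_var VY = VX"

text \<open>Exchanging the variables lets a formula about the position of \<open>VX\<close> be used
  for the position of \<open>VY\<close>, with \<open>VX\<close> available for reuse inside
  it.\<close>

fun flip :: "'a fo2 \<Rightarrow> 'a fo2" where
  "flip FTrue = FTrue"
| "flip (FNot f) = FNot (flip f)"
| "flip (FAnd f g) = FAnd (flip f) (flip g)"
| "flip (FEx v f) = FEx (flip_var v) (flip f)"
| "flip (FLess u v) = FLess (flip_var u) (flip_var v)"
| "flip (FEq u v) = FEq (flip_var u) (flip_var v)"
| "flip (FLetter a v) = FLetter a (flip_var v)"
| "flip (FInv a u v) = FInv a (flip_var u) (flip_var v)"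

lemma flip_var_flip_var [simp]: "flip_var (flip_var v) = v"
  by (cases v) auto

lemma sat_flip: "sat w \<sigma> (flip f) \<longleftrightarrow> sat w (\<lambda>v. \<sigma> (flip_var v)) f"
proof (induction f arbitrary: \<sigma>)
  case (FEx v f)
  have "(\<lambda>u. (\<sigma>(flip_var v := i)) (flip_var u)) = (\<lambda>u. \<sigma> (flip_var u))(v := i)" for i
    by (rule ext) (metis flip_var_flip_var fun_upd_apply)
  with FEx show ?case by simp
qed auto

definition fo1 :: "('a list \<Rightarrow> nat \<Rightarrow> bool) \<Rightarrow> bool" where
  "fo1 P \<longleftrightarrow> (\<exists>f. fv f \<subseteq> {VX} \<and> (\<forall>w \<sigma>. \<sigma> VX < length w \<longrightarrow> (sat w \<sigma> f \<longleftrightarrow> P w (\<sigma> VX))))"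

lemma fo1I:
  "fv f \<subseteq> {VX} \<Longrightarrow> (\<And>w \<sigma>. \<sigma> VX < length w \<Longrightarrow> sat w \<sigma> f \<longleftrightarrow> P w (\<sigma> VX)) \<Longrightarrow> fo1 P"
  unfolding fo1_def by blast

lemma fo1_cong: "fo1 P \<Longrightarrow> (\<And>w i. i < length w \<Longrightarrow> P w i \<longleftrightarrow> Q w i) \<Longrightarrow> fo1 Q"
  unfolding fo1_def by meson

lemma fo1_letter: "fo1 (\<lambda>w i. w ! i = c)"
  by (rule fo1I[of "FLetter c VX"]) auto

lemma fo1_not:
  assumes "fo1 P" shows "fo1 (\<lambda>w i. \<not> P w i)"
proof -
  from assms obtain f where "fv f \<subseteq> {VX}"
    "\<And>w \<sigma>. \<sigma> VX < length w \<Longrightarrow> sat w \<sigma> f \<longleftrightarrow> P w (\<sigma> VX)" unfolding fo1_def by blast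
  then show ?thesis by (intro fo1I[of "FNot f"]) auto
qed

lemma fo1_and:
  assumes "fo1 P" "fo1 Q" shows "fo1 (\<lambda>w i. P w i \<and> Q w i)"
proof -
  from assms obtain f g where "fv f \<subseteq> {VX}" "fv g \<subseteq> {VX}"
    "\<And>w \<sigma>. \<sigma> VX < length w \<Longrightarrow> sat w \<sigma> f \<longleftrightarrow> P w (\<sigma> VX)"
    "\<And>w \<sigma>. \<sigma> VX < length w \<Longrightarrow> sat w \<sigma> g \<longleftrightarrow> Q w (\<sigma> VX)" unfolding fo1_def by blast
  then show ?thesis by (intro fo1I[of "FAnd f g"]) auto
qed

lemma fo1_or: "fo1 P \<Longrightarrow> fo1 Q \<Longrightarrow> fo1 (\<lambda>w i. P w i \<or> Q w i)"
  using fo1_not[OF fo1_and[OF fo1_not fo1_not, of P Q]] by simp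

lemma fo1_modal:
  assumes "fo1 P" and "\<And>w \<sigma>. sat w \<sigma> r \<longleftrightarrow> R w (\<sigma> VX) (\<sigma> VY)"
  shows "fo1 (\<lambda>w i. \<exists>j<length w. R w i j \<and> P w j)"
proof -
  from assms obtain f where f: "fv f \<subseteq> {VX}"
    "\<And>w \<sigma>. \<sigma> VX < length w \<Longrightarrow> sat w \<sigma> f \<longleftrightarrow> P w (\<sigma> VX)" unfolding fo1_def by blast
  show ?thesis
  proof (rule fo1I[of "FEx VY (FAnd r (flip f))"])
    show "fv (FEx VY (FAnd r (flip f))) \<subseteq> {VX}"
    proof
      fix v assume "v \<in> fv (FEx VY (FAnd r (flip f)))"
      then show "v \<in> {VX}" by (cases v) auto
    qed
    fix w :: "'a list" and \<sigma> assume "\<sigma> VX < length w"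
    show "sat w \<sigma> (FEx VY (FAnd r (flip f))) \<longleftrightarrow> (\<exists>j<length w. R w (\<sigma> VX) j \<and> P w j)"
      using f(2) assms(2) by (simp add: sat_flip cong: conj_cong)
  qed
qed

lemma fo1_until: "fo1 P \<Longrightarrow> fo1 (\<lambda>w i. \<exists>j<length w. (i < j \<and> c \<notin> bet w i j) \<and> P w j)"
  by (erule fo1_modal[of _ "FAnd (FLess VX VY) (FNot (FInv c VX VY))"])
    (simp only: sat_FInv sat.simps(2,3,5))

lemma fo1_since: "fo1 P \<Longrightarrow> fo1 (\<lambda>w i. \<exists>j<length w. (j < i \<and> c \<notin> bet w i j) \<and> P w j)"
  by (erule fo1_modal[of _ "FAnd (FLess VY VX) (FNot (FInv c VX VY))"])
    (simp only: sat_FInv sat.simps(2,3,5))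

lemma fo1_fut: "fo1 P \<Longrightarrow> fo1 (\<lambda>w i. \<exists>j. i < j \<and> j < length w \<and> P w j)"
  by (rule fo1_cong[OF fo1_modal[of P "FLess VX VY" "\<lambda>w i j. i < j"]]) auto

lemma fo1_past: "fo1 P \<Longrightarrow> fo1 (\<lambda>w i. \<exists>j<i. P w j)"
  by (rule fo1_cong[OF fo1_modal[of P "FLess VY VX" "\<lambda>w i j. j < i"]]) (auto intro: less_trans)

text \<open>This is how successor enters the logic: with only two letters available, absence of both
  means that nothing lies in between.\<close>

lemma bet_empty_iff:
  assumes "i < j" "j < length w" "(UNIV :: 'a set) = {a, b}"
  shows "a \<notin> bet w i j \<and> b \<notin> bet w i j \<longleftrightarrow> j = Suc i"
proof -
  have "bet w i j = {} \<longleftrightarrow> a \<notin> bet w i j \<and> b \<notin> bet w i j"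
  proof -
    have "c = a \<or> c = b" for c :: 'a using assms(3) by blast
    then show ?thesis by (metis empty_iff equals0I)
  qed
  moreover have "bet w i j = {} \<longleftrightarrow> j \<le> Suc i"
    using assms(1,2) by (simp add: bet_def min_def max_def)
  ultimately show ?thesis using assms(1) by auto
qed

lemma fo1_next:
  assumes "fo1 P" "(UNIV :: 'a set) = {a, b}"
  shows "fo1 (\<lambda>w i. Suc i < length w \<and> P (w :: 'a list) (Suc i))"
proof -
  let ?r = "FAnd (FLess VX VY) (FAnd (FNot (FInv a VX VY)) (FNot (FInv b VX VY)))"
  have "fo1 (\<lambda>w i. \<exists>j<length w. (i < j \<and> a \<notin> bet w i j \<and> b \<notin> bet w i j) \<and> P w j)"
    by (rule fo1_modal[of _ ?r, OF assms(1)]) (simp only: sat_FInv sat.simps(2,3,5))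
  then show ?thesis
    by (rule fo1_cong) (use bet_empty_iff[OF _ _ assms(2)] in auto)
qed

lemma fo1_prev:
  assumes "fo1 P" "(UNIV :: 'a set) = {a, b}"
  shows "fo1 (\<lambda>w i. 0 < i \<and> P (w :: 'a list) (i - 1))"
proof -
  let ?r = "FAnd (FLess VY VX) (FAnd (FNot (FInv a VX VY)) (FNot (FInv b VX VY)))"
  have "fo1 (\<lambda>w i. \<exists>j<length w. (j < i \<and> a \<notin> bet w i j \<and> b \<notin> bet w i j) \<and> P w j)"
    by (rule fo1_modal[of _ ?r, OF assms(1)]) (simp only: sat_FInv sat.simps(2,3,5))
  then show ?thesis
  proof (rule fo1_cong)
    fix w :: "'a list" and i assume i: "i < length w"
    have "a \<notin> bet w i j \<and> b \<notin> bet w i j \<longleftrightarrow> i = Suc j" if "j < i" for j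
      using bet_empty_iff[OF that i assms(2)] unfolding bet_commute[of w i j] .
    then have "(j < i \<and> a \<notin> bet w i j \<and> b \<notin> bet w i j) \<longleftrightarrow> i = Suc j" for j by auto
    then show "(\<exists>j<length w. (j < i \<and> a \<notin> bet w i j \<and> b \<notin> bet w i j) \<and> P w j) \<longleftrightarrow>
        0 < i \<and> P w (i - 1)"
      using i by (cases i) auto
  qed
qed

lemma tdef_imp_fo1:
  assumes "tdef P" "(UNIV :: 'a set) = {a, b}"
  shows "fo1 (P :: 'a list \<Rightarrow> nat \<Rightarrow> bool)"
  using assms(1)
proof induction
  case (tdef_cong P Q)
  then show ?case by (blast intro: fo1_cong)
qed (blast intro: fo1_letter fo1_not fo1_and fo1_fut fo1_past fo1_next[OF _ assms(2)]
  fo1_prev[OF _ assms(2)])+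

lemma FO2Inv_definable_fo1:
  assumes "fo1 P"
  shows "FO2Inv_definable {w. \<exists>i<length w. P w i}"
proof -
  from assms obtain f where f: "fv f \<subseteq> {VX}"
    "\<And>w \<sigma>. \<sigma> VX < length w \<Longrightarrow> sat w \<sigma> f \<longleftrightarrow> P w (\<sigma> VX)" unfolding fo1_def by blast
  have "sentence (FEx VX f)" using f(1) by (auto simp: sentence_def)
  moreover have "{w. \<exists>i<length w. P w i} = {w. sat w (\<lambda>_. 0) (FEx VX f)}"
    using f(2) by (auto cong: conj_cong)
  ultimately show ?thesis unfolding FO2Inv_definable_def by blast
qed

lemma FO2Inv_definable_Compl:
  assumes "FO2Inv_definable D" shows "FO2Inv_definable (- D)"
proof -
  from assms obtain f where "sentence f" "D = {w. sat w (\<lambda>_. 0) f}"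
    unfolding FO2Inv_definable_def by blast
  then show ?thesis unfolding FO2Inv_definable_def
    by (intro exI[of _ "FNot f"]) (auto simp: sentence_def)
qed

lemma FO2Inv_definable_Int:
  assumes "FO2Inv_definable D" "FO2Inv_definable D'" shows "FO2Inv_definable (D \<inter> D')"
proof -
  from assms obtain f g where "sentence f" "D = {w. sat w (\<lambda>_. 0) f}"
    "sentence g" "D' = {w. sat w (\<lambda>_. 0) g}" unfolding FO2Inv_definable_def by blast
  then show ?thesis unfolding FO2Inv_definable_def
    by (intro exI[of _ "FAnd f g"]) (auto simp: sentence_def)
qed

lemma FO2Inv_definable_Un:
  "FO2Inv_definable D \<Longrightarrow> FO2Inv_definable D' \<Longrightarrow> FO2Inv_definable (D \<union> D')"
  using FO2Inv_definable_Compl[OF FO2Inv_definable_Int[OF FO2Inv_definable_Compl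
    FO2Inv_definable_Compl, of D D']] by simp

lemma FO2Inv_definable_const: "FO2Inv_definable {w. b}"
proof -
  have "{w. False} = {w. sat w (\<lambda>_. 0) (FNot FTrue)}" "{w. True} = {w. sat w (\<lambda>_. 0) FTrue}" by auto
  moreover have "sentence FTrue" "sentence (FNot FTrue)" by (simp_all add: sentence_def)
  ultimately show ?thesis unfolding FO2Inv_definable_def by (cases b) blast+
qed

lemma FO2Inv_definable_UN:
  "finite I \<Longrightarrow> (\<And>i. i \<in> I \<Longrightarrow> FO2Inv_definable (D i)) \<Longrightarrow> FO2Inv_definable (\<Union>i\<in>I. D i)"
proof (induction rule: finite_induct)
  case empty
  then show ?case using FO2Inv_definable_const[of False] by simp
qed (simp add: FO2Inv_definable_Un)

section \<open>Words over two letters as sequences of blocks\<close>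

locale two_letters =
  fixes a b :: 'a
  assumes UNIV_ab: "UNIV = {a, b}" and a_neq_b: "a \<noteq> b"
begin

text \<open>The exponents are shifted by one, so that every block contains both letters.\<close>

definition enc :: "(nat \<times> nat) list \<Rightarrow> 'a list" where
  "enc s = concat (map (\<lambda>(i, j). replicate (Suc i) a @ replicate (Suc j) b) s)"

lemma enc_simps [simp]:
  "enc [] = []"
  "enc ((i, j) # s) = replicate (Suc i) a @ replicate (Suc j) b @ enc s"
  "enc (s @ t) = enc s @ enc t"
  by (simp_all add: enc_def)

lemma enc_pw: "enc (pw k s) = pw k (enc s)"
  by (induction k) auto

text \<open>Leading b's and trailing a's belong to no block and are kept apart.\<close>

definition word :: "nat \<Rightarrow> (nat \<times> nat) list \<Rightarrow> nat \<Rightarrow> 'a list" where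
  "word j s i = replicate j b @ enc s @ replicate i a"

lemma word_exists: "\<exists>j s i. w = word j s i"
proof (induction w)
  case Nil
  show ?case by (intro exI[of _ 0] exI[of _ "[]"]) (simp add: word_def)
next
  case (Cons c w)
  then obtain j s i where w: "w = word j s i" by blast
  have "c = a \<or> c = b" using UNIV_ab by auto
  then show ?case
  proof
    assume "c = b"
    then have "c # w = word (Suc j) s i" by (simp add: w word_def)
    then show ?thesis by blast
  next
    assume c: "c = a"
    show ?thesis
    proof (cases j)
      case (Suc j')
      then have "c # w = word 0 ((0, j') # s) i" by (simp add: w word_def c)
      then show ?thesis by blast
    next
      case 0
      show ?thesis
      proof (cases s)
        case Nil
        with 0 have "c # w = word 0 [] (Suc i)" by (simp add: w word_def c)
        then show ?thesis by blast
      next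
        case (Cons p s')
        then obtain k l where "s = (k, l) # s'" by (cases p) auto
        with 0 have "c # w = word 0 ((Suc k, l) # s') i" by (simp add: w word_def c)
        then show ?thesis by blast
      qed
    qed
  qed
qed

section \<open>Block starts as definable positions\<close>

definition pos :: "nat \<Rightarrow> (nat \<times> nat) list \<Rightarrow> nat \<Rightarrow> nat" where
  "pos j s l = j + length (enc (take l s))"

text \<open>The demand for a later b excludes the trailing a's, which form no block.\<close>

definition is_start :: "'a list \<Rightarrow> nat \<Rightarrow> bool" where
  "is_start w x \<longleftrightarrow> w ! x = a \<and> \<not> (0 < x \<and> w ! (x - 1) = a) \<and> (\<exists>y. x < y \<and> y < length w \<and> w ! y = b)"

lemma fo1_is_start: "fo1 is_start"
  unfolding is_start_def
  by (intro fo1_and fo1_not fo1_letter fo1_prev[OF _ UNIV_ab] fo1_fut)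

lemma last_before_start: "replicate j b @ enc s = [] \<or> last (replicate j b @ enc s) = b"
proof -
  have "enc s = [] \<or> last (enc s) = b"
    by (induction s rule: rev_induct) (auto simp: last_append)
  then show ?thesis by (cases "enc s = []"; cases "j = 0") (auto simp: last_append)
qed

lemma word_split:
  assumes "l < length s" "s ! l = (p, q)"
  obtains u v where "word j s i = u @ replicate (Suc p) a @ replicate (Suc q) b @ v"
    "length u = pos j s l" "pos j s (Suc l) = pos j s l + Suc p + Suc q"
    "u = [] \<or> last u = b" "v = [] \<or> hd v = a" "Suc l < length s \<Longrightarrow> v \<noteq> []"
    "l = 0 \<Longrightarrow> set u \<subseteq> {b}"
proof (rule that)
  let ?u = "replicate j b @ enc (take l s)" and ?v = "enc (drop (Suc l) s) @ replicate i a"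
  have s: "s = take l s @ (p, q) # drop (Suc l) s" using id_take_nth_drop[OF assms(1)] assms(2) by simp
  have "enc s = enc (take l s @ (p, q) # drop (Suc l) s)" using s by (rule arg_cong)
  then show "word j s i = ?u @ replicate (Suc p) a @ replicate (Suc q) b @ ?v"
    unfolding word_def by (simp only: enc_simps append.assoc)
  show "length ?u = pos j s l" by (simp add: pos_def)
  have "take (Suc l) s = take l s @ [(p, q)]" using assms by (simp add: take_Suc_conv_app_nth)
  then show "pos j s (Suc l) = pos j s l + Suc p + Suc q" by (simp add: pos_def)
  show "?u = [] \<or> last ?u = b" by (rule last_before_start)
  have "enc t = [] \<or> hd (enc t) = a" for t by (cases t) auto
  from this[of "drop (Suc l) s"] show "?v = [] \<or> hd ?v = a"
    by (cases "enc (drop (Suc l) s) = []"; cases "i = 0") (auto simp: hd_append)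
  show "?v \<noteq> []" if "Suc l < length s"
  proof -
    from that have "drop (Suc l) s = s ! Suc l # drop (Suc (Suc l)) s" by (simp add: Cons_nth_drop_Suc)
    then show ?thesis by (cases "s ! Suc l") simp
  qed
  show "set ?u \<subseteq> {b}" if "l = 0" using that by auto
qed

lemma pos_less:
  assumes "l < l'" "l' \<le> length s"
  shows "pos j s l < pos j s l'"
proof -
  obtain p q where pq: "s ! l = (p, q)" by (cases "s ! l")
  have "l < length s" using assms by simp
  from word_split[OF this pq] have "pos j s l < pos j s (Suc l)" by (metis add_Suc_right less_add_Suc1 trans_less_add1)
  also have "pos j s (Suc l) \<le> pos j s l'"
  proof -
    have "take l' s = take (Suc l) s @ drop (Suc l) (take l' s)"
      using append_take_drop_id[of "Suc l" "take l' s"] assms by (simp add: min_def)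
    then have "enc (take l' s) = enc (take (Suc l) s) @ enc (drop (Suc l) (take l' s))"
      by (metis enc_simps(3))
    then show ?thesis by (simp add: pos_def)
  qed
  finally show ?thesis .
qed

lemma pos_less_length: "l < length s \<Longrightarrow> pos j s l < length (word j s i)"
  using pos_less[of l "length s" s j] by (simp add: pos_def word_def)

lemma pos_less_iff:
  "l < length s \<Longrightarrow> l' < length s \<Longrightarrow> pos j s l < pos j s l' \<longleftrightarrow> l < l'"
  using pos_less[of l l' s j] pos_less[of l' l s j] by (cases l l' rule: linorder_cases) auto

lemma is_start_pos:
  assumes "l < length s"
  shows "is_start (word j s i) (pos j s l)"
proof -
  obtain p q where pq: "s ! l = (p, q)" by (cases "s ! l")
  from word_split[OF assms pq] obtain u v where
    *: "word j s i = u @ replicate (Suc p) a @ replicate (Suc q) b @ v"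
    "length u = pos j s l" "u = [] \<or> last u = b" by metis
  have "word j s i ! (pos j s l - 1) = b" if "0 < pos j s l"
    using that *(3) unfolding *(1) *(2)[symmetric] by (auto simp: nth_append last_conv_nth)
  moreover have "word j s i ! (pos j s l + Suc p) = b" "pos j s l + Suc p < length (word j s i)"
    "word j s i ! pos j s l = a"
    unfolding *(1) *(2)[symmetric] by (auto simp: nth_append)
  ultimately show ?thesis unfolding is_start_def using a_neq_b
    by (metis less_add_Suc1 add_Suc_right)
qed

lemma start_is_pos:
  assumes "is_start (word j s i) x" "x < length (word j s i)"
  shows "\<exists>l<length s. x = pos j s l"
proof -
  have "\<exists>l<length s. x = pos j s l"
    if "is_start (word j s i) x" "x < length (word j s i)" for x
    using that
  proof (induction s arbitrary: j x)
    case Nil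
    then have "x \<ge> j" using a_neq_b by (auto simp: is_start_def word_def nth_append split: if_splits)
    then show ?case using Nil a_neq_b by (auto simp: is_start_def word_def nth_append)
  next
    case (Cons pq s)
    obtain p q where pq: "pq = (p, q)" by (cases pq)
    have w: "word j (pq # s) i = replicate j b @ replicate (Suc p) a @ word (Suc q) s i"
      by (simp add: word_def pq)
    consider "x < j" | "x = j" | "j < x" "x < j + Suc p" | "j + Suc p \<le> x" by linarith
    then show ?case
    proof cases
      case 1
      then show ?thesis using Cons.prems(1) a_neq_b unfolding w is_start_def by (simp add: nth_append)
    next
      case 2
      then show ?thesis by (intro exI[of _ 0]) (simp add: pos_def)
    next
      case 3
      then have "word j (pq # s) i ! (x - 1) = a" unfolding w by (auto simp: nth_append nth_Cons')
      then show ?thesis using Cons.prems(1) 3 unfolding is_start_def by simp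
    next
      case 4
      define y where "y = x - (j + Suc p)"
      have x: "x = j + Suc p + y" using 4 by (simp add: y_def)
      have nth: "word j (pq # s) i ! (j + Suc p + k) = word (Suc q) s i ! k" for k
        unfolding w by (simp add: nth_append)
      have len: "length (word j (pq # s) i) = j + Suc p + length (word (Suc q) s i)"
        unfolding w by simp
      have "is_start (word (Suc q) s i) y"
      proof -
        from Cons.prems(1) obtain z where z: "x < z" "z < length (word j (pq # s) i)"
          "word j (pq # s) i ! z = b" unfolding is_start_def by blast
        then have "z = j + Suc p + (z - (j + Suc p))" using x by simp
        then have "word (Suc q) s i ! (z - (j + Suc p)) = b" using z(3) nth by metis
        moreover have "y < z - (j + Suc p)" "z - (j + Suc p) < length (word (Suc q) s i)"
          using z x len by linarith+
        moreover have "word (Suc q) s i ! y = a" using Cons.prems(1) nth[of y] x by (simp add: is_start_def)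
        moreover have "\<not> (0 < y \<and> word (Suc q) s i ! (y - 1) = a)"
        proof
          assume y: "0 < y \<and> word (Suc q) s i ! (y - 1) = a"
          then have "x - 1 = j + Suc p + (y - 1)" using x by simp
          with nth[of "y - 1"] y Cons.prems(1) x show False by (simp add: is_start_def)
        qed
        ultimately show ?thesis unfolding is_start_def by blast
      qed
      moreover have "y < length (word (Suc q) s i)" using Cons.prems(2) x len by simp
      ultimately obtain l where "l < length s" "y = pos (Suc q) s l" using Cons.IH by blast
      then show ?thesis by (intro exI[of _ "Suc l"]) (simp add: x pos_def pq)
    qed
  qed
  with assms show ?thesis by blast
qed

end

lemma bet_memI: "x < k \<Longrightarrow> k < y \<Longrightarrow> k < length w \<Longrightarrow> w ! k \<in> bet w x y"
  by (auto simp: bet_def in_set_drop_iff Suc_le_eq intro!: exI[of _ k])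

text \<open>The next \<open>c\<close> after x is a single position, so the guarded quantifier acts
  as a definable move of the variable to it.\<close>

lemma until_unique:
  assumes "x < z" "z < length w" "w ! z = c" "c \<notin> bet w x z"
  shows "(\<exists>y<length w. (x < y \<and> c \<notin> bet w x y) \<and> w ! y = c \<and> Q w y) \<longleftrightarrow> Q w z"
proof
  assume "\<exists>y<length w. (x < y \<and> c \<notin> bet w x y) \<and> w ! y = c \<and> Q w y"
  then obtain y where y: "y < length w" "x < y" "c \<notin> bet w x y" "w ! y = c" "Q w y" by blast
  have "y = z"
    using bet_memI[of x y z w] bet_memI[of x z y w] y assms by (cases y z rule: linorder_cases) auto
  with y show "Q w z" by simp
qed (use assms in blast)

lemma since_unique:
  assumes "z < x" "x < length w" "w ! z = c" "c \<notin> bet w z x"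
  shows "(\<exists>y<length w. (y < x \<and> c \<notin> bet w x y) \<and> w ! y = c \<and> Q w y) \<longleftrightarrow> Q w z"
proof
  assume "\<exists>y<length w. (y < x \<and> c \<notin> bet w x y) \<and> w ! y = c \<and> Q w y"
  then obtain y where y: "y < length w" "y < x" "c \<notin> bet w y x" "w ! y = c" "Q w y"
    unfolding bet_commute[of w x] by blast
  have "y = z"
    using bet_memI[of y z x w] bet_memI[of z y x w] y assms by (cases y z rule: linorder_cases) auto
  with y show "Q w z" by simp
next
  assume "Q w z"
  moreover have "z < length w" using assms by simp
  ultimately show "\<exists>y<length w. (y < x \<and> c \<notin> bet w x y) \<and> w ! y = c \<and> Q w y"
    using assms unfolding bet_commute[of w x] by blast
qed

lemma take_replicate_append_iff:
  assumes "v = [] \<or> hd v \<noteq> c"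
  shows "take k (replicate m c @ v) = replicate k c \<longleftrightarrow> k \<le> m"
proof
  assume eq: "take k (replicate m c @ v) = replicate k c"
  show "k \<le> m"
  proof (rule ccontr)
    assume "\<not> k \<le> m"
    then have "m < length (take k (replicate m c @ v))" using eq by simp
    then have "v \<noteq> []" by auto
    moreover have "(replicate m c @ v) ! m = take k (replicate m c @ v) ! m"
      using \<open>\<not> k \<le> m\<close> by (simp only: nth_take not_le)
    then have "(replicate m c @ v) ! m = replicate k c ! m" unfolding eq .
    then have "(replicate m c @ v) ! m = c" using \<open>\<not> k \<le> m\<close> by simp
    ultimately show False using assms by (simp add: nth_append hd_conv_nth)
  qed
qed (simp add: min_def)

context two_letters
begin

lemma block_facts:
  fixes j i s l p q
  defines "w \<equiv> word j s i" and "x \<equiv> pos j s l"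
  assumes l: "l < length s" "s ! l = (p, q)"
  shows "x + Suc p < length w" "w ! (x + Suc p) = b" "b \<notin> bet w x (x + Suc p)"
    "take k (drop x w) = replicate k a \<longleftrightarrow> k \<le> Suc p"
    "take k (drop (x + Suc p) w) = replicate k b \<longleftrightarrow> k \<le> Suc q"
    "pos j s (Suc l) = x + Suc p + Suc q"
    "Suc l < length s \<Longrightarrow> w ! (x + Suc p + Suc q) = a"
    "a \<notin> bet w (x + Suc p) (x + Suc p + Suc q)"
    "w ! (x + p) = a" "a \<notin> bet w (x + p) (x + Suc p + Suc q)" "b \<notin> bet w x (x + p)"
    "l = 0 \<Longrightarrow> y < x \<Longrightarrow> w ! y = b"
proof -
  from word_split[OF l] obtain u v where
    w: "w = u @ replicate (Suc p) a @ replicate (Suc q) b @ v"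
    and u: "length u = x" "l = 0 \<Longrightarrow> set u \<subseteq> {b}"
    and v: "v = [] \<or> hd v = a" "Suc l < length s \<Longrightarrow> v \<noteq> []"
    and next_pos: "pos j s (Suc l) = x + Suc p + Suc q"
    unfolding w_def x_def by metis
  show "pos j s (Suc l) = x + Suc p + Suc q" by (rule next_pos)
  show "x + Suc p < length w" "w ! (x + Suc p) = b" "w ! (x + p) = a"
    unfolding w u(1)[symmetric] by (auto simp: nth_append nth_Cons')
  show "b \<notin> bet w x (x + p)"
    unfolding w u(1)[symmetric] using a_neq_b by (auto simp: bet_def simp del: replicate_Suc)
  show "b \<notin> bet w x (x + Suc p)" "a \<notin> bet w (x + Suc p) (x + Suc p + Suc q)"
    "a \<notin> bet w (x + p) (x + Suc p + Suc q)"
    unfolding w u(1)[symmetric] using a_neq_b by (auto simp: bet_def min_def max_def)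
  have "drop x w = replicate (Suc p) a @ replicate (Suc q) b @ v"
    "drop (x + Suc p) w = replicate (Suc q) b @ v"
    unfolding w u(1)[symmetric] by simp_all
  then show "take k (drop x w) = replicate k a \<longleftrightarrow> k \<le> Suc p"
    "take k (drop (x + Suc p) w) = replicate k b \<longleftrightarrow> k \<le> Suc q"
    using take_replicate_append_iff[of "replicate (Suc q) b @ v" a k "Suc p"]
      take_replicate_append_iff[of v b k "Suc q"] v(1) a_neq_b by auto
  show "w ! (x + Suc p + Suc q) = a" if "Suc l < length s"
    unfolding w u(1)[symmetric] using v that by (auto simp: nth_append hd_conv_nth)
  show "w ! y = b" if "l = 0" "y < x"
  proof -
    have "u ! y \<in> set u" using that u(1) by simp
    then have "u ! y = b" using u(2)[OF that(1)] by blast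
    then show ?thesis using that(2) unfolding w u(1)[symmetric] by (simp add: nth_append)
  qed
qed

section \<open>Translation of formulas on blocks into formulas on letters\<close>

definition trunc :: "nat \<Rightarrow> nat \<times> nat \<Rightarrow> nat \<times> nat" where
  "trunc N = (\<lambda>(p, q). (min p N, min q N))"

lemma start_unique_between:
  assumes "l < length s" "is_start (word j s i) y" "y < length (word j s i)"
    and "pos j s l \<le> y" "y < pos j s (Suc l)"
  shows "y = pos j s l"
proof -
  obtain l' where l': "l' < length s" "y = pos j s l'" using start_is_pos[OF assms(2,3)] by blast
  have "\<not> l' < l" using assms l' pos_less_iff[of l' s l j] by auto
  moreover have "\<not> Suc l \<le> l'"
  proof
    assume "Suc l \<le> l'"
    then have "pos j s (Suc l) \<le> pos j s l'"
      using pos_less[of "Suc l" l' s j] l'(1) by (cases "Suc l = l'") auto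
    then show False using assms(5) l'(2) by simp
  qed
  ultimately have "l' = l" by linarith
  with l'(2) show ?thesis by simp
qed

text \<open>A block is represented by its first position. The next block is reached by moving to the
  next b and from there to the next a, the previous one by moving to the nearest a on the left and
  then back within its run; each such move is a quantifier guarded by the absence of one letter.
  Future and past become quantifiers restricted to block starts.\<close>

lemma tdef_translate:
  assumes "tdef P"
  shows "\<exists>Q. fo1 Q \<and> (\<forall>j s i l. l < length s \<longrightarrow>
           (Q (word j s i) (pos j s l) \<longleftrightarrow> P (map (trunc N) s) l))"
  using assms
proof induction
  case (tdef_letter c)
  obtain p0 q0 where c: "c = (p0, q0)" by (cases c)
  \<comment> \<open>From x on there are at least \<open>Suc k\<close> letters \<open>d\<close> and,
    unless k has reached the threshold \<open>N\<close>, no more. This matches the truncated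
    exponent k.\<close>
  define run where "run = (\<lambda>d k w x. k \<le> N \<and> take (length (replicate (Suc k) (d :: 'a))) (drop x w) = replicate (Suc k) d \<and>
    (N \<le> k \<or> \<not> take (length (replicate (Suc (Suc k)) d)) (drop x w) = replicate (Suc (Suc k)) d))"
  have fo1_run: "fo1 (run d k)" for d k
    unfolding run_def
    by (intro tdef_imp_fo1[OF _ UNIV_ab] tdef_and tdef_or tdef_not tdef_const tdef_factor)
  let ?Q = "\<lambda>w x. run a p0 w x \<and>
    (\<exists>y<length w. (x < y \<and> b \<notin> bet w x y) \<and> w ! y = b \<and> run b q0 w y)"
  show ?case
  proof (intro exI[of _ ?Q] conjI allI impI)
    show "fo1 ?Q" by (intro fo1_and fo1_until fo1_letter fo1_run)
    fix j i l and s :: "(nat \<times> nat) list" assume l: "l < length s"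
    obtain p q where pq: "s ! l = (p, q)" by (cases "s ! l")
    note f = block_facts[OF l pq]
    have "run a p0 (word j s i) (pos j s l) \<longleftrightarrow> min p N = p0"
      unfolding run_def length_replicate f(4) by auto
    moreover have "run b q0 (word j s i) (pos j s l + Suc p) \<longleftrightarrow> min q N = q0"
      unfolding run_def length_replicate f(5) by auto
    moreover have "(\<exists>y<length (word j s i). (pos j s l < y \<and> b \<notin> bet (word j s i) (pos j s l) y) \<and>
        word j s i ! y = b \<and> run b q0 (word j s i) y) \<longleftrightarrow> run b q0 (word j s i) (pos j s l + Suc p)"
      by (rule until_unique[OF _ f(1,2,3)]) simp
    ultimately show "?Q (word j s i) (pos j s l) \<longleftrightarrow> map (trunc N) s ! l = c"
      using l by (simp add: pq c trunc_def)
  qed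
next
  case (tdef_not P)
  then obtain Q where "fo1 Q" "\<forall>j s i l. l < length s \<longrightarrow>
           (Q (word j s i) (pos j s l) \<longleftrightarrow> P (map (trunc N) s) l)" by blast
  then show ?case by (intro exI[of _ "\<lambda>w x. \<not> Q w x"]) (simp add: fo1_not)
next
  case (tdef_and P P')
  then obtain Q Q' where "fo1 Q" "fo1 Q'" "\<forall>j s i l. l < length s \<longrightarrow>
           (Q (word j s i) (pos j s l) \<longleftrightarrow> P (map (trunc N) s) l)"
    "\<forall>j s i l. l < length s \<longrightarrow>
           (Q' (word j s i) (pos j s l) \<longleftrightarrow> P' (map (trunc N) s) l)" by blast
  then show ?case by (intro exI[of _ "\<lambda>w x. Q w x \<and> Q' w x"]) (simp add: fo1_and)
next
  case (tdef_next P)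
  then obtain Q where Q: "fo1 Q" "\<And>j s i l. l < length s \<Longrightarrow>
           (Q (word j s i) (pos j s l) \<longleftrightarrow> P (map (trunc N) s) l)" by blast
  \<comment> \<open>After the last block the next a, if any, is a trailing one;
    \<open>is_start\<close> rejects it.\<close>
  let ?Q1 = "\<lambda>w x. \<exists>y<length w. (x < y \<and> a \<notin> bet w x y) \<and> w ! y = a \<and> is_start w y \<and> Q w y"
  let ?Q = "\<lambda>w x. \<exists>y<length w. (x < y \<and> b \<notin> bet w x y) \<and> w ! y = b \<and> ?Q1 w y"
  show ?case
  proof (intro exI[of _ ?Q] conjI allI impI)
    show "fo1 ?Q" by (intro fo1_until fo1_and fo1_letter fo1_is_start Q)
    fix j i l and s :: "(nat \<times> nat) list" assume l: "l < length s"
    let ?w = "word j s i"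
    obtain p q where pq: "s ! l = (p, q)" by (cases "s ! l")
    note f = block_facts[OF l pq]
    have "?Q ?w (pos j s l) \<longleftrightarrow> ?Q1 ?w (pos j s l + Suc p)"
      by (rule until_unique[OF _ f(1,2,3)]) simp
    also have "\<dots> \<longleftrightarrow> Suc l < length s \<and> P (map (trunc N) s) (Suc l)"
    proof (cases "Suc l < length s")
      case True
      have "?Q1 ?w (pos j s l + Suc p) \<longleftrightarrow> is_start ?w (pos j s (Suc l)) \<and> Q ?w (pos j s (Suc l))"
        using until_unique[where Q = "\<lambda>w y. is_start w y \<and> Q w y", OF _ pos_less_length[OF True, of j i], of "pos j s l + Suc p" a]
          f(7)[OF True] f(8) unfolding f(6) by simp
      with Q(2)[OF True] is_start_pos[OF True] True show ?thesis by simp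
    next
      case False
      have "\<not> is_start ?w y" if y: "y < length ?w" "pos j s l + Suc p < y" for y
      proof
        assume "is_start ?w y"
        then obtain l' where l': "l' < length s" "y = pos j s l'" using start_is_pos y(1) by blast
        then have "l < l'" using pos_less_iff[OF l l'(1), of j] y(2) by simp
        with False l' show False by simp
      qed
      with False show ?thesis by blast
    qed
    finally show "?Q ?w (pos j s l) \<longleftrightarrow>
        Suc l < length (map (trunc N) s) \<and> P (map (trunc N) s) (Suc l)" by simp
  qed
next
  case (tdef_prev P)
  then obtain Q where Q: "fo1 Q" "\<And>j s i l. l < length s \<Longrightarrow>
           (Q (word j s i) (pos j s l) \<longleftrightarrow> P (map (trunc N) s) l)" by blast
  \<comment> \<open>Here x is the last a of the previous block. It is the start itself if the run
    has length one; otherwise the start is the block start to its left with no b in between.\<close>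
  let ?Q1 = "\<lambda>w x. (is_start w x \<and> Q w x) \<or>
    (\<exists>y<length w. (y < x \<and> b \<notin> bet w x y) \<and> is_start w y \<and> Q w y)"
  let ?Q = "\<lambda>w x. \<exists>y<length w. (y < x \<and> a \<notin> bet w x y) \<and> w ! y = a \<and> ?Q1 w y"
  show ?case
  proof (intro exI[of _ ?Q] conjI allI impI)
    show "fo1 ?Q" by (intro fo1_since fo1_and fo1_or fo1_letter fo1_is_start Q)
    fix j i l and s :: "(nat \<times> nat) list" assume l: "l < length s"
    let ?w = "word j s i"
    show "?Q ?w (pos j s l) \<longleftrightarrow> 0 < l \<and> P (map (trunc N) s) (l - 1)"
    proof (cases l)
      case 0
      obtain p q where pq: "s ! l = (p, q)" by (cases "s ! l")
      have "?w ! y = b" if "y < pos j s l" for y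
        by (rule block_facts(12)[OF l pq 0 that])
      with 0 a_neq_b show ?thesis by auto
    next
      case (Suc m)
      then have m: "m < length s" using l by simp
      obtain p q where pq: "s ! m = (p, q)" by (cases "s ! m")
      note f = block_facts[OF m pq]
      let ?x = "pos j s m" and ?z = "pos j s m + p"
      have next_pos: "pos j s l = ?x + Suc p + Suc q" unfolding Suc by (rule f(6))
      have len: "?x < length ?w" "?z < length ?w" using f(1)[where j = j and i = i] by simp_all
      have "?Q ?w (pos j s l) \<longleftrightarrow> ?Q1 ?w ?z"
        by (rule since_unique[OF _ pos_less_length[OF l] f(9)]) (use f(10) in \<open>simp_all add: next_pos\<close>)
      also have "\<dots> \<longleftrightarrow> Q ?w ?x"
      proof
        assume "?Q1 ?w ?z"
        then show "Q ?w ?x"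
        proof (elim disjE exE conjE)
          assume z: "is_start ?w ?z" "Q ?w ?z"
          have "?z = ?x" by (rule start_unique_between[OF m z(1) len(2)]) (simp_all add: f(6))
          with z(2) show ?thesis by simp
        next
          fix y assume y: "y < length ?w" "y < ?z" "b \<notin> bet ?w ?z y" "is_start ?w y" "Q ?w y"
          have "?x \<le> y"
          proof (rule ccontr)
            assume "\<not> ?x \<le> y"
            obtain k where k: "k < length s" "y = pos j s k" using start_is_pos[OF y(4,1)] by blast
            then have "k < m" using pos_less_iff[OF k(1) m, of j] \<open>\<not> ?x \<le> y\<close> by simp
            obtain p' q' where pq': "s ! k = (p', q')" by (cases "s ! k")
            note g = block_facts[OF k(1) pq']
            have "pos j s (Suc k) \<le> ?x"
              using pos_less[of "Suc k" m s j] m \<open>k < m\<close> by (cases "Suc k = m") auto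
            then have "y + Suc p' < ?z" unfolding g(6) k(2) by simp
            then have "b \<in> bet ?w y ?z"
              using bet_memI[of y "y + Suc p'" ?z ?w] g(1,2)[where j = j and i = i] unfolding k(2) by simp
            then show False using y(3) bet_commute by metis
          qed
          then have "y = ?x" using start_unique_between[OF m y(4,1)] y(2) by (simp add: f(6))
          with y(5) show ?thesis by simp
        qed
      next
        assume q: "Q ?w ?x"
        show "?Q1 ?w ?z"
        proof (cases "p = 0")
          case True
          then show ?thesis using q is_start_pos[OF m] by simp
        next
          case False
          moreover have "b \<notin> bet ?w ?z ?x" unfolding bet_commute[of ?w ?z] by (rule f(11))
          ultimately show ?thesis using q is_start_pos[OF m, of j i] len(1)
            by (intro disjI2 exI[of _ ?x]) simp
        qed
      qed
      also have "\<dots> \<longleftrightarrow> P (map (trunc N) s) m" by (rule Q(2)[OF m])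
      finally show ?thesis by (simp add: Suc)
    qed
  qed
next
  case (tdef_fut P)
  then obtain Q where Q: "fo1 Q" "\<And>j s i l. l < length s \<Longrightarrow>
           (Q (word j s i) (pos j s l) \<longleftrightarrow> P (map (trunc N) s) l)" by blast
  let ?Q = "\<lambda>w x. \<exists>y. x < y \<and> y < length w \<and> is_start w y \<and> Q w y"
  show ?case
  proof (intro exI[of _ ?Q] conjI allI impI)
    show "fo1 ?Q" by (intro fo1_fut fo1_and fo1_is_start Q)
    fix j i l and s :: "(nat \<times> nat) list" assume l: "l < length s"
    let ?w = "word j s i"
    show "?Q ?w (pos j s l) \<longleftrightarrow> (\<exists>k. l < k \<and> k < length (map (trunc N) s) \<and> P (map (trunc N) s) k)"
    proof
      assume "?Q ?w (pos j s l)"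
      then obtain y where y: "pos j s l < y" "y < length ?w" "is_start ?w y" "Q ?w y" by blast
      then obtain k where k: "k < length s" "y = pos j s k" using start_is_pos by blast
      then show "\<exists>k. l < k \<and> k < length (map (trunc N) s) \<and> P (map (trunc N) s) k"
        using y pos_less_iff[OF l k(1)] Q(2)[OF k(1)] by (intro exI[of _ k]) auto
    next
      assume "\<exists>k. l < k \<and> k < length (map (trunc N) s) \<and> P (map (trunc N) s) k"
      then obtain k where k: "l < k" "k < length s" "P (map (trunc N) s) k" by auto
      then show "?Q ?w (pos j s l)"
        using pos_less_iff[OF l k(2), of j] Q(2)[OF k(2)] is_start_pos[OF k(2)] pos_less_length[OF k(2)]
        by (intro exI[of _ "pos j s k"]) auto
    qed
  qed
next
  case (tdef_past P)
  then obtain Q where Q: "fo1 Q" "\<And>j s i l. l < length s \<Longrightarrow>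
           (Q (word j s i) (pos j s l) \<longleftrightarrow> P (map (trunc N) s) l)" by blast
  let ?Q = "\<lambda>w x. \<exists>y<x. is_start w y \<and> Q w y"
  show ?case
  proof (intro exI[of _ ?Q] conjI allI impI)
    show "fo1 ?Q" by (intro fo1_past fo1_and fo1_is_start Q)
    fix j i l and s :: "(nat \<times> nat) list" assume l: "l < length s"
    let ?w = "word j s i"
    show "?Q ?w (pos j s l) \<longleftrightarrow> (\<exists>k<l. P (map (trunc N) s) k)"
    proof
      assume "?Q ?w (pos j s l)"
      then obtain y where y: "y < pos j s l" "is_start ?w y" "Q ?w y" by blast
      then have "y < length ?w" using pos_less_length[OF l] less_trans by blast
      then obtain k where k: "k < length s" "y = pos j s k" using start_is_pos y by blast
      then show "\<exists>k<l. P (map (trunc N) s) k"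
        using y pos_less_iff[OF k(1) l] Q(2)[OF k(1)] by (intro exI[of _ k]) auto
    next
      assume "\<exists>k<l. P (map (trunc N) s) k"
      then obtain k where k: "k < l" "P (map (trunc N) s) k" by auto
      then have "k < length s" using l by simp
      then show "?Q ?w (pos j s l)"
        using k pos_less_iff[of k s l j] l Q(2)[of k s j i] is_start_pos[of k s j i]
        by (intro exI[of _ "pos j s k"]) auto
    qed
  qed
next
  case (tdef_cong P P')
  then obtain Q where Q: "fo1 Q" "\<And>j s i l. l < length s \<Longrightarrow>
           (Q (word j s i) (pos j s l) \<longleftrightarrow> P (map (trunc N) s) l)" by blast
  then show ?case using tdef_cong.hyps(2) by (intro exI[of _ Q]) simp
qed

lemma blocks_definable:
  assumes "tdef_on {s. set s \<subseteq> {..N} \<times> {..N}} D"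
  shows "\<exists>X. FO2Inv_definable X \<and> (\<forall>j s i. word j s i \<in> X \<longleftrightarrow> map (trunc N) s \<in> D)"
proof -
  from assms obtain P where P: "tdef P"
    "\<forall>s\<in>{s. set s \<subseteq> {..N} \<times> {..N}}. s \<noteq> [] \<longrightarrow> (s \<in> D \<longleftrightarrow> P s 0)" unfolding tdef_on_def by blast
  obtain Q where Q: "fo1 Q" "\<And>j s i l. l < length s \<Longrightarrow>
           (Q (word j s i) (pos j s l) \<longleftrightarrow> P (map (trunc N) s) l)"
    using tdef_translate[OF P(1)] by blast
  let ?first = "\<lambda>w x. is_start w x \<and> \<not> (\<exists>y<x. is_start w y) \<and> Q w x"
  \<comment> \<open>A word without any block start has an empty block sequence, whose membership
    enters as the constant \<open>[] \<in> D\<close>.\<close>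
  define X where "X = {w. \<exists>x<length w. ?first w x} \<union> (- {w. \<exists>x<length w. is_start w x} \<inter> {w. [] \<in> D})"
  have "FO2Inv_definable X"
    unfolding X_def
    by (intro FO2Inv_definable_Un FO2Inv_definable_Int FO2Inv_definable_Compl FO2Inv_definable_const
        FO2Inv_definable_fo1 fo1_and fo1_not fo1_past fo1_is_start Q)
  moreover have "word j s i \<in> X \<longleftrightarrow> map (trunc N) s \<in> D" for j s i
  proof (cases "s = []")
    case True
    then have "\<not> is_start (word j s i) x" if "x < length (word j s i)" for x
      using start_is_pos[of j s i x] that by auto
    then show ?thesis using True by (auto simp: X_def)
  next
    case False
    then have s: "0 < length s" by simp
    let ?w = "word j s i"
    have x: "pos j s 0 < length ?w" "is_start ?w (pos j s 0)"
      using pos_less_length[OF s] is_start_pos[OF s] by auto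
    have before: "\<not> is_start ?w y" if "y < pos j s 0" for y
    proof
      assume y: "is_start ?w y"
      have "y < length ?w" using that x(1) by simp
      from start_is_pos[OF y this] obtain l where l: "l < length s" "y = pos j s l" by blast
      then show False using that pos_less_iff[OF l(1) s, of j] by simp
    qed
    have "?w \<in> X \<longleftrightarrow> (\<exists>y<length ?w. ?first ?w y)" using x by (auto simp: X_def)
    also have "\<dots> \<longleftrightarrow> Q ?w (pos j s 0)"
    proof
      assume "\<exists>y<length ?w. ?first ?w y"
      then obtain y where y: "y < length ?w" "?first ?w y" by blast
      have "y = pos j s 0"
        using before[of y] y x by (cases y "pos j s 0" rule: linorder_cases) auto
      with y show "Q ?w (pos j s 0)" by simp
    next
      assume "Q ?w (pos j s 0)"
      with x before show "\<exists>y<length ?w. ?first ?w y" by blast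
    qed
    also have "\<dots> \<longleftrightarrow> P (map (trunc N) s) 0" by (rule Q(2)[OF s])
    also have "\<dots> \<longleftrightarrow> map (trunc N) s \<in> D"
    proof -
      have "set (map (trunc N) s) \<subseteq> {..N} \<times> {..N}" by (auto simp: trunc_def)
      then show ?thesis using P(2) False by simp
    qed
    finally show ?thesis .
  qed
  ultimately show ?thesis by blast
qed

lemma FO2Inv_definable_tdef_on:
  assumes "tdef_on UNIV D"
  shows "FO2Inv_definable (D :: 'a list set)"
proof -
  from assms obtain P where P: "tdef P" "\<And>w. w \<noteq> [] \<Longrightarrow> w \<in> D \<longleftrightarrow> P w 0" unfolding tdef_on_def by blast
  let ?X = "{w. \<exists>x<length w. \<not> (\<exists>y<x. True) \<and> P w x} \<union> (- {w. \<exists>x<length w. True} \<inter> {w. [] \<in> D})"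
  have "w \<in> ?X \<longleftrightarrow> w \<in> D" for w
  proof -
    have "\<not> (\<exists>y<x. True) \<longleftrightarrow> x = 0" for x :: nat by auto
    then show ?thesis using P(2)[of w] by (cases "w = []") auto
  qed
  then have "?X = D" by blast
  moreover have "FO2Inv_definable ?X"
    by (intro FO2Inv_definable_Un FO2Inv_definable_Int FO2Inv_definable_Compl FO2Inv_definable_const
        FO2Inv_definable_fo1 tdef_imp_fo1[OF _ UNIV_ab] tdef_and tdef_not tdef_past tdef_True P)
  ultimately show ?thesis by simp
qed

section \<open>Sufficiency: the outer runs, the value of the blocks and their combination\<close>

lemma leading_definable: "FO2Inv_definable {w. take m w = replicate m b}"
  by (intro FO2Inv_definable_tdef_on tdef_on_take)

lemma leading_iff: "take m (word j s i) = replicate m b \<longleftrightarrow> m \<le> j"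
proof -
  let ?v = "enc s @ replicate i a"
  have "?v = [] \<or> hd ?v \<noteq> b" using a_neq_b by (cases s; cases "i = 0") (auto simp: hd_append)
  then show ?thesis unfolding word_def by (rule take_replicate_append_iff)
qed

lemma trailing_definable: "FO2Inv_definable {w. take m (rev w) = replicate m a}"
proof (rule FO2Inv_definable_tdef_on)
  have "range rev = (UNIV :: 'a list set)" by (rule surjI[of _ rev]) simp
  with tdef_on_rev[OF tdef_on_take[of UNIV m "replicate m a"]]
  show "tdef_on UNIV {w. take m (rev w) = replicate m a}" by simp
qed

lemma trailing_iff: "take m (rev (word j s i)) = replicate m a \<longleftrightarrow> m \<le> i"
proof -
  let ?u = "rev (replicate j b @ enc s)"
  have "?u = [] \<or> hd ?u \<noteq> a"
  proof (cases "replicate j b @ enc s = []")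
    case False
    then have "hd ?u = b" using last_before_start[of j s] by (simp only: hd_rev simp_thms)
    with a_neq_b show ?thesis by simp
  qed simp
  then have "take m (replicate i a @ ?u) = replicate m a \<longleftrightarrow> m \<le> i"
    by (rule take_replicate_append_iff)
  then show ?thesis by (simp add: word_def)
qed

text \<open>The encoding of a nonempty block sequence contains both letters, so the letter
  conditions of \<open>MeDA_identity\<close> hold automatically. For \<open>f\<close> an idempotent
  power of c d, both c and d are factors of \<open>f\<close> and are absorbed by it.\<close>

lemma locally_DA_synclass:
  fixes L :: "'a list set"
  assumes MeDA: "MeDA (syntactic_monoid L)"
  shows "locally_DA (\<lambda>s. synclass L (enc s))"
proof
  show "finite (range (\<lambda>s. synclass L (enc s)))"
    by (rule finite_subset[of _ "range (synclass L)"]) (use MeDA in \<open>auto simp: MeDA_def\<close>)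
  show "synclass L (enc (u @ v)) = synclass L (enc (u' @ v'))"
    if "synclass L (enc u) = synclass L (enc u')" "synclass L (enc v) = synclass L (enc v')" for u u' v v'
    using synclass_append_cong[OF that] by simp
  show "\<exists>k\<ge>1. synclass L (enc (pw (Suc k) s)) = synclass L (enc (pw k s))" for s
    unfolding enc_pw by (rule MeDA_aperiodic[OF MeDA]) blast
next
  fix x c c' d d' :: "(nat \<times> nat) list"
  assume x: "x \<noteq> []" "synclass L (enc (x @ x)) = synclass L (enc x)"
    and c: "c = x @ c' @ x" and d: "d = x @ d' @ x"
  let ?X = "enc x" and ?c = "enc c" and ?d = "enc d"
  have XX: "synclass L (?X @ ?X) = synclass L ?X" using x(2) by simp
  have absorb: "synclass L (u @ ?X @ ?X @ v) = synclass L (u @ ?X @ v)" for u v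
    using synclass_append_cong[OF refl synclass_append_cong[OF XX refl]] by simp
  obtain p q x' where "x = (p, q) # x'" using x(1) by (cases x) auto
  then have full: "set v \<subseteq> set ?X" for v using UNIV_ab by auto
  have "finite (range (synclass L))" using MeDA by (simp add: MeDA_def)
  then obtain k where k: "k \<ge> 1"
    "synclass L (pw k (?c @ ?d) @ pw k (?c @ ?d)) = synclass L (pw k (?c @ ?d))"
    by (rule finite_idempotent_power)
  then obtain l where l: "k = Suc l" by (cases k) auto
  define f where "f = pw k (?c @ ?d)"
  define g where "g = pw l (?c @ ?d)"
  have f: "f = ?c @ ?d @ g" "f = g @ ?c @ ?d"
    using pw_commute[of "?c @ ?d" l] by (simp_all add: f_def g_def l)
  have ff: "synclass L (f @ f) = synclass L f" using k(2) by (simp add: f_def)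
  have Xf: "synclass L (?X @ f @ u) = synclass L (f @ u)" for u
    using absorb[of "[]" "enc c' @ ?X @ ?d @ g @ u"] by (simp add: f(1) c)
  have fX: "synclass L (u @ f @ ?X) = synclass L (u @ f)" for u
    using absorb[of "u @ g @ ?c @ ?X @ enc d'" "[]"] by (simp add: f(2) d)
  have fff: "synclass L (f @ f @ f) = synclass L f"
    using synclass_append_cong[OF refl ff, of f] ff by simp
  \<comment> \<open>Writing \<open>f\<close> as a cube and its middle copy as c d g puts c and d in
    the interior, with words on both sides as the identity requires.\<close>
  have fold: "synclass L f = synclass L (?X @ f @ (?c @ ?d @ g) @ f @ ?X)"
  proof -
    have "f @ f @ f = f @ (?c @ ?d @ g) @ f" using f(1) by (rule arg_cong)
    then have "synclass L f = synclass L (f @ (?c @ ?d @ g) @ f)" using fff by (simp only:)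
    also have "\<dots> = synclass L (?X @ f @ (?c @ ?d @ g) @ f)" by (rule Xf[symmetric])
    also have "\<dots> = synclass L (?X @ f @ (?c @ ?d @ g) @ f @ ?X)"
      using fX[of "?X @ f @ ?c @ ?d @ g"] by simp
    finally show ?thesis .
  qed
  then have "synclass L f = synclass L (?X @ f @ ?X @ enc c' @ ?X @ (?d @ g @ f) @ ?X)"
    by (simp add: c)
  from MeDA_identity[OF MeDA XX ff full full full this]
  have fc: "synclass L (f @ ?c @ f) = synclass L f" by (simp add: c)
  from fold have "synclass L f = synclass L (?X @ (f @ ?c) @ ?X @ enc d' @ ?X @ (g @ f) @ ?X)"
    by (simp add: d)
  from MeDA_identity[OF MeDA XX ff full full full this]
  have fd: "synclass L (f @ ?d @ f) = synclass L f" by (simp add: d)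
  from fc fd show "\<exists>k. synclass L (enc (pw k (c @ d) @ d @ pw k (c @ d))) = synclass L (enc (pw k (c @ d))) \<and>
      synclass L (enc (pw k (c @ d) @ c @ pw k (c @ d))) = synclass L (enc (pw k (c @ d)))"
    unfolding f_def by (intro exI[of _ k]) (simp add: enc_pw)
qed

lemma synclass_trunc:
  fixes L :: "'a list set"
  assumes "MeDA (syntactic_monoid L)"
  obtains N where "\<And>j s i. synclass L (word j s i) =
    synclass L (word (min j N) (map (trunc N) s) (min i N))"
proof -
  have pw_single: "pw k [c] = replicate k c" for k and c :: 'a by (induction k) auto
  obtain ka where ka: "\<And>l. l \<ge> ka \<Longrightarrow> synclass L (pw l [a]) = synclass L (pw ka [a])"
    by (rule MeDA_aperiodic_uniform[OF assms]) blast
  obtain kb where kb: "\<And>l. l \<ge> kb \<Longrightarrow> synclass L (pw l [b]) = synclass L (pw kb [b])"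
    by (rule MeDA_aperiodic_uniform[OF assms]) blast
  define N where "N = max ka kb"
  have eq: "synclass L (replicate l c) = synclass L (replicate l' c)"
    if "l = l' \<or> (N \<le> l \<and> N \<le> l')" for l l' c
  proof -
    have "c = a \<or> c = b" using UNIV_ab by auto
    then show ?thesis
      using that ka[of l] ka[of l'] kb[of l] kb[of l'] unfolding pw_single N_def by auto
  qed
  have enc_trunc: "synclass L (enc s) = synclass L (enc (map (trunc N) s))" for s
  proof (induction s)
    case (Cons pq s)
    obtain p q where pq: "pq = (p, q)" by (cases pq)
    have "synclass L (replicate (Suc p) a @ replicate (Suc q) b @ enc s) =
      synclass L (replicate (Suc (min p N)) a @ replicate (Suc (min q N)) b @ enc (map (trunc N) s))"
      by (intro synclass_append_cong eq Cons) auto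
    then show ?case by (simp add: pq trunc_def)
  qed simp
  show ?thesis
  proof (rule that[of N])
    show "synclass L (word j s i) = synclass L (word (min j N) (map (trunc N) s) (min i N))" for j s i
      unfolding word_def by (intro synclass_append_cong eq enc_trunc) auto
  qed
qed

theorem MeDA_imp_definable:
  fixes L :: "'a list set"
  assumes MeDA: "MeDA (syntactic_monoid L)"
  shows "FO2Inv_definable L"
proof -
  obtain N where N: "\<And>j s i. synclass L (word j s i) =
      synclass L (word (min j N) (map (trunc N) s) (min i N))"
    by (rule synclass_trunc[OF MeDA]) blast
  define lead where "lead = (\<lambda>m. {w. take m w = replicate m b})"
  define trail where "trail = (\<lambda>m. {w. take m (rev w) = replicate m a})"
  have lead: "FO2Inv_definable (lead m)" "word j s i \<in> lead m \<longleftrightarrow> m \<le> j"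
    and trail: "FO2Inv_definable (trail m)" "word j s i \<in> trail m \<longleftrightarrow> m \<le> i" for m j s i
    by (simp_all add: lead_def trail_def leading_definable trailing_definable leading_iff trailing_iff)
  have "tdef_on {s. set s \<subseteq> {..N} \<times> {..N}} {s. synclass L (enc s) = synclass L (enc t)}" for t
    by (rule locally_DA_tdef[OF locally_DA_synclass[OF MeDA]]) simp
  from blocks_definable[OF this] obtain mid where mid: "\<And>t. FO2Inv_definable (mid t)"
    "\<And>t j s i. word j s i \<in> mid t \<longleftrightarrow> synclass L (enc (map (trunc N) s)) = synclass L (enc t)"
    unfolding mem_Collect_eq by metis
  \<comment> \<open>Exactly m leading b's for m below \<open>N\<close>, and at least
    \<open>N\<close> of them for m = \<open>N\<close>.\<close>
  define lead' where "lead' = (\<lambda>m. if m < N then lead m \<inter> - lead (Suc m) else lead m)"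
  define trail' where "trail' = (\<lambda>m. if m < N then trail m \<inter> - trail (Suc m) else trail m)"
  have lead': "FO2Inv_definable (lead' m)" "m \<le> N \<Longrightarrow> word j s i \<in> lead' m \<longleftrightarrow> min j N = m" for m j s i
    using lead by (auto simp: lead'_def intro: FO2Inv_definable_Int FO2Inv_definable_Compl)
  have trail': "FO2Inv_definable (trail' m)" "m \<le> N \<Longrightarrow> word j s i \<in> trail' m \<longleftrightarrow> min i N = m" for m j s i
    using trail by (auto simp: trail'_def intro: FO2Inv_definable_Int FO2Inv_definable_Compl)
  have "finite (range (\<lambda>s. synclass L (enc s)))"
    by (rule locally_DA.finite_val[OF locally_DA_synclass[OF MeDA]])
  then obtain T where T: "finite T" "(\<lambda>s. synclass L (enc s)) ` T = range (\<lambda>s. synclass L (enc s))"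
    using finite_subset_image[OF _ order_refl] by metis
  \<comment> \<open>The truncated outer exponents and a representative of the block part determine
    the class of a word, so \<open>L\<close> is the union of the pieces indexed by those finitely
    many triples whose word lies in \<open>L\<close>.\<close>
  define I where "I = {(j, t, i). j \<le> N \<and> i \<le> N \<and> t \<in> T \<and> word j t i \<in> L}"
  have "finite I"
    by (rule finite_subset[of _ "{..N} \<times> T \<times> {..N}"]) (use T(1) in \<open>auto simp: I_def\<close>)
  then have "FO2Inv_definable (\<Union>(j, t, i)\<in>I. lead' j \<inter> mid t \<inter> trail' i)"
    by (rule FO2Inv_definable_UN)
      (auto intro: FO2Inv_definable_Int lead'(1) mid(1) trail'(1))
  moreover have "w \<in> (\<Union>(j, t, i)\<in>I. lead' j \<inter> mid t \<inter> trail' i) \<longleftrightarrow> w \<in> L" for w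
  proof -
    obtain j s i where w: "w = word j s i" using word_exists by blast
    have key: "w \<in> L \<longleftrightarrow> word (min j N) t (min i N) \<in> L"
      if "synclass L (enc (map (trunc N) s)) = synclass L (enc t)" for t
    proof (rule synclass_mem)
      have "synclass L w = synclass L (word (min j N) (map (trunc N) s) (min i N))"
        unfolding w by (rule N)
      also have "\<dots> = synclass L (word (min j N) t (min i N))"
        unfolding word_def by (intro synclass_append_cong refl that)
      finally show "synclass L w = synclass L (word (min j N) t (min i N))" .
    qed
    show ?thesis
    proof
      assume "w \<in> (\<Union>(j, t, i)\<in>I. lead' j \<inter> mid t \<inter> trail' i)"
      then obtain j' t i' where "(j', t, i') \<in> I" "w \<in> lead' j'" "w \<in> mid t" "w \<in> trail' i'" by auto
      moreover from this have "min j N = j'" "min i N = i'"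
        using lead'(2)[of j' j s i] trail'(2)[of i' j s i] by (auto simp: I_def w)
      ultimately show "w \<in> L" using key[of t] mid(2)[of j s i t] by (auto simp: I_def w)
    next
      assume "w \<in> L"
      have "synclass L (enc (map (trunc N) s)) \<in> (\<lambda>s. synclass L (enc s)) ` T" unfolding T(2) by blast
      then obtain t where t: "t \<in> T" "synclass L (enc (map (trunc N) s)) = synclass L (enc t)" by blast
      have "(min j N, t, min i N) \<in> I" using key[OF t(2)] \<open>w \<in> L\<close> t(1) by (simp add: I_def)
      moreover have "w \<in> lead' (min j N) \<inter> mid t \<inter> trail' (min i N)"
        using lead'(2)[of "min j N" j s i] trail'(2)[of "min i N" j s i] mid(2)[of j s i t] t(2)
        by (simp add: w)
      ultimately show "w \<in> (\<Union>(j, t, i)\<in>I. lead' j \<inter> mid t \<inter> trail' i)" by blast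
    qed
  qed
  then have "(\<Union>(j, t, i)\<in>I. lead' j \<inter> mid t \<inter> trail' i) = L" by blast
  ultimately show ?thesis by simp
qed

end

theorem theorem6:
  fixes L :: "'a::finite list set"
  shows "(FO2Inv_definable L \<longrightarrow> MeDA (syntactic_monoid L)) \<and>
         (card (UNIV :: 'a set) = 2 \<and> MeDA (syntactic_monoid L) \<longrightarrow> FO2Inv_definable L)"
proof (intro conjI impI)
  show "MeDA (syntactic_monoid L)" if "FO2Inv_definable L"
    using that by (rule definable_imp_MeDA)
  assume *: "card (UNIV :: 'a set) = 2 \<and> MeDA (syntactic_monoid L)"
  then obtain a b :: 'a where "UNIV = {a, b}" "a \<noteq> b" by (auto simp: card_2_iff)
  then interpret two_letters a b by unfold_locales
  from * show "FO2Inv_definable L" using MeDA_imp_definable by blast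
qed

end
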